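(* Let $a\ge b>0$, $r>0$, $\varepsilon=\sqrt{a^2-b^2}/a$. Let $K_0\subset\mathbb{R}^2$ be a fixed closed disk of radius $r$ with boundary circle $C_0$, and let $C_1$ be a moving oriented ellipse with semi-major axis of length $a$ and semi-minor axis of length $b$, bounding the closed region $K_1$. With respect to the kinematic measure $m$ on the positions of $C_1$, let $$m_{\mathrm i}^{10}=m(\{C_1: C_1\subset K_0\}),\quad m_{\mathrm i}^{01}=m(\{C_1: C_0\subset K_1\}),\quad m_{2j}=m(\{C_1:\#(C_0\cap C_1)=2j\}),\ j\in\{1,2\}.$$ Then the measures of all oriented ellipses $C_1$ which intersect $C_0$ in two and four points, respectively, are $$m_2=4\pi^2r^2+4\pi^2ab-2m_{\mathrm i},\qquad m_4=8\pi ra\,E(\varepsilon)-2\pi^2r^2-2\pi^2ab+m_{\mathrm i},$$ where $$m_{\mathrm i}=\begin{cases} m_{\mathrm i}^{10}=2\pi A_{\mathrm i}^{10} & \text{if } a<r,\\ 0 & \text{if } b\le r\le a,\\ m_{\mathrm i}^{01}=2\pi A_{\mathrm i}^{01} & \text{if } b>r,\end{cases}$$ and, for $a<r$, $$A_{\mathrm i}^{10}=\begin{cases}\pi r^2+\pi ab-4ra\,E(\varepsilon) & \text{if } a^2/b\le r,\\ F(\beta) & \text{if } a^2/b>r,\end{cases}$$ and, for $b>r$, $$A_{\mathrm i}^{01}=\begin{cases}\widetilde F(\alpha) & \text{if } b^2/a<r,\\ \pi r^2+\pi ab-4ra\,E(\varepsilon) & \text{if } b^2/a\ge r.\end{cases}$$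 Here $$F(\phi)=2r^2\phi+2ab\arctan\Big(\frac ba\tan\phi\Big)-4ra\,E(\phi,\varepsilon)+\frac{ra\,\varepsilon^2\sin 2\phi}{\sqrt{1-\varepsilon^2\sin^2\phi}},$$ $$\widetilde F(\phi)=\pi r^2+\pi ab-4ra\,E(\varepsilon)-F(\phi),$$ $$\alpha=\arctan\frac{\sqrt{r^2a^2-b^4}}{b\sqrt{b^2-r^2}},\qquad \beta=\arctan\frac{a\sqrt{r^2-a^2}}{\sqrt{a^4-r^2b^2}}.$$
   Context: A position of the oriented ellipse $C_1$ is described by the coordinates $(x_1,y_1)\in\mathbb{R}^2$ of its center $M_1$ and the angle $\psi\in[0,2\pi)$ between the $x$-axis of the fixed frame and the $\xi$-axis of a frame attached to $C_1$ with origin $M_1$. The kinematic measure $m$ of a set of positions is its measure with respect to the kinematic density $\mathrm dx_1\wedge\mathrm dy_1\wedge\mathrm d\psi$ (Lebesgue measure, taken non-negative). $\#(C_0\cap C_1)$ is the number of real intersection points of $C_0$ and $C_1$, counted with intersection multiplicity. $E(\phi,\varepsilon)=\int_0^{\phi}\sqrt{1-\varepsilon^2\sin^2\theta}\,\mathrm d\theta$ is the incomplete elliptic integral of the second kind, and $E(\varepsilon)=E(\pi/2,\varepsilon)$ the complete one. $A_{\mathrm i}^{10}$ and $A_{\mathrm i}^{01}$ are the areas of the sets of positions of the center $M_1$, for fixed direction $\psi$, for which $C_1\subset K_0$ and $C_0\subset K_1$, respectively. *)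

theory Defs
  imports "HOL-Analysis.Analysis"
begin

text \<open>Planar points are elements of \<^typ>\<open>real \<times> real\<close>, whose metric is Euclidean, so \<^term>\<open>cball c r\<close>
  and \<^term>\<open>sphere c r\<close> are the disk \<open>K\<^sub>0\<close> and the circle \<open>C\<^sub>0\<close>. A position \<^term>\<open>(x, y, \<psi>)\<close> of the moving
  frame consists of its origin \<open>M\<^sub>1 = (x, y)\<close> and the angle from the fixed \<open>x\<close>-axis to its \<open>\<xi>\<close>-axis.\<close>

definition positions :: "(real \<times> real \<times> real) set" where
  "positions = UNIV \<times> UNIV \<times> {0..<2*pi}"

fun place :: "real \<times> real \<times> real \<Rightarrow> real \<times> real \<Rightarrow> real \<times> real" where
  "place (x, y, \<psi>) (\<xi>, \<eta>) =
     (x + \<xi> * cos \<psi> - \<eta> * sin \<psi>, y + \<xi> * sin \<psi> + \<eta> * cos \<psi>)"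

definition ellipse_curve :: "real \<Rightarrow> real \<Rightarrow> real \<times> real \<times> real \<Rightarrow> (real \<times> real) set" where
  "ellipse_curve a b q = place q ` {(\<xi>, \<eta>). \<xi>^2 / a^2 + \<eta>^2 / b^2 = 1}"

definition ellipse_region :: "real \<Rightarrow> real \<Rightarrow> real \<times> real \<times> real \<Rightarrow> (real \<times> real) set" where
  "ellipse_region a b q = place q ` {(\<xi>, \<eta>). \<xi>^2 / a^2 + \<eta>^2 / b^2 \<le> 1}"

text \<open>The kinematic density \<open>dx \<and> dy \<and> d\<psi>\<close> is Lebesgue measure on the position coordinates; it is applied
  only to subsets of \<^const>\<open>positions\<close>.\<close>

definition kinematic_measure :: "(real \<times> real \<times> real) set \<Rightarrow> real" where
  "kinematic_measure S = measure lebesgue S"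


text \<open>The intersection multiplicity at a point of the ellipse is the order of vanishing of the circle's
  defining polynomial along a regular parametrization of the ellipse. It is \<open>\<infinity>\<close> if all derivatives
  vanish, which happens only when the two curves coincide.\<close>

definition vanishing_order :: "(real \<Rightarrow> real) \<Rightarrow> real \<Rightarrow> enat" where
  "vanishing_order f t = (INF n\<in>{n. (deriv ^^ n) f t \<noteq> 0}. enat n)"

definition ellipse_param :: "real \<Rightarrow> real \<Rightarrow> real \<times> real \<times> real \<Rightarrow> real \<Rightarrow> real \<times> real" where
  "ellipse_param a b q t = place q (a * cos t, b * sin t)"

definition circle_poly :: "real \<times> real \<Rightarrow> real \<Rightarrow> real \<times> real \<Rightarrow> real" where
  "circle_poly c r p = (fst p - fst c)^2 + (snd p - snd c)^2 - r^2"

definition intersection_multiplicity ::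
  "real \<times> real \<Rightarrow> real \<Rightarrow> real \<Rightarrow> real \<Rightarrow> real \<times> real \<times> real \<Rightarrow> real \<times> real \<Rightarrow> enat" where
  "intersection_multiplicity c r a b q p =
     vanishing_order (\<lambda>t. circle_poly c r (ellipse_param a b q t))
       (THE t. t \<in> {0..<2*pi} \<and> ellipse_param a b q t = p)"

definition intersection_number ::
  "real \<times> real \<Rightarrow> real \<Rightarrow> real \<Rightarrow> real \<Rightarrow> real \<times> real \<times> real \<Rightarrow> enat" where
  "intersection_number c r a b q =
     (let I = sphere c r \<inter> ellipse_curve a b q in
      if finite I then \<Sum>p\<in>I. intersection_multiplicity c r a b q p else \<infinity>)"


definition pos10 :: "real \<times> real \<Rightarrow> real \<Rightarrow> real \<Rightarrow> real \<Rightarrow> (real \<times> real \<times> real) set" where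
  "pos10 c r a b = {q \<in> positions. ellipse_curve a b q \<subseteq> cball c r}"

definition pos01 :: "real \<times> real \<Rightarrow> real \<Rightarrow> real \<Rightarrow> real \<Rightarrow> (real \<times> real \<times> real) set" where
  "pos01 c r a b = {q \<in> positions. sphere c r \<subseteq> ellipse_region a b q}"

definition pos_points ::
  "nat \<Rightarrow> real \<times> real \<Rightarrow> real \<Rightarrow> real \<Rightarrow> real \<Rightarrow> (real \<times> real \<times> real) set" where
  "pos_points k c r a b = {q \<in> positions. intersection_number c r a b q = enat k}"

definition centers10 :: "real \<times> real \<Rightarrow> real \<Rightarrow> real \<Rightarrow> real \<Rightarrow> real \<Rightarrow> (real \<times> real) set" where
  "centers10 c r a b \<psi> = {(x, y). ellipse_curve a b (x, y, \<psi>) \<subseteq> cball c r}"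

definition centers01 :: "real \<times> real \<Rightarrow> real \<Rightarrow> real \<Rightarrow> real \<Rightarrow> real \<Rightarrow> (real \<times> real) set" where
  "centers01 c r a b \<psi> = {(x, y). sphere c r \<subseteq> ellipse_region a b (x, y, \<psi>)}"

definition m_i :: "real \<times> real \<Rightarrow> real \<Rightarrow> real \<Rightarrow> real \<Rightarrow> real" where
  "m_i c r a b =
     (if a < r then kinematic_measure (pos10 c r a b)
      else if b > r then kinematic_measure (pos01 c r a b)
      else 0)"


definition eccentricity :: "real \<Rightarrow> real \<Rightarrow> real" where
  "eccentricity a b = sqrt (a^2 - b^2) / a"

definition ellint_E :: "real \<Rightarrow> real \<Rightarrow> real" where
  "ellint_E \<phi> k = (LBINT \<theta>=0..\<phi>. sqrt (1 - k^2 * (sin \<theta>)^2))"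

definition complete_ellint_E :: "real \<Rightarrow> real" where
  "complete_ellint_E k = ellint_E (pi / 2) k"

definition F :: "real \<Rightarrow> real \<Rightarrow> real \<Rightarrow> real \<Rightarrow> real" where
  "F r a b \<phi> =
     (let \<epsilon> = eccentricity a b in
      2 * r^2 * \<phi> + 2 * a * b * arctan (b / a * tan \<phi>) - 4 * r * a * ellint_E \<phi> \<epsilon>
      + r * a * \<epsilon>^2 * sin (2 * \<phi>) / sqrt (1 - \<epsilon>^2 * (sin \<phi>)^2))"

definition F_tilde :: "real \<Rightarrow> real \<Rightarrow> real \<Rightarrow> real \<Rightarrow> real" where
  "F_tilde r a b \<phi> =
     pi * r^2 + pi * a * b - 4 * r * a * complete_ellint_E (eccentricity a b) - F r a b \<phi>"

definition alpha :: "real \<Rightarrow> real \<Rightarrow> real \<Rightarrow> real" where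
  "alpha r a b = arctan (sqrt (r^2 * a^2 - b^4) / (b * sqrt (b^2 - r^2)))"

definition beta :: "real \<Rightarrow> real \<Rightarrow> real \<Rightarrow> real" where
  "beta r a b = arctan (a * sqrt (r^2 - a^2) / sqrt (a^4 - r^2 * b^2))"

end

theory Submission
  imports Defs
begin

text \<open>For a position of the moving frame let \<open>v\<close> be the centre of the circle in the coordinates of that frame.
Whether the curves meet, how often, and whether one lies inside the other depends on \<open>v\<close> alone. For a
fixed direction the passage from the centre of the ellipse to \<open>v\<close> is a rigid motion of the plane, so the
kinematic measure of a set of positions is \<open>2 \<pi>\<close> times the area of the corresponding set of points \<open>v\<close>.
The theorem is thereby a statement about areas in the plane, with an ellipse \<open>C\<close> in standard position
that bounds \<open>K\<close>, and a disk of radius \<open>r\<close> with variable centre \<open>v\<close>.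

Outside the two curves at distance \<open>r\<close> from \<open>C\<close>, a null set, all intersections are transversal. Along
\<open>C\<close> they alternate between leaving and entering the disk, and there are at most four of them because
they are zeros of a trigonometric polynomial of degree two. Their number is therefore \<open>2 u\<close>, where
\<open>u \<in> {0, 1, 2}\<close> counts the departures. The areas \<open>A\<^sub>1\<close> and \<open>A\<^sub>2\<close> of the sets \<open>u = 1\<close> and \<open>u = 2\<close> are
the solution of two linear equations.

\<^item> \<open>A\<^sub>1 + 2 A\<^sub>2\<close> is the integral of \<open>u\<close>, which is \<open>2 r L\<close> with the perimeter \<open>L = 4 a E(\<epsilon>)\<close>. This is
  Poincare's formula. Here \<open>u(v)\<close> is the limit of the number of edges of an inscribed polygon that begin in the
  disk about \<open>v\<close> and end outside it. The points \<open>v\<close> with this property for one edge of length \<open>d\<close> form the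
  difference of two disks, whose area is \<open>2 r d + O(d\<^sup>2)\<close>. Summation over the edges and dominated
  convergence give the integral.

\<^item> \<open>A\<^sub>1 + A\<^sub>2 + A\<^sub>i\<close> is the area of the parallel body of \<open>K\<close> at distance \<open>r\<close>, where \<open>A\<^sub>i\<close> is the
  area of the points whose disk contains \<open>C\<close> or is contained in \<open>K\<close>. Indeed, a disk that meets \<open>K\<close> but
  misses \<open>C\<close> is of one of these two kinds.

The areas of the parallel body and of the two parts of \<open>A\<^sub>i\<close> come from one principle. All three regions are
convex and symmetric about both axes, and in the first quadrant each is bounded by an arc of a curve parallel
to \<open>C\<close>. If \<open>h(\<phi>)\<close> is the support function of \<open>C\<close>, then such an arc has the support function
\<open>p = \<plusminus> (h + \<rho>)\<close> with \<open>\<rho> = \<plusminus> r\<close>, and the area of the region is the integral of \<open>2 p (p + p'')\<close> over the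
interval of directions of the arc. For \<open>\<rho> = - r\<close> the function \<open>F\<close> is an antiderivative of this integrand. That an arc belongs to the region follows from
\<open>contact_identity\<close>, which writes the power of a point of \<open>C\<close> with respect to the circle as a sum of two
squares with the coefficients \<open>1 + \<rho> h / a\<^sup>2\<close> and \<open>1 + \<rho> h / b\<^sup>2\<close>. Their signs change where the centre of the
circle reaches an axis, and this happens at the angles \<open>\<alpha>\<close> and \<open>\<beta>\<close>.\<close>

section \<open>Rigid motions and lunes in the plane\<close>

lemma emeasure_lborel_slices_snd:
  fixes A :: "(real \<times> real) set"
  assumes "A \<in> sets borel"
  shows "emeasure lborel A = (\<integral>\<^sup>+ y. emeasure lborel ((\<lambda>x. (x, y)) -` A) \<partial>lborel)"
proof -
  have "A \<in> sets (lborel \<Otimes>\<^sub>M lborel)"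
    using assms by (metis lborel_prod sets_lborel)
  from lborel_pair.emeasure_pair_measure_alt2[OF this] show ?thesis
    by (simp add: lborel_prod)
qed

lemma emeasure_lborel_slices_fst:
  fixes A :: "(real \<times> real) set"
  assumes "A \<in> sets borel"
  shows "emeasure lborel A = (\<integral>\<^sup>+ x. emeasure lborel (Pair x -` A) \<partial>lborel)"
proof -
  have "A \<in> sets (lborel \<Otimes>\<^sub>M lborel)"
    using assms by (metis lborel_prod sets_lborel)
  from lborel.emeasure_pair_measure_alt[OF this] show ?thesis
    by (simp add: lborel_prod)
qed

lemma emeasure_lborel_shift:
  fixes A :: "real set"
  assumes "A \<in> sets borel"
  shows "emeasure lborel ((\<lambda>x. x + k) -` A) = emeasure lborel A"
proof -
  have "(\<lambda>x. x + k) = (+) k" by auto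
  with emeasure_distr[of "(+) k" lborel borel A] assms lborel_distr_plus[of k] show ?thesis
    by simp
qed

lemma borel_linear_map_on_plane:
  "(\<lambda>(x, y). (p * x + q * y, s * x + t * y) :: real \<times> real) \<in> borel_measurable borel"
  by (intro borel_measurable_continuous_onI) (auto simp: case_prod_unfold intro!: continuous_intros)

lemma vimage_linear_map_on_plane:
  assumes "A \<in> sets borel"
  shows "(\<lambda>(x, y). (p * x + q * y, s * x + t * y) :: real \<times> real) -` A \<in> sets borel"
  using measurable_sets[OF borel_linear_map_on_plane assms, of p q s t] by (simp del: vimage_Collect_eq)

definition plane_rotation :: "real \<Rightarrow> real \<Rightarrow> real \<times> real \<Rightarrow> real \<times> real" where
  "plane_rotation u w = (\<lambda>(x, y). (u * x - w * y, w * x + u * y))"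

lemma plane_rotation_measurable: "plane_rotation u w \<in> borel_measurable borel"
  using borel_linear_map_on_plane[of u "- w" w u] by (simp add: plane_rotation_def)

text \<open>The trivial coefficients present the shears as instances of one family of linear maps, so that a single
measurability lemma serves for all of them. Area is preserved because a shear only translates the lines of one
direction.\<close>

lemma emeasure_shear_fst:
  assumes A: "A \<in> sets borel"
  shows "emeasure lborel ((\<lambda>(x, y). (1 * x + k * y, 0 * x + 1 * y :: real)) -` A) = emeasure lborel A"
    (is "emeasure lborel (?S -` A) = _")
proof -
  have m: "?S -` A \<in> sets borel"
    by (rule vimage_linear_map_on_plane[OF A])
  have "(\<lambda>x. (x, y)) -` (?S -` A) = (\<lambda>x. x + k * y) -` ((\<lambda>x. (x, y)) -` A)" for y
    by auto
  moreover have "(\<lambda>x. (x, y)) -` A \<in> sets borel" for y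
    using measurable_sets[of "\<lambda>x. (x, y)" borel borel A] A
    by (simp add: borel_measurable_continuous_onI continuous_intros)
  ultimately show ?thesis
    by (simp only: emeasure_lborel_slices_snd[OF m] emeasure_lborel_slices_snd[OF A]
        emeasure_lborel_shift)
qed

lemma emeasure_shear_snd:
  assumes A: "A \<in> sets borel"
  shows "emeasure lborel ((\<lambda>(x, y). (1 * x + 0 * y, k * x + 1 * y :: real)) -` A) = emeasure lborel A"
    (is "emeasure lborel (?S -` A) = _")
proof -
  have m: "?S -` A \<in> sets borel"
    by (rule vimage_linear_map_on_plane[OF A])
  have "Pair x -` (?S -` A) = (\<lambda>y. y + k * x) -` (Pair x -` A)" for x
    by (auto simp: add.commute)
  moreover have "Pair x -` A \<in> sets borel" for x
    using measurable_sets[of "Pair x" borel borel A] A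
    by (simp add: borel_measurable_continuous_onI continuous_intros)
  ultimately show ?thesis
    by (simp only: emeasure_lborel_slices_fst[OF m] emeasure_lborel_slices_fst[OF A]
        emeasure_lborel_shift)
qed

text \<open>A rotation other than the half turn is a product of three shears. The half turn is the square of a quarter
turn.\<close>

lemma emeasure_plane_rotation:
  assumes A: "A \<in> sets borel" and uw: "u\<^sup>2 + w\<^sup>2 = 1"
  shows "emeasure lborel (plane_rotation u w -` A) = emeasure lborel A"
proof -
  have *: "emeasure lborel (plane_rotation u w -` A) = emeasure lborel A"
    if A: "A \<in> sets borel" and uw: "u\<^sup>2 + w\<^sup>2 = 1" and u: "u \<noteq> - 1" for u w A
  proof -
    \<comment> \<open>This is \<open>- tan (\<psi> / 2)\<close> for the angle \<open>\<psi>\<close> with cosine \<open>u\<close> and sine \<open>w\<close>.\<close>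
    define k where "k = - w / (1 + u)"
    have k: "1 + k * w = u" "k * u + k = - w"
    proof -
      have "1 + u \<noteq> 0" using u by simp
      then have "k * (1 + u) = - w" by (simp add: k_def)
      then show "k * u + k = - w" by (simp add: algebra_simps)
      have "(1 + k * w) * (1 + u) = 1 + u + w * (k * u + k)"
        by (simp add: algebra_simps)
      also have "\<dots> = u * (1 + u)"
        using uw unfolding \<open>k * u + k = - w\<close> by (simp add: power2_eq_square algebra_simps)
      finally have "(1 + k * w) * (1 + u) = u * (1 + u)" .
      then show "1 + k * w = u" using \<open>1 + u \<noteq> 0\<close> by simp
    qed
    let ?X = "\<lambda>(x, y). (1 * x + k * y, 0 * x + 1 * y :: real)"
    let ?Y = "\<lambda>(x, y). (1 * x + 0 * y, w * x + 1 * y :: real)"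
    have "plane_rotation u w = ?X \<circ> ?Y \<circ> ?X"
    proof (rule ext, clarify)
      fix x y
      have "x + k * y + k * (w * (x + k * y) + y) = (1 + k * w) * x + (k * (1 + k * w) + k) * y"
        by (simp add: algebra_simps)
      also have "\<dots> = u * x - w * y" unfolding k by simp
      moreover have "w * (x + k * y) + y = w * x + (1 + k * w) * y"
        by (simp add: algebra_simps)
      ultimately show "plane_rotation u w (x, y) = (?X \<circ> ?Y \<circ> ?X) (x, y)"
        by (simp add: plane_rotation_def k(1))
    qed
    then have "plane_rotation u w -` A = ?X -` (?Y -` (?X -` A))"
      by auto
    moreover have "?X -` A \<in> sets borel" "?Y -` (?X -` A) \<in> sets borel"
      by (intro vimage_linear_map_on_plane A)+
    ultimately show ?thesis
      using A by (simp only: emeasure_shear_fst emeasure_shear_snd)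
  qed
  show ?thesis
  proof (cases "u = - 1")
    case True
    with uw have "w = 0" by simp
    have "plane_rotation u w = plane_rotation 0 1 \<circ> plane_rotation 0 1"
      by (auto simp: plane_rotation_def True \<open>w = 0\<close>)
    then have "plane_rotation u w -` A = plane_rotation 0 1 -` (plane_rotation 0 1 -` A)"
      by auto
    moreover have "plane_rotation 0 1 -` A \<in> sets borel"
      using measurable_sets[OF plane_rotation_measurable A] by simp
    ultimately show ?thesis
      using *[of _ 0 1] A by simp
  next
    case False
    with * A uw show ?thesis by blast
  qed
qed

lemma emeasure_rigid_motion:
  assumes A: "A \<in> sets borel" and uw: "u\<^sup>2 + w\<^sup>2 = 1"
  shows "emeasure lborel ((\<lambda>v. p + plane_rotation u w v) -` A) = emeasure lborel A"
proof -
  have m: "(+) p -` A \<in> sets borel"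
    using measurable_sets[of "(+) p" borel borel A] A by simp
  have "(\<lambda>v. p + plane_rotation u w v) -` A = plane_rotation u w -` ((+) p -` A)"
    by auto
  also have "emeasure lborel \<dots> = emeasure lborel ((+) p -` A)"
    by (rule emeasure_plane_rotation[OF m uw])
  also have "\<dots> = emeasure lborel A"
    using emeasure_distr[of "(+) p" lborel borel A] A lborel_distr_plus[of p] by simp
  finally show ?thesis .
qed

lemma cball_plane: "(x, y) \<in> cball (p, q) r \<longleftrightarrow> (x - p)\<^sup>2 + (y - q)\<^sup>2 \<le> r\<^sup>2" if "r \<ge> 0" for r :: real
  using that
  by (auto simp: dist_prod_def dist_real_def power2_commute real_sqrt_le_iff real_le_lsqrt
      dest!: sqrt_le_D intro!: real_le_lsqrt)

text \<open>A horizontal slice of the lune is contained in an interval of length \<open>d\<close>. It fills that interval, up to an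
end point, whenever the half chord of the disk at this height is at least \<open>d\<close>, and this is certain for heights
up to \<open>r - d\<close>.\<close>

lemma emeasure_lune_on_axis:
  fixes r d :: real
  assumes r: "r > 0" and d: "0 \<le> d" "d \<le> r"
  defines "L \<equiv> cball (0 :: real, 0 :: real) r - cball (d, 0) r"
  shows "emeasure lborel L \<le> ennreal (2 * r * d)"
    and "ennreal (2 * r * d - 2 * d\<^sup>2) \<le> emeasure lborel L"
proof -
  have m: "L \<in> sets borel" unfolding L_def by simp
  have ms: "(\<lambda>x. (x, y)) -` L \<in> sets borel" for y :: real
    using measurable_sets[of "\<lambda>x. (x, y)" borel borel L] m
    by (simp add: borel_measurable_continuous_onI continuous_intros)
  have L: "(x, y) \<in> L \<longleftrightarrow> x\<^sup>2 + y\<^sup>2 \<le> r\<^sup>2 \<and> (x - d)\<^sup>2 + y\<^sup>2 > r\<^sup>2" for x y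
    using cball_plane[of r x y 0 0] cball_plane[of r x y d 0] r by (auto simp: L_def)
  define w where "w y = sqrt (r\<^sup>2 - y\<^sup>2)" for y
  have slice: "(\<lambda>x. (x, y)) -` L = {x. \<bar>x\<bar> \<le> w y \<and> \<not> \<bar>x - d\<bar> \<le> w y}" if "\<bar>y\<bar> \<le> r" for y :: real
  proof -
    have "y\<^sup>2 \<le> r\<^sup>2" using that r by (simp add: abs_le_square_iff[symmetric])
    then have eq: "z\<^sup>2 + y\<^sup>2 \<le> r\<^sup>2 \<longleftrightarrow> \<bar>z\<bar> \<le> w y" for z
      unfolding w_def by (metis le_diff_eq real_sqrt_abs real_sqrt_le_iff)
    show ?thesis unfolding eq[symmetric] by (auto simp: L)
  qed
  have slice0: "(\<lambda>x. (x, y)) -` L = {}" if "\<not> \<bar>y\<bar> \<le> r" for y :: real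
  proof -
    have "y\<^sup>2 > r\<^sup>2" using that r by (metis abs_le_square_iff abs_of_pos not_le)
    then show ?thesis by (auto simp: L) (smt (verit) zero_le_power2)
  qed
  have up: "emeasure lborel ((\<lambda>x. (x, y)) -` L) \<le> ennreal d * indicator {- r..r} y" for y
  proof (cases "\<bar>y\<bar> \<le> r")
    case True
    have "(\<lambda>x. (x, y)) -` L \<subseteq> {- w y .. d - w y}"
      unfolding slice[OF True] using d by auto
    then have "emeasure lborel ((\<lambda>x. (x, y)) -` L) \<le> emeasure lborel {- w y .. d - w y}"
      by (intro emeasure_mono) auto
    with True d show ?thesis by (simp add: abs_le_iff)
  qed (simp add: slice0)
  have lo: "ennreal d * indicator {- (r - d)..r - d} y \<le> emeasure lborel ((\<lambda>x. (x, y)) -` L)" for y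
  proof (cases "\<bar>y\<bar> \<le> r - d")
    case True
    have "y\<^sup>2 \<le> (r - d)\<^sup>2"
      using True by (metis abs_ge_self abs_le_square_iff order.trans)
    moreover have "(r - d)\<^sup>2 + d\<^sup>2 \<le> r\<^sup>2"
    proof -
      have "d * (r - d) \<ge> 0" using d by simp
      then show ?thesis by (simp add: power2_eq_square algebra_simps)
    qed
    ultimately have "d\<^sup>2 \<le> r\<^sup>2 - y\<^sup>2" by simp
    then have "d \<le> w y" unfolding w_def using d real_le_rsqrt by blast
    with d have "{- w y ..< d - w y} \<subseteq> {x. \<bar>x\<bar> \<le> w y \<and> \<not> \<bar>x - d\<bar> \<le> w y}" by auto
    then have "{- w y ..< d - w y} \<subseteq> (\<lambda>x. (x, y)) -` L"
      using slice[of y] True d by auto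
    then have "emeasure lborel {- w y ..< d - w y} \<le> emeasure lborel ((\<lambda>x. (x, y)) -` L)"
      using ms by (intro emeasure_mono) auto
    with True d show ?thesis by (simp add: abs_le_iff)
  next
    case False
    then have "y \<notin> {- (r - d)..r - d}" by auto
    then show ?thesis by simp
  qed
  have int: "(\<integral>\<^sup>+ y. ennreal d * indicator {- s..s} y \<partial>lborel) = ennreal (2 * s * d)" if "s \<ge> 0" for s
    using that d by (simp add: nn_integral_cmult_indicator ennreal_mult[symmetric] mult.commute)
  show "emeasure lborel L \<le> ennreal (2 * r * d)"
    unfolding emeasure_lborel_slices_snd[OF m] int[OF less_imp_le[OF r], symmetric]
    by (intro nn_integral_mono up)
  have "ennreal (2 * r * d - 2 * d\<^sup>2) = (\<integral>\<^sup>+ y. ennreal d * indicator {- (r - d)..r - d} y \<partial>lborel)"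
    using int[of "r - d"] d by (simp add: power2_eq_square algebra_simps)
  also have "\<dots> \<le> emeasure lborel L"
    unfolding emeasure_lborel_slices_snd[OF m] by (intro nn_integral_mono lo)
  finally show "ennreal (2 * r * d - 2 * d\<^sup>2) \<le> emeasure lborel L" .
qed

lemma measure_lune:
  fixes p q :: "real \<times> real"
  assumes r: "r > 0" and d: "dist p q \<le> r"
  shows "measure lborel (cball p r - cball q r) \<le> 2 * r * dist p q"
    and "2 * r * dist p q - 2 * (dist p q)\<^sup>2 \<le> measure lborel (cball p r - cball q r)"
proof -
  define d where "d = dist p q"
  obtain u w where uw: "u\<^sup>2 + w\<^sup>2 = 1" and q: "q = p + (d * u, d * w)"
  proof (cases "d = 0")
    case True
    then show ?thesis using that[of 1 0] by (simp add: d_def zero_prod_def[symmetric])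
  next
    case False
    have d2: "d\<^sup>2 = (fst q - fst p)\<^sup>2 + (snd q - snd p)\<^sup>2"
      by (simp add: d_def dist_prod_def dist_real_def power2_commute)
    then have "((fst q - fst p) / d)\<^sup>2 + ((snd q - snd p) / d)\<^sup>2 = 1"
      using False unfolding power_divide add_divide_distrib[symmetric] d2[symmetric] by simp
    then show ?thesis
      using that[of "(fst q - fst p) / d" "(snd q - snd p) / d"] False
      by (simp add: prod_eq_iff)
  qed
  let ?g = "\<lambda>v. p + plane_rotation u w v"
  have g: "dist (?g v) (?g v') = dist v v'" for v v'
  proof -
    obtain x y x' y' where v: "v = (x, y)" "v' = (x', y')" by fastforce
    have "(u * (x - x') - w * (y - y'))\<^sup>2 + (w * (x - x') + u * (y - y'))\<^sup>2
        = (u\<^sup>2 + w\<^sup>2) * ((x - x')\<^sup>2 + (y - y')\<^sup>2)"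
      by algebra
    then show ?thesis
      by (simp add: v plane_rotation_def dist_prod_def dist_real_def uw)
         (simp add: algebra_simps)
  qed
  have "?g (0, 0) = p" "?g (d, 0) = q"
    by (simp_all add: q plane_rotation_def zero_prod_def mult.commute)
  then have "?g v \<in> cball p r \<longleftrightarrow> v \<in> cball (0, 0) r" "?g v \<in> cball q r \<longleftrightarrow> v \<in> cball (d, 0) r" for v
    using g[of "(0, 0)" v] g[of "(d, 0)" v] unfolding mem_cball by metis+
  then have "?g -` (cball p r - cball q r) = cball (0 :: real, 0 :: real) r - cball (d, 0) r"
    unfolding vimage_Diff vimage_def by blast
  with emeasure_rigid_motion[of "cball p r - cball q r" u w p] uw
  have e: "emeasure lborel (cball p r - cball q r) = emeasure lborel (cball (0 :: real, 0 :: real) r - cball (d, 0) r)"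
    by simp
  have "0 \<le> d" "d \<le> r" using d by (auto simp: d_def)
  note l = emeasure_lune_on_axis[OF r this, folded e]
  have fin: "emeasure lborel (cball p r - cball q r) = ennreal (measure lborel (cball p r - cball q r))"
    using l(1) by (intro emeasure_eq_ennreal_measure) (auto simp: top_unique)
  have "0 \<le> 2 * r * dist p q" using r by simp
  with l(1) show "measure lborel (cball p r - cball q r) \<le> 2 * r * dist p q"
    unfolding fin d_def by (subst (asm) ennreal_le_iff)
  show "2 * r * dist p q - 2 * (dist p q)\<^sup>2 \<le> measure lborel (cball p r - cball q r)"
    using l(2) unfolding fin d_def by (subst (asm) ennreal_le_iff) simp_all
qed

section \<open>Zeros of a periodic function and its samples\<close>

text \<open>The derivative is an argument of its own, so that it can be given by a formula.\<close>

definition up_zeros :: "(real \<Rightarrow> real) \<Rightarrow> (real \<Rightarrow> real) \<Rightarrow> real set" where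
  "up_zeros f f' = {t \<in> {0..<2*pi}. f t = 0 \<and> f' t > 0}"

definition grid :: "nat \<Rightarrow> nat \<Rightarrow> real" where
  "grid n k = 2 * pi * real k / real n"

definition up_steps :: "(real \<Rightarrow> real) \<Rightarrow> nat \<Rightarrow> nat set" where
  "up_steps f n = {k. k < n \<and> f (grid n k) \<le> 0 \<and> f (grid n (Suc k)) > 0}"

lemma grid_less_iff:
  assumes "n > 0"
  shows "grid n k < grid n j \<longleftrightarrow> k < j"
proof -
  have "grid n i = (2 * pi / n) * real i" for i by (simp add: grid_def)
  moreover have "2 * pi / n > 0" using assms by simp
  ultimately show ?thesis by (simp only: mult_less_cancel_left_pos of_nat_less_iff)
qed

lemma grid_ends: "grid n 0 = 0" "n > 0 \<Longrightarrow> grid n n = 2 * pi"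
  by (simp_all add: grid_def)

lemma grid_reflect: "k \<le> n \<Longrightarrow> n > 0 \<Longrightarrow> grid n (n - k) = 2 * pi - grid n k"
  by (simp add: grid_def of_nat_diff right_diff_distrib diff_divide_distrib)

lemma grid_mesh: "grid n (Suc k) = grid n k + 2 * pi / n"
  by (simp add: grid_def distrib_left add_divide_distrib)

lemma grid_bounds:
  assumes "k < n"
  shows "0 \<le> grid n k" "grid n k < grid n (Suc k)" "grid n (Suc k) \<le> 2 * pi" "grid n k < 2 * pi"
proof -
  have n: "n > 0" using assms by simp
  show "0 \<le> grid n k" by (simp add: grid_def)
  show "grid n k < grid n (Suc k)" using n by (simp add: grid_less_iff)
  have "\<not> grid n n < grid n (Suc k)" using assms unfolding grid_less_iff[OF n] by linarith
  then show "grid n (Suc k) \<le> 2 * pi" unfolding grid_ends(2)[OF n] by linarith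
  have "grid n k < grid n n" using assms unfolding grid_less_iff[OF n] .
  then show "grid n k < 2 * pi" unfolding grid_ends(2)[OF n] .
qed

lemma grid_cell_unique:
  assumes "grid n k \<le> t" "t < grid n (Suc k)" "grid n j \<le> t" "t < grid n (Suc j)" "n > 0"
  shows "k = j"
proof -
  have "grid n k < grid n (Suc j)" "grid n j < grid n (Suc k)" using assms by linarith+
  with \<open>n > 0\<close> show ?thesis by (simp add: grid_less_iff)
qed

lemma grid_cell_exists:
  assumes "0 \<le> t" "t < 2 * pi" "n > 0"
  obtains k where "k < n" "grid n k \<le> t" "t < grid n (Suc k)"
proof -
  define x where "x = t * n / (2 * pi)"
  define k where "k = nat \<lfloor>x\<rfloor>"
  have "0 \<le> x" using assms by (simp add: x_def)
  then have k: "real k \<le> x" "x < real k + 1"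
    unfolding k_def by linarith+
  have "t * n < n * (2 * pi)" using assms by (simp add: mult.commute)
  then have "x < n" unfolding x_def by (subst pos_divide_less_eq) simp_all
  with k have "real k < n" by linarith
  moreover have "grid n k \<le> t"
  proof -
    have "real k * (2 * pi) \<le> t * n" using k(1) unfolding x_def by (subst (asm) pos_le_divide_eq) simp_all
    then show ?thesis unfolding grid_def using \<open>n > 0\<close> by (subst pos_divide_le_eq) (simp_all add: mult.commute)
  qed
  moreover have "t < grid n (Suc k)"
  proof -
    have "t * n < real (Suc k) * (2 * pi)" using k(2) unfolding x_def by (subst (asm) pos_divide_less_eq) (simp_all add: add.commute)
    then show ?thesis unfolding grid_def using \<open>n > 0\<close> by (subst pos_less_divide_eq) (simp_all add: mult.commute)
  qed
  ultimately show ?thesis using that by simp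
qed

text \<open>The last point of the interval at which \<open>f \<le> 0\<close> is a zero, and the derivative cannot be negative there.\<close>

lemma upward_zero_in_step:
  fixes f f' :: "real \<Rightarrow> real"
  assumes f: "\<And>t. (f has_real_derivative f' t) (at t)"
    and simple: "\<And>t. f t = 0 \<Longrightarrow> f' t \<noteq> 0"
    and ab: "a < b" "f a \<le> 0" "f b > 0"
  obtains z where "a \<le> z" "z < b" "f z = 0" "f' z > 0"
proof -
  have cont: "continuous_on S f" for S
    using f by (meson DERIV_isCont continuous_at_imp_continuous_on)
  define S where "S = {t \<in> {a..b}. f t \<le> 0}"
  have "S = {a..b} \<inter> f -` {..0}" by (auto simp: S_def)
  then have "closed S"
    by (simp add: continuous_closed_preimage[OF cont])
  moreover have "a \<in> S" "S \<subseteq> {a..b}" using ab by (auto simp: S_def)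
  moreover have bdd: "bdd_above S" by (rule bdd_above_mono[OF bdd_above_Icc \<open>S \<subseteq> {a..b}\<close>])
  ultimately have zS: "Sup S \<in> S"
    using bdd by (intro closed_contains_Sup) auto
  define z where "z = Sup S"
  have z: "a \<le> z" "z \<le> b" "f z \<le> 0" using zS by (auto simp: S_def z_def)
  then have "z < b" using ab by (metis not_less order.order_iff_strict)
  have right: "f t > 0" if "z < t" "t \<le> b" for t
  proof (rule ccontr)
    assume "\<not> f t > 0"
    with that z have "t \<in> S" by (auto simp: S_def)
    then have "t \<le> Sup S" using bdd by (rule cSup_upper)
    with that show False by (simp add: z_def)
  qed
  have "f z = 0"
  proof (rule ccontr)
    assume "f z \<noteq> 0"
    then obtain t where "z < t" "t < b" "f t < 0"
    proof -
      have "f z < 0" using z \<open>f z \<noteq> 0\<close> by simp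
      have "(f \<longlongrightarrow> f z) (at_right z)"
        using DERIV_isCont[OF f, of z] by (simp add: isCont_def filterlim_at_split)
      then have "eventually (\<lambda>t. f t < 0) (at_right z)"
        using \<open>f z < 0\<close> by (rule order_tendstoD(2))
      moreover have "eventually (\<lambda>t. t \<in> {z<..<b}) (at_right z)"
        using \<open>z < b\<close> by (rule eventually_at_right_real)
      ultimately have "eventually (\<lambda>t. f t < 0 \<and> t \<in> {z<..<b}) (at_right z)"
        by (rule eventually_conj)
      from eventually_happens[OF this] show ?thesis using that by auto
    qed
    then show False using right by force
  qed
  moreover have "f' z > 0"
  proof (rule ccontr)
    assume "\<not> f' z > 0"
    with simple[OF \<open>f z = 0\<close>] have "f' z < 0" by simp
    from DERIV_neg_dec_right[OF f this] obtain d where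
      d: "d > 0" "\<And>h. h > 0 \<Longrightarrow> h < d \<Longrightarrow> f (z + h) < f z" by blast
    define h where "h = min (d / 2) (b - z)"
    have "h > 0" "h < d" "z + h \<le> b" using d \<open>z < b\<close> by (auto simp: h_def)
    with d(2)[of h] right[of "z + h"] \<open>f z = 0\<close> show False by simp
  qed
  ultimately show ?thesis using that z \<open>z < b\<close> by blast
qed

text \<open>Distinct upward steps contain distinct upward zeros.\<close>

lemma up_steps_le:
  fixes f f' :: "real \<Rightarrow> real"
  assumes f: "\<And>t. (f has_real_derivative f' t) (at t)"
    and simple: "\<And>t. f t = 0 \<Longrightarrow> f' t \<noteq> 0"
    and fin: "finite (up_zeros f f')"
  shows "card (up_steps f n) \<le> card (up_zeros f f')"
proof -
  have "\<exists>z \<in> up_zeros f f'. grid n k \<le> z \<and> z < grid n (Suc k)" if "k \<in> up_steps f n" for k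
  proof -
    have "k < n" using that by (simp add: up_steps_def)
    from that obtain z where "grid n k \<le> z" "z < grid n (Suc k)" "f z = 0" "f' z > 0"
      using upward_zero_in_step[OF f simple grid_bounds(2)[OF \<open>k < n\<close>]]
      by (auto simp: up_steps_def)
    with grid_bounds[OF \<open>k < n\<close>] show ?thesis
      by (intro bexI[of _ z]) (auto simp: up_zeros_def)
  qed
  then obtain z where z: "\<And>k. k \<in> up_steps f n \<Longrightarrow> z k \<in> up_zeros f f' \<and> grid n k \<le> z k \<and> z k < grid n (Suc k)"
    by metis
  have "inj_on z (up_steps f n)"
  proof (rule inj_onI)
    fix k j assume kj: "k \<in> up_steps f n" "j \<in> up_steps f n" "z k = z j"
    then have "n > 0" by (auto simp: up_steps_def)
    with kj z[of k] z[of j] show "k = j" by (metis grid_cell_unique)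
  qed
  moreover have "z ` up_steps f n \<subseteq> up_zeros f f'" using z by blast
  ultimately show ?thesis using fin by (rule card_inj_on_le)
qed

text \<open>Once the mesh is finer than the gaps between the zeros, the cell that contains an upward zero contains no
other zero, so that it is an upward step.\<close>

lemma up_steps_ge:
  fixes f f' :: "real \<Rightarrow> real"
  assumes f: "\<And>t. (f has_real_derivative f' t) (at t)"
    and fin: "finite {t \<in> {0..2*pi}. f t = 0}"
  shows "eventually (\<lambda>n. card (up_zeros f f') \<le> card (up_steps f n)) sequentially"
proof -
  define Z where "Z = {t \<in> {0..2*pi}. f t = 0}"
  have cont: "continuous_on S f" for S
    using f by (meson DERIV_isCont continuous_at_imp_continuous_on)
  obtain d where d: "d > 0" "\<And>s t. s \<in> Z \<Longrightarrow> t \<in> Z \<Longrightarrow> s \<noteq> t \<Longrightarrow> d \<le> \<bar>s - t\<bar>"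
  proof -
    define D where "D = insert 1 ((\<lambda>(s, t). \<bar>s - t\<bar>) ` {(s, t). s \<in> Z \<and> t \<in> Z \<and> s \<noteq> t})"
    have "finite {(s, t). s \<in> Z \<and> t \<in> Z \<and> s \<noteq> t}"
      by (rule finite_subset[of _ "Z \<times> Z"]) (use fin in \<open>auto simp: Z_def\<close>)
    then have "finite D" by (simp add: D_def)
    show ?thesis
    proof (rule that[of "Min D"])
      show "Min D > 0" using \<open>finite D\<close> by (subst Min_gr_iff) (auto simp: D_def)
      show "Min D \<le> \<bar>s - t\<bar>" if "s \<in> Z" "t \<in> Z" "s \<noteq> t" for s t
        using \<open>finite D\<close> that by (intro Min_le) (auto simp: D_def)
    qed
  qed
  have "card (up_zeros f f') \<le> card (up_steps f n)" if n: "real n > 2 * pi / d" for n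
  proof -
    have "0 < 2 * pi / d" using d by simp
    with n have "real n > 0" by linarith
    then have "n > 0" by simp
    have mesh: "grid n (Suc k) - grid n k < d" for k
    proof -
      have "2 * pi < d * n" using n d by (simp add: pos_divide_less_eq mult.commute)
      then have "2 * pi / n < d" using \<open>n > 0\<close> by (simp add: pos_divide_less_eq)
      then show ?thesis by (simp add: grid_mesh)
    qed
    have "\<exists>k \<in> up_steps f n. grid n k \<le> z \<and> z < grid n (Suc k)" if z: "z \<in> up_zeros f f'" for z
    proof -
      have z': "0 \<le> z" "z < 2 * pi" "f z = 0" "f' z > 0" using z by (auto simp: up_zeros_def)
      from grid_cell_exists[OF z'(1,2) \<open>n > 0\<close>] obtain k where
        k: "k < n" "grid n k \<le> z" "z < grid n (Suc k)" by blast
      have only: "s = z" if "grid n k \<le> s" "s \<le> grid n (Suc k)" "f s = 0" for s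
      proof (rule ccontr)
        assume "s \<noteq> z"
        moreover have "s \<in> Z" "z \<in> Z"
          using that z' grid_bounds[OF k(1)] by (auto simp: Z_def)
        ultimately have "d \<le> \<bar>s - z\<bar>" using d by blast
        with mesh[of k] that k show False by linarith
      qed
      have "f (grid n (Suc k)) > 0"
      proof (rule ccontr)
        assume neg: "\<not> f (grid n (Suc k)) > 0"
        from DERIV_pos_inc_right[OF f z'(4)] obtain e where
          e: "e > 0" "\<And>h. h > 0 \<Longrightarrow> h < e \<Longrightarrow> f z < f (z + h)" by blast
        define h where "h = min (e / 2) (grid n (Suc k) - z)"
        have h: "h > 0" "h < e" "z + h \<le> grid n (Suc k)" using e k by (auto simp: h_def)
        with e z' have "f (z + h) > 0" by fastforce
        with IVT2'[of f "grid n (Suc k)" 0 "z + h"] neg h cont obtain x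
          where "z + h \<le> x" "x \<le> grid n (Suc k)" "f x = 0" by (auto simp: not_less)
        with only[of x] k h show False by linarith
      qed
      moreover have "f (grid n k) \<le> 0"
      proof (rule ccontr)
        assume pos: "\<not> f (grid n k) \<le> 0"
        then have "grid n k < z" using k z' by (metis order.order_iff_strict order_refl)
        from DERIV_pos_inc_left[OF f z'(4)] obtain e where
          e: "e > 0" "\<And>h. h > 0 \<Longrightarrow> h < e \<Longrightarrow> f (z - h) < f z" by blast
        define h where "h = min (e / 2) (z - grid n k)"
        have h: "h > 0" "h < e" "grid n k \<le> z - h" using e \<open>grid n k < z\<close> by (auto simp: h_def)
        with e z' have "f (z - h) < 0" by fastforce
        with IVT2'[of f "z - h" 0 "grid n k"] pos h cont obtain x
          where "grid n k \<le> x" "x \<le> z - h" "f x = 0" by (auto simp: not_le)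
        with only[of x] k h show False by linarith
      qed
      ultimately show ?thesis using k by (auto simp: up_steps_def)
    qed
    then obtain k where k: "\<And>z. z \<in> up_zeros f f' \<Longrightarrow> k z \<in> up_steps f n \<and> grid n (k z) \<le> z \<and> z < grid n (Suc (k z))"
      by metis
    have "inj_on k (up_zeros f f')"
    proof (rule inj_onI)
      fix s t assume st: "s \<in> up_zeros f f'" "t \<in> up_zeros f f'" "k s = k t"
      then have "\<bar>s - t\<bar> < d" using k[of s] k[of t] mesh[of "k s"] by simp linarith
      moreover have "s \<in> Z" "t \<in> Z" using st by (auto simp: up_zeros_def Z_def)
      ultimately show "s = t" using d(2)[of s t] by linarith
    qed
    moreover have "finite (up_steps f n)" by (simp add: up_steps_def)
    ultimately show ?thesis using k by (metis card_inj_on_le image_subsetI)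
  qed
  moreover have "eventually (\<lambda>n. real n > 2 * pi / d) sequentially"
    using filterlim_real_sequentially by (simp add: filterlim_at_top_dense)
  ultimately show ?thesis by (simp add: eventually_mono)
qed

text \<open>The sum of the changes of the indicator of \<open>P\<close> telescopes.\<close>

lemma card_cyclic_switches:
  fixes P :: "nat \<Rightarrow> bool"
  assumes "P n = P 0"
  shows "card {k. k < n \<and> P k \<and> \<not> P (Suc k)} = card {k. k < n \<and> \<not> P k \<and> P (Suc k)}"
proof -
  have "int (card {k. k < n \<and> P k \<and> \<not> P (Suc k)}) - int (card {k. k < n \<and> \<not> P k \<and> P (Suc k)})
      = of_bool (P 0) - of_bool (P n)" for n
  proof (induction n)
    case (Suc n)
    have step: "card {k. k < Suc n \<and> Q k} = card {k. k < n \<and> Q k} + of_bool (Q n)" for Q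
    proof -
      have *: "{k. k < Suc n \<and> Q k} = (if Q n then insert n {k. k < n \<and> Q k} else {k. k < n \<and> Q k})"
        by (auto simp only: less_Suc_eq mem_Collect_eq insert_iff split: if_splits)
      have "finite {k. k < n \<and> Q k}" "n \<notin> {k. k < n \<and> Q k}" by simp_all
      then show ?thesis unfolding * by (cases "Q n") (simp_all only: card_insert_disjoint if_True if_False of_bool_eq, simp_all)
    qed
    show ?case unfolding step using Suc by (cases "P n"; cases "P (Suc n)"; simp)
  qed simp
  from this[of n] show ?thesis unfolding assms by simp
qed

text \<open>Reversal of the parameter turns downward zeros into upward zeros. On a fine grid the zeros of both kinds are
counted by the steps, and a periodic sequence of samples rises as often as it falls.\<close>

lemma card_zeros_eq_twice_up_zeros:
  fixes f f' :: "real \<Rightarrow> real"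
  assumes f: "\<And>t. (f has_real_derivative f' t) (at t)"
    and per: "\<And>t. f (t + 2 * pi) = f t" "\<And>t. f' (t + 2 * pi) = f' t"
    and simple: "\<And>t. f t = 0 \<Longrightarrow> f' t \<noteq> 0"
    and fin: "finite {t \<in> {0..2*pi}. f t = 0}"
  shows "card {t \<in> {0..<2*pi}. f t = 0} = 2 * card (up_zeros f f')"
proof -
  define g g' where "g t = f (2 * pi - t)" and "g' t = - f' (2 * pi - t)" for t
  have g: "(g has_real_derivative g' t) (at t)" for t
  proof -
    have "((\<lambda>t. f (2 * pi - t)) has_real_derivative f' (2 * pi - t) * (- 1)) (at t)"
      by (rule DERIV_chain2[OF f]) (auto intro!: derivative_eq_intros)
    then show ?thesis unfolding g_def g'_def by simp
  qed
  have gs: "g t = 0 \<Longrightarrow> g' t \<noteq> 0" for t using simple by (simp add: g_def g'_def)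
  have fing: "finite {t \<in> {0..2*pi}. g t = 0}"
  proof (rule finite_subset)
    show "{t \<in> {0..2*pi}. g t = 0} \<subseteq> (\<lambda>t. 2 * pi - t) ` {t \<in> {0..2*pi}. f t = 0}"
    proof
      fix t assume "t \<in> {t \<in> {0..2*pi}. g t = 0}"
      then show "t \<in> (\<lambda>t. 2 * pi - t) ` {t \<in> {0..2*pi}. f t = 0}"
        by (intro image_eqI[of _ _ "2 * pi - t"]) (auto simp: g_def)
    qed
  qed (use fin in simp)
  have finu: "finite (up_zeros f f')" "finite (up_zeros g g')"
    by (rule finite_subset[OF _ fin] finite_subset[OF _ fing]; auto simp: up_zeros_def)+
  have refl: "grid n (Suc (n - Suc k)) = 2 * pi - grid n k" "grid n (n - Suc k) = 2 * pi - grid n (Suc k)"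
    if "k < n" for n k
    using grid_reflect[of k n] grid_reflect[of "Suc k" n] that by (simp_all add: Suc_diff_Suc)
  have steps: "card (up_steps g n) = card (up_steps f n)" for n
  proof (cases "n = 0")
    case False
    have "up_steps g n = (\<lambda>k. n - Suc k) ` {k. k < n \<and> f (grid n k) > 0 \<and> f (grid n (Suc k)) \<le> 0}"
      (is "_ = ?r ` ?D")
    proof (intro set_eqI iffI)
      fix k assume k: "k \<in> up_steps g n"
      then have "k < n" by (simp add: up_steps_def)
      with k have "n - Suc k \<in> ?D" "k = n - Suc (n - Suc k)"
        by (auto simp: up_steps_def g_def refl)
      then show "k \<in> ?r ` ?D" by blast
    next
      fix j assume "j \<in> ?r ` ?D"
      then obtain k where k: "k < n" "f (grid n k) > 0" "f (grid n (Suc k)) \<le> 0" "j = n - Suc k" by blast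
      then show "j \<in> up_steps g n"
        by (auto simp: up_steps_def g_def refl)
    qed
    moreover have "inj_on ?r ?D" by (auto simp: inj_on_def)
    ultimately have "card (up_steps g n) = card ?D" by (simp add: card_image)
    also have "\<dots> = card (up_steps f n)"
    proof -
      have "grid n n = 0 + 2 * pi" "grid n 0 = 0" using False by (auto simp: grid_def)
      then have "f (grid n n) = f (grid n 0)" using per(1)[of 0] by simp
      then show ?thesis
        using card_cyclic_switches[of "\<lambda>k. f (grid n k) \<le> 0" n]
        by (simp add: up_steps_def not_le)
    qed
    finally show ?thesis .
  qed (simp add: up_steps_def)
  have "eventually (\<lambda>n. card (up_zeros f f') \<le> card (up_steps f n) \<and> card (up_zeros g g') \<le> card (up_steps g n)) sequentially"
    using up_steps_ge[OF f fin] up_steps_ge[OF g fing] by (rule eventually_conj)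
  then obtain n where "card (up_zeros f f') \<le> card (up_steps f n)" "card (up_zeros g g') \<le> card (up_steps g n)"
    using eventually_happens by force
  with steps[of n] up_steps_le[OF f simple finu(1), of n] up_steps_le[OF g gs finu(2), of n]
  have eq: "card (up_zeros g g') = card (up_zeros f f')" by linarith
  \<comment> \<open>Reflection of the half-open period; the parameter zero is its own mirror image.\<close>
  define m where "m t = (if t = 0 then 0 else 2 * pi - t)" for t :: real
  have fm: "f (2 * pi - m t) = f t" "f' (2 * pi - m t) = f' t" for t
    using per[of 0] by (auto simp: m_def)
  have "bij_betw m {t \<in> {0..<2*pi}. f t = 0 \<and> f' t < 0} (up_zeros g g')"
  proof (rule bij_betwI[where g = m])
    have mm: "m (m t) = t" "m t \<in> {0..<2*pi}" if "t \<in> {0..<2*pi}" for t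
      using that by (auto simp: m_def)
    have fm': "f (m t) = f (2 * pi - t)" "f' (m t) = f' (2 * pi - t)" for t
      using per[of 0] by (auto simp: m_def)
    show "m \<in> {t \<in> {0..<2*pi}. f t = 0 \<and> f' t < 0} \<rightarrow> up_zeros g g'"
      using mm fm by (auto simp: up_zeros_def g_def g'_def)
    show "m \<in> up_zeros g g' \<rightarrow> {t \<in> {0..<2*pi}. f t = 0 \<and> f' t < 0}"
      using mm fm' by (auto simp: up_zeros_def g_def g'_def)
  qed (auto simp: m_def up_zeros_def)
  then have "card {t \<in> {0..<2*pi}. f t = 0 \<and> f' t < 0} = card (up_zeros f f')"
    using eq bij_betw_same_card by fastforce
  moreover have "{t \<in> {0..<2*pi}. f t = 0} = up_zeros f f' \<union> {t \<in> {0..<2*pi}. f t = 0 \<and> f' t < 0}"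
    using simple by (force simp: up_zeros_def)
  moreover have "finite {t \<in> {0..<2*pi}. f t = 0 \<and> f' t < 0}"
    by (rule finite_subset[OF _ fin]) auto
  ultimately show ?thesis
    using finu(1) by (simp add: card_Un_disjoint up_zeros_def disjoint_iff)
qed

section \<open>The area of a symmetric region with a given support function\<close>

text \<open>The point of the boundary with outer normal direction \<open>\<phi>\<close> is
\<open>X = p cos \<phi> - p' sin \<phi>\<close>, \<open>Y = p sin \<phi> + p' cos \<phi>\<close>. As \<open>\<phi>\<close> grows from \<open>\<sigma>\<close> to \<open>\<tau>\<close>, it runs
through the part of the boundary in the first quadrant, from the first axis to the second. The vertical slice
of \<open>S\<close> at \<open>X(\<phi>)\<close> is the interval from \<open>- Y(\<phi>)\<close> to \<open>Y(\<phi>)\<close>, and the area is found by Fubini and the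
substitution \<open>x = X(\<phi>)\<close>. The integrand \<open>- 2 Y X'\<close> differs from \<open>p (p + p'')\<close> by the derivative of \<open>X Y\<close>, a
function that vanishes at both ends. The interval of directions is a parameter because the region may have
corners on the axes, where the normal direction jumps.\<close>

lemma area_from_support_function:
  fixes S :: "(real \<times> real) set" and p p' p'' G :: "real \<Rightarrow> real"
  assumes S: "compact S" "convex S"
    and sym: "\<And>x y. (x, y) \<in> S \<Longrightarrow> (- x, y) \<in> S" "\<And>x y. (x, y) \<in> S \<Longrightarrow> (x, - y) \<in> S"
    and \<phi>: "0 \<le> \<sigma>" "\<sigma> < \<tau>" "\<tau> \<le> pi / 2"
    and p: "\<And>\<phi>. (p has_real_derivative p' \<phi>) (at \<phi>)" "\<And>\<phi>. (p' has_real_derivative p'' \<phi>) (at \<phi>)"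
      "continuous_on UNIV p''"
    and rad: "\<And>\<phi>. \<phi> \<in> {\<sigma>..\<tau>} \<Longrightarrow> 0 \<le> p \<phi> + p'' \<phi>"
    and supp: "\<And>\<phi> x y. \<phi> \<in> {\<sigma>..\<tau>} \<Longrightarrow> (x, y) \<in> S \<Longrightarrow> x * cos \<phi> + y * sin \<phi> \<le> p \<phi>"
    and touch: "\<And>\<phi>. \<phi> \<in> {\<sigma>..\<tau>} \<Longrightarrow>
      (p \<phi> * cos \<phi> - p' \<phi> * sin \<phi>, p \<phi> * sin \<phi> + p' \<phi> * cos \<phi>) \<in> S"
    and start: "p \<sigma> * sin \<sigma> + p' \<sigma> * cos \<sigma> = 0"
    and stop: "p \<tau> * cos \<tau> - p' \<tau> * sin \<tau> = 0"
    and G: "\<And>\<phi>. (G has_real_derivative p \<phi> * (p \<phi> + p'' \<phi>)) (at \<phi>)"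
  shows "measure lborel S = 2 * (G \<tau> - G \<sigma>)"
proof -
  define X where "X \<phi> = p \<phi> * cos \<phi> - p' \<phi> * sin \<phi>" for \<phi>
  define Y where "Y \<phi> = p \<phi> * sin \<phi> + p' \<phi> * cos \<phi>" for \<phi>
  define w where "w \<phi> = (p \<phi> + p'' \<phi>) * sin \<phi>" for \<phi>
  have X': "(X has_real_derivative - w \<phi>) (at \<phi>)" for \<phi>
    unfolding X_def w_def
    by (rule DERIV_cong[OF DERIV_diff[OF DERIV_mult[OF p(1) DERIV_cos] DERIV_mult[OF p(2) DERIV_sin]]])
       (simp add: algebra_simps)
  have Y': "(Y has_real_derivative (p \<phi> + p'' \<phi>) * cos \<phi>) (at \<phi>)" for \<phi>
    unfolding Y_def
    by (rule DERIV_cong[OF DERIV_add[OF DERIV_mult[OF p(1) DERIV_sin] DERIV_mult[OF p(2) DERIV_cos]]])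
       (simp add: algebra_simps)
  have XY: "p \<phi> = X \<phi> * cos \<phi> + Y \<phi> * sin \<phi>" for \<phi>
  proof -
    have "X \<phi> * cos \<phi> + Y \<phi> * sin \<phi> = p \<phi> * ((sin \<phi>)\<^sup>2 + (cos \<phi>)\<^sup>2)"
      unfolding X_def Y_def by algebra
    then show ?thesis by simp
  qed
  have "X \<tau> = 0" "Y \<sigma> = 0" using stop start by (simp_all add: X_def Y_def)
  have sin0: "0 \<le> sin \<phi>" and cos0: "0 \<le> cos \<phi>" if "\<phi> \<in> {\<sigma>..\<tau>}" for \<phi>
  proof -
    have "0 \<le> \<phi>" "\<phi> \<le> pi" "- (pi / 2) \<le> \<phi>" "\<phi> \<le> pi / 2"
      using that \<phi> pi_gt_zero unfolding atLeastAtMost_iff by linarith+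
    then show "0 \<le> sin \<phi>" "0 \<le> cos \<phi>" by (auto intro: sin_ge_zero cos_ge_zero)
  qed
  have w0: "0 \<le> w \<phi>" if "\<phi> \<in> {\<sigma>..\<tau>}" for \<phi>
    using rad[OF that] sin0[OF that] by (simp add: w_def)
  have Y0: "0 \<le> Y \<phi>" if "\<phi> \<in> {\<sigma>..\<tau>}" for \<phi>
  proof -
    have "Y \<sigma> \<le> Y \<phi>"
    proof (rule DERIV_nonneg_imp_nondecreasing[of "\<sigma>" "\<phi>" Y])
      fix t assume "\<sigma> \<le> t" "t \<le> \<phi>"
      with that have "t \<in> {\<sigma>..\<tau>}" by simp
      with Y'[of t] rad[of t] cos0[of t]
      show "\<exists>d. (Y has_real_derivative d) (at t) \<and> 0 \<le> d" by (meson mult_nonneg_nonneg)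
    qed (use that in simp)
    then show ?thesis using \<open>Y \<sigma> = 0\<close> by simp
  qed
  have slice: "Pair (X \<phi>) -` S = {- Y \<phi>..Y \<phi>}" if "\<sigma> < \<phi>" "\<phi> < \<tau>" for \<phi>
  proof (intro set_eqI iffI)
    fix y assume "y \<in> Pair (X \<phi>) -` S"
    then have "(X \<phi>, y) \<in> S" "(X \<phi>, - y) \<in> S" using sym(2) by auto
    with supp[of \<phi>] that have "y * sin \<phi> \<le> Y \<phi> * sin \<phi>" "- y * sin \<phi> \<le> Y \<phi> * sin \<phi>"
      using XY[of \<phi>] by fastforce+
    moreover have "sin \<phi> > 0" using that \<phi> pi_gt_zero by (intro sin_gt_zero) linarith+
    ultimately have "y \<le> Y \<phi>" "- y \<le> Y \<phi>" by (metis mult_le_cancel_right_pos)+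
    then show "y \<in> {- Y \<phi>..Y \<phi>}" by auto
  next
    fix y assume y: "y \<in> {- Y \<phi>..Y \<phi>}"
    have "(X \<phi>, Y \<phi>) \<in> S" using touch[of \<phi>] that by (simp add: X_def Y_def)
    moreover from this have "(X \<phi>, - Y \<phi>) \<in> S" by (rule sym(2))
    ultimately have "closed_segment (X \<phi>, - Y \<phi>) (X \<phi>, Y \<phi>) \<subseteq> S"
      using \<open>convex S\<close> by (simp add: convex_contains_segment)
    moreover have "(X \<phi>, y) \<in> closed_segment (X \<phi>, - Y \<phi>) (X \<phi>, Y \<phi>)"
    proof (cases "Y \<phi> = 0")
      case False
      with y have "Y \<phi> > 0" by auto
      define u where "u = (y + Y \<phi>) / (2 * Y \<phi>)"
      have "0 \<le> u" "u \<le> 1" using y \<open>Y \<phi> > 0\<close> by (auto simp: u_def pos_divide_le_eq)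
      moreover have "u * (2 * Y \<phi>) = y + Y \<phi>" using \<open>Y \<phi> > 0\<close> by (simp add: u_def)
      ultimately show ?thesis
        by (auto simp: in_segment algebra_simps intro!: exI[of _ u])
    qed (use y in auto)
    ultimately show "y \<in> Pair (X \<phi>) -` S" by auto
  qed
  \<comment> \<open>Since \<open>Y(\<sigma>) = 0\<close>, the support line of direction \<open>\<sigma>\<close> meets the first axis at \<open>X(\<sigma>)\<close>.\<close>
  have beyond: "Pair x -` S = {}" if "x > X \<sigma>" for x
  proof -
    have "cos \<sigma> > 0" using \<phi> pi_gt_zero by (intro cos_gt_zero_pi) linarith+
    have False if "(x, y) \<in> S" for y
    proof -
      have "(x, \<bar>y\<bar>) \<in> S" using that sym(2)[of x y] by (cases "y \<ge> 0") auto
      then have "x * cos \<sigma> + \<bar>y\<bar> * sin \<sigma> \<le> X \<sigma> * cos \<sigma>"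
        using supp[of \<sigma> x "\<bar>y\<bar>"] \<phi> unfolding XY[of \<sigma>] \<open>Y \<sigma> = 0\<close> by simp
      moreover have "0 \<le> \<bar>y\<bar> * sin \<sigma>" using sin0[of \<sigma>] \<phi> by simp
      ultimately have "x * cos \<sigma> \<le> X \<sigma> * cos \<sigma>" by linarith
      with \<open>cos \<sigma> > 0\<close> \<open>x > X \<sigma>\<close> show False by simp
    qed
    then show ?thesis by auto
  qed
  have Sb: "S \<in> sets (lborel \<Otimes>\<^sub>M lborel)"
    using S(1) by (metis lborel_prod sets_lborel borel_closed compact_imp_closed)
  define f where "f x = emeasure lborel (Pair x -` S)" for x
  have f_meas[measurable]: "f \<in> borel_measurable borel"
    using lborel.measurable_emeasure_Pair[OF Sb] by (simp add: f_def[abs_def])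
  have even: "f (- x) = f x" for x
  proof -
    have "Pair (- x) -` S = Pair x -` S" using sym(1)[of x] sym(1)[of "- x"] by auto
    then show ?thesis by (simp add: f_def)
  qed
  have fin: "f x < \<infinity>" for x
  proof -
    have "Pair x -` S \<subseteq> snd ` S" by force
    then have "bounded (Pair x -` S)"
      using S(1) by (meson bounded_snd bounded_subset compact_imp_bounded)
    then show ?thesis unfolding f_def by (rule emeasure_bounded_finite)
  qed
  define h where "h x = enn2real (f x)" for x
  have h_meas[measurable]: "h \<in> borel_measurable borel" unfolding h_def[abs_def] by measurable
  have fh: "f x = ennreal (h x)" for x using fin[of x] by (simp add: h_def)
  have hX: "h (X \<phi>) = 2 * Y \<phi>" if "\<sigma> < \<phi>" "\<phi> < \<tau>" for \<phi>
    using Y0[of \<phi>] that by (simp add: h_def f_def slice)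
  \<comment> \<open>The abscissa decreases with the angle; the opposite angle is an increasing substitution.\<close>
  define g where "g s = X (- s)" for s
  define g' where "g' s = w (- s)" for s
  have g: "(g has_real_derivative g' s) (at s)" for s
  proof -
    have "((\<lambda>s. X (- s)) has_real_derivative - w (- s) * (- 1)) (at s)"
      by (rule DERIV_chain2[OF X']) (auto intro!: derivative_eq_intros)
    then show ?thesis by (simp add: g_def[abs_def] g'_def)
  qed
  have cont: "continuous_on A p" "continuous_on A p''" "continuous_on A p'" for A
    using p by (auto intro: DERIV_continuous_on DERIV_subset continuous_on_subset)
  have contw: "continuous_on A w" for A
    unfolding w_def by (intro continuous_intros cont)
  have contg': "continuous_on A g'" for A
    unfolding g'_def by (rule continuous_on_compose2[OF contw[of UNIV]]) (auto intro!: continuous_intros)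
  have "(\<integral>\<^sup>+ x. f x * indicator {0..} x \<partial>lborel) = (\<integral>\<^sup>+ x. ennreal (h x * indicator {g (- \<tau>)..g (- \<sigma>)} x) \<partial>lborel)"
  proof (rule nn_integral_cong)
    fix x
    show "f x * indicator {0..} x = ennreal (h x * indicator {g (- \<tau>)..g (- \<sigma>)} x)"
      using beyond[of x] \<open>X \<tau> = 0\<close>
      by (cases "x > X \<sigma>") (auto simp: fh[symmetric] f_def g_def split: split_indicator)
  qed
  also have "\<dots> = (\<integral>\<^sup>+ s. ennreal (h (g s) * g' s * indicator {- \<tau>..- \<sigma>} s) \<partial>lborel)"
  proof (rule nn_integral_substitution)
    show "set_borel_measurable borel {g (- \<tau>)..g (- \<sigma>)} h"
      unfolding set_borel_measurable_def by measurable
    show "0 \<le> g' s" if "s \<in> {- \<tau>..- \<sigma>}" for s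
      unfolding g'_def using that by (intro w0) auto
    show "- \<tau> \<le> - \<sigma>" using \<phi>(2) by simp
  qed (rule g contg')+
  also have "\<dots> = (\<integral>\<^sup>+ s. ennreal (2 * Y (- s) * w (- s)) * indicator {- \<tau>..- \<sigma>} s \<partial>lborel)"
  proof (rule nn_integral_cong_AE)
    have "AE s in lborel. s \<notin> {- \<sigma>, - \<tau>}"
      by (intro AE_not_in finite_imp_null_set_lborel) auto
    then show "AE s in lborel. ennreal (h (g s) * g' s * indicator {- \<tau>..- \<sigma>} s) =
        ennreal (2 * Y (- s) * w (- s)) * indicator {- \<tau>..- \<sigma>} s"
    proof eventually_elim
      fix s assume s: "s \<notin> {- \<sigma>, - \<tau>}"
      show "ennreal (h (g s) * g' s * indicator {- \<tau>..- \<sigma>} s) =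
        ennreal (2 * Y (- s) * w (- s)) * indicator {- \<tau>..- \<sigma>} s"
      proof (cases "s \<in> {- \<tau>..- \<sigma>}")
        case True
        with s have "\<sigma> < - s" "- s < \<tau>" by auto
        with True show ?thesis by (simp add: g_def g'_def hX)
      qed simp
    qed
  qed
  also have "\<dots> = ennreal (- (G (- (- \<sigma>)) - X (- (- \<sigma>)) * Y (- (- \<sigma>)))
      - - (G (- (- \<tau>)) - X (- (- \<tau>)) * Y (- (- \<tau>))))"
  proof (rule nn_integral_FTC_Icc[where f = "\<lambda>s. 2 * Y (- s) * w (- s)"
        and F = "\<lambda>s. - (G (- s) - X (- s) * Y (- s))" and a = "- \<tau>" and b = "- \<sigma>"])
    have contY: "continuous_on UNIV (\<lambda>s. Y (- s))" "continuous_on UNIV (\<lambda>s. w (- s))"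
      unfolding Y_def by (intro continuous_intros continuous_on_compose2[OF cont(1)[of UNIV]]
          continuous_on_compose2[OF cont(3)[of UNIV]] continuous_on_compose2[OF contw[of UNIV]]; simp)+
    show "(\<lambda>s. 2 * Y (- s) * w (- s)) \<in> borel_measurable borel"
      by (intro borel_measurable_continuous_onI continuous_intros contY)
    show "((\<lambda>s. - (G (- s) - X (- s) * Y (- s))) has_real_derivative 2 * Y (- s) * w (- s)) (at s)" for s
    proof -
      define \<phi> where "\<phi> = - s"
      have *: "((\<lambda>\<phi>. - (G \<phi> - X \<phi> * Y \<phi>)) has_real_derivative
          - (p \<phi> * (p \<phi> + p'' \<phi>) - ((- w \<phi>) * Y \<phi> + (p \<phi> + p'' \<phi>) * cos \<phi> * X \<phi>))) (at \<phi>)"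
        by (intro DERIV_minus DERIV_diff DERIV_mult G X' Y')
      have "p \<phi> * (p \<phi> + p'' \<phi>) = X \<phi> * cos \<phi> * (p \<phi> + p'' \<phi>) + Y \<phi> * w \<phi>"
        using arg_cong[OF XY[of \<phi>], of "\<lambda>x. x * (p \<phi> + p'' \<phi>)"] unfolding w_def by (simp only: algebra_simps)
      then have "- (p \<phi> * (p \<phi> + p'' \<phi>) - ((- w \<phi>) * Y \<phi> + (p \<phi> + p'' \<phi>) * cos \<phi> * X \<phi>)) = - (2 * Y \<phi> * w \<phi>)"
        by (simp add: algebra_simps)
      from *[unfolded this] have "((\<lambda>\<phi>. - (G \<phi> - X \<phi> * Y \<phi>)) has_real_derivative - (2 * Y \<phi> * w \<phi>)) (at (- s))"
        by (simp only: \<phi>_def)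
      moreover have "(uminus has_real_derivative - 1) (at s)"
        by (auto intro!: derivative_eq_intros)
      ultimately have "((\<lambda>s. - (G (- s) - X (- s) * Y (- s))) has_real_derivative - (2 * Y \<phi> * w \<phi>) * - 1) (at s)"
        by (rule DERIV_chain2)
      then show ?thesis by (simp add: \<phi>_def)
    qed
    show "0 \<le> 2 * Y (- s) * w (- s)" if "s \<in> {- \<tau>..- \<sigma>}" for s
      using Y0[of "- s"] w0[of "- s"] that by simp
    show "- \<tau> \<le> - \<sigma>" using \<phi> by simp
  qed
  also have "\<dots> = ennreal (G \<tau> - G \<sigma>)"
    by (simp add: \<open>X \<tau> = 0\<close> \<open>Y \<sigma> = 0\<close>)
  finally have half: "(\<integral>\<^sup>+ x. f x * indicator {0..} x \<partial>lborel) = ennreal (G \<tau> - G \<sigma>)" .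
  have "(\<integral>\<^sup>+ x. f x * indicator {..<0} x \<partial>lborel) = (\<integral>\<^sup>+ x. f (- x) * indicator {..<0} (- x) \<partial>lborel)"
    by (subst nn_integral_real_affine[where c = "- 1" and t = 0]) auto
  also have "\<dots> = (\<integral>\<^sup>+ x. f x * indicator {0..} x \<partial>lborel)"
  proof (rule nn_integral_cong_AE)
    have "AE x in lborel. x \<noteq> (0 :: real)" by (rule AE_lborel_singleton)
    then show "AE x in lborel. f (- x) * indicator {..<0} (- x) = f x * indicator {0..} (x :: real)"
      by eventually_elim (auto simp: even split: split_indicator)
  qed
  finally have other: "(\<integral>\<^sup>+ x. f x * indicator {..<0} x \<partial>lborel) = ennreal (G \<tau> - G \<sigma>)"
    using half by simp
  have "G \<sigma> \<le> G \<tau>"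
  proof -
    have "0 \<le> p \<phi> * (p \<phi> + p'' \<phi>)" if "\<phi> \<in> {\<sigma>..\<tau>}" for \<phi>
    proof -
      have "X \<tau> \<le> X \<phi>"
      proof (rule DERIV_nonpos_imp_nonincreasing[of \<phi> "\<tau>" X])
        fix t assume "\<phi> \<le> t" "t \<le> \<tau>"
        with that have "t \<in> {\<sigma>..\<tau>}" by simp
        with X'[of t] w0[of t] show "\<exists>d. (X has_real_derivative d) (at t) \<and> d \<le> 0"
          by (meson neg_le_0_iff_le)
      qed (use that in simp)
      then have "0 \<le> p \<phi>" using Y0[OF that] sin0[OF that] cos0[OF that] \<open>X \<tau> = 0\<close> unfolding XY[of \<phi>] by simp
      then show ?thesis using rad[OF that] by simp
    qed
    then have "\<exists>d. (G has_real_derivative d) (at t) \<and> 0 \<le> d" if "\<sigma> \<le> t" "t \<le> \<tau>" for t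
      using G[of t] that by auto
    with \<phi> show ?thesis by (intro DERIV_nonneg_imp_nondecreasing[of "\<sigma>" "\<tau>" G]) auto
  qed
  have "emeasure lborel S = (\<integral>\<^sup>+ x. f x \<partial>lborel)"
    using lborel.emeasure_pair_measure_alt[OF Sb] unfolding lborel_prod f_def .
  also have "\<dots> = (\<integral>\<^sup>+ x. f x * indicator {0..} x + f x * indicator {..<0} x \<partial>lborel)"
    by (intro nn_integral_cong) (auto split: split_indicator)
  also have "\<dots> = ennreal (G \<tau> - G \<sigma>) + ennreal (G \<tau> - G \<sigma>)"
    by (subst nn_integral_add) (auto simp: half other)
  also have "\<dots> = ennreal (2 * (G \<tau> - G \<sigma>))"
    using \<open>G \<sigma> \<le> G \<tau>\<close> by (simp flip: ennreal_plus)
  finally show ?thesis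
    using \<open>G \<sigma> \<le> G \<tau>\<close> by (simp add: measure_def)
qed

section \<open>The support function of an ellipse\<close>

locale circle_and_ellipse =
  fixes a b r :: real
  assumes ab: "a \<ge> b" and b: "b > 0" and r: "r > 0"
begin

lemma a: "a > 0" using ab b by simp

text \<open>The support function of the ellipse, with its first two derivatives.\<close>

definition h :: "real \<Rightarrow> real" where
  "h \<phi> = sqrt (a\<^sup>2 * (cos \<phi>)\<^sup>2 + b\<^sup>2 * (sin \<phi>)\<^sup>2)"

definition h' :: "real \<Rightarrow> real" where
  "h' \<phi> = - ((a\<^sup>2 - b\<^sup>2) * (sin \<phi> * cos \<phi>)) / h \<phi>"

definition h'' :: "real \<Rightarrow> real" where
  "h'' \<phi> = a\<^sup>2 * b\<^sup>2 / (h \<phi>) ^ 3 - h \<phi>"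

lemma ab2: "b\<^sup>2 \<le> a\<^sup>2" using ab b by (simp add: power_mono)

lemma h_radicand: "a\<^sup>2 * (cos \<phi>)\<^sup>2 + b\<^sup>2 * (sin \<phi>)\<^sup>2 = b\<^sup>2 + (a\<^sup>2 - b\<^sup>2) * (cos \<phi>)\<^sup>2"
  unfolding sin_squared_eq by (simp add: algebra_simps)

lemma h_radicand_pos: "a\<^sup>2 * (cos \<phi>)\<^sup>2 + b\<^sup>2 * (sin \<phi>)\<^sup>2 > 0"
  unfolding h_radicand using b ab2 by (simp add: add_pos_nonneg)

lemma h_sq: "(h \<phi>)\<^sup>2 = a\<^sup>2 * (cos \<phi>)\<^sup>2 + b\<^sup>2 * (sin \<phi>)\<^sup>2"
  unfolding h_def using h_radicand_pos[of \<phi>] by simp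

lemma h_pos: "h \<phi> > 0"
  unfolding h_def using h_radicand_pos by simp

lemma h_ge: "b \<le> h \<phi>"
proof -
  have "b\<^sup>2 \<le> (h \<phi>)\<^sup>2" unfolding h_sq h_radicand using ab2 by simp
  then show ?thesis by (rule power2_le_imp_le) (use h_pos[of \<phi>] in simp)
qed

lemma h_le: "h \<phi> \<le> a"
proof -
  have "(cos \<phi>)\<^sup>2 \<le> 1"
    using sin_cos_squared_add[of \<phi>] zero_le_power2[of "sin \<phi>"] by linarith
  then have "(a\<^sup>2 - b\<^sup>2) * (cos \<phi>)\<^sup>2 \<le> a\<^sup>2 - b\<^sup>2"
    using ab2 by (intro mult_left_le) simp_all
  then have "(h \<phi>)\<^sup>2 \<le> a\<^sup>2"
    unfolding h_sq h_radicand by (simp only: le_diff_eq add.commute)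
  then show ?thesis by (rule power2_le_imp_le) (use a in simp)
qed

lemma h_antimono:
  assumes "0 \<le> s" "s \<le> t" "t \<le> pi / 2"
  shows "h t \<le> h s"
proof -
  have "0 \<le> cos t" using assms by (intro cos_ge_zero) linarith+
  moreover have "cos t \<le> cos s" using assms pi_gt_zero by (intro cos_monotone_0_pi_le) linarith+
  ultimately have "(cos t)\<^sup>2 \<le> (cos s)\<^sup>2" by (intro power_mono)
  then have "(h t)\<^sup>2 \<le> (h s)\<^sup>2"
    unfolding h_sq h_radicand using ab2 by (simp add: mult_left_mono)
  then show ?thesis by (rule power2_le_imp_le) (use h_pos[of s] in simp)
qed

lemma h_deriv: "(h has_real_derivative h' \<phi>) (at \<phi>)"
proof -
  define R where "R \<phi> = a\<^sup>2 * (cos \<phi>)\<^sup>2 + b\<^sup>2 * (sin \<phi>)\<^sup>2" for \<phi>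
  have "((\<lambda>\<phi>. b\<^sup>2 + (a\<^sup>2 - b\<^sup>2) * (cos \<phi> * cos \<phi>)) has_real_derivative
      0 + (a\<^sup>2 - b\<^sup>2) * (- sin \<phi> * cos \<phi> + - sin \<phi> * cos \<phi>)) (at \<phi>)"
    by (intro DERIV_add DERIV_const DERIV_cmult DERIV_mult DERIV_cos)
  moreover have "R = (\<lambda>\<phi>. b\<^sup>2 + (a\<^sup>2 - b\<^sup>2) * (cos \<phi> * cos \<phi>))"
    unfolding R_def h_radicand by (simp only: power2_eq_square)
  moreover have "0 + k * (- s * c + - s * c) = - 2 * (k * (s * c))" for k s c :: real by simp
  ultimately have "(R has_real_derivative - 2 * ((a\<^sup>2 - b\<^sup>2) * (sin \<phi> * cos \<phi>))) (at \<phi>)"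
    by (simp only:)
  moreover have pos: "R \<phi> > 0" unfolding R_def by (rule h_radicand_pos)
  ultimately have d: "((\<lambda>\<phi>. sqrt (R \<phi>)) has_real_derivative
      inverse (sqrt (R \<phi>)) / 2 * (- 2 * ((a\<^sup>2 - b\<^sup>2) * (sin \<phi> * cos \<phi>)))) (at \<phi>)"
    by (intro DERIV_chain2[where f = sqrt and g = R, OF DERIV_real_sqrt])
  have heq: "h = (\<lambda>\<phi>. sqrt (R \<phi>))" by (rule ext) (simp only: h_def R_def)
  have "inverse y / 2 * (- 2 * x) = - x / y" for x y :: real by (simp add: inverse_eq_divide)
  then have "inverse (sqrt (R \<phi>)) / 2 * (- 2 * ((a\<^sup>2 - b\<^sup>2) * (sin \<phi> * cos \<phi>))) = h' \<phi>"
    unfolding h'_def heq .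
  with d show ?thesis unfolding heq by (simp only:)
qed

lemma h'_deriv: "(h' has_real_derivative h'' \<phi>) (at \<phi>)"
proof -
  let ?s = "sin \<phi>" and ?c = "cos \<phi>" and ?h = "h \<phi>"
  have num: "((\<lambda>\<phi>. - ((a\<^sup>2 - b\<^sup>2) * (sin \<phi> * cos \<phi>))) has_real_derivative - ((a\<^sup>2 - b\<^sup>2) * (?c\<^sup>2 - ?s\<^sup>2))) (at \<phi>)"
  proof -
    have "((\<lambda>\<phi>. (- (a\<^sup>2 - b\<^sup>2)) * (sin \<phi> * cos \<phi>)) has_real_derivative
        (- (a\<^sup>2 - b\<^sup>2)) * (?c * ?c + - ?s * ?s)) (at \<phi>)"
      by (intro DERIV_cmult DERIV_mult DERIV_sin DERIV_cos)
    moreover have "(- k) * (c * c + - s * s) = - (k * (c\<^sup>2 - s\<^sup>2))" for k s c :: real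
      by (simp add: power2_eq_square algebra_simps)
    ultimately show ?thesis by (simp only: mult_minus_left)
  qed
  have h0: "?h \<noteq> 0" using h_pos[of \<phi>] by simp
  have "(h' has_real_derivative
      (- ((a\<^sup>2 - b\<^sup>2) * (?c\<^sup>2 - ?s\<^sup>2)) * ?h - - ((a\<^sup>2 - b\<^sup>2) * (?s * ?c)) * h' \<phi>) / (?h * ?h)) (at \<phi>)"
    unfolding h'_def[abs_def] by (rule DERIV_divide[OF num h_deriv[unfolded h'_def] h0])
  also have "(- ((a\<^sup>2 - b\<^sup>2) * (?c\<^sup>2 - ?s\<^sup>2)) * ?h - - ((a\<^sup>2 - b\<^sup>2) * (?s * ?c)) * h' \<phi>) / (?h * ?h) = h'' \<phi>"
  proof -
    have hh': "h' \<phi> * ?h = - ((a\<^sup>2 - b\<^sup>2) * (?s * ?c))" using h0 by (simp add: h'_def)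
    have key: "(h \<phi>)\<^sup>2 * (h \<phi>)\<^sup>2 - (a\<^sup>2 - b\<^sup>2) * (?c\<^sup>2 - ?s\<^sup>2) * (h \<phi>)\<^sup>2 - ((a\<^sup>2 - b\<^sup>2) * (?s * ?c))\<^sup>2 = a\<^sup>2 * b\<^sup>2"
    proof -
      have "(h \<phi>)\<^sup>2 * (h \<phi>)\<^sup>2 - (a\<^sup>2 - b\<^sup>2) * (?c\<^sup>2 - ?s\<^sup>2) * (h \<phi>)\<^sup>2 - ((a\<^sup>2 - b\<^sup>2) * (?s * ?c))\<^sup>2
        = a\<^sup>2 * b\<^sup>2 * (?s\<^sup>2 + ?c\<^sup>2)\<^sup>2" unfolding h_sq by algebra
      then show ?thesis by simp
    qed
    define u where "u = - ((a\<^sup>2 - b\<^sup>2) * (?c\<^sup>2 - ?s\<^sup>2))"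
    define v where "v = (a\<^sup>2 - b\<^sup>2) * (?s * ?c)"
    have key': "?h ^ 4 + u * ?h\<^sup>2 - v\<^sup>2 = a\<^sup>2 * b\<^sup>2"
      using key unfolding u_def v_def by (simp add: power4_eq_xxxx power2_eq_square algebra_simps)
    have "(u * ?h + v * h' \<phi>) * ?h = (h'' \<phi> * (?h * ?h)) * ?h"
    proof -
      have "(u * ?h + v * h' \<phi>) * ?h = u * ?h\<^sup>2 + v * (h' \<phi> * ?h)" by algebra
      also have "\<dots> = u * ?h\<^sup>2 - v\<^sup>2" unfolding hh' v_def by (simp add: power2_eq_square)
      also have "\<dots> = a\<^sup>2 * b\<^sup>2 - ?h ^ 4" using key' by simp
      also have "\<dots> = (h'' \<phi> * (?h * ?h)) * ?h"
      proof -
        have "h'' \<phi> * ?h ^ 3 = a\<^sup>2 * b\<^sup>2 - ?h * ?h ^ 3"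
          unfolding h''_def left_diff_distrib using h0 by simp
        then show ?thesis by (simp add: power4_eq_xxxx power3_eq_cube algebra_simps)
      qed
      finally show ?thesis .
    qed
    then have "u * ?h + v * h' \<phi> = h'' \<phi> * (?h * ?h)" using h0 by simp
    then show ?thesis using h0 unfolding u_def v_def by (simp add: nonzero_divide_eq_eq)
  qed
  finally show ?thesis .
qed

lemma continuous_h: "continuous_on A h"
  by (rule DERIV_continuous_on[of _ _ h']) (meson h_deriv DERIV_subset subset_UNIV)

lemma continuous_h'': "continuous_on A h''"
  unfolding h''_def[abs_def]
  by (intro continuous_intros continuous_h) (use h_pos in \<open>auto simp: less_imp_neq[symmetric]\<close>)

text \<open>This is the radius of curvature at the point with normal direction \<open>\<phi>\<close>.\<close>

lemma h_plus_h'': "h \<phi> + h'' \<phi> = a\<^sup>2 * b\<^sup>2 / (h \<phi>) ^ 3"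
  by (simp add: h''_def)

lemma contact_point_fst: "h \<phi> * cos \<phi> - h' \<phi> * sin \<phi> = a\<^sup>2 * cos \<phi> / h \<phi>"
proof -
  have "(h \<phi> * cos \<phi> - h' \<phi> * sin \<phi>) * h \<phi> = (h \<phi>)\<^sup>2 * cos \<phi> - (h' \<phi> * h \<phi>) * sin \<phi>"
    by algebra
  also have "h' \<phi> * h \<phi> = - ((a\<^sup>2 - b\<^sup>2) * (sin \<phi> * cos \<phi>))"
    using h_pos[of \<phi>] by (simp add: h'_def)
  also have "(h \<phi>)\<^sup>2 * cos \<phi> - - ((a\<^sup>2 - b\<^sup>2) * (sin \<phi> * cos \<phi>)) * sin \<phi> = a\<^sup>2 * cos \<phi> * ((sin \<phi>)\<^sup>2 + (cos \<phi>)\<^sup>2)"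
    unfolding h_sq by algebra
  also have "\<dots> = a\<^sup>2 * cos \<phi>" by simp
  finally show ?thesis using h_pos[of \<phi>] by (simp add: nonzero_eq_divide_eq)
qed

lemma contact_point_snd: "h \<phi> * sin \<phi> + h' \<phi> * cos \<phi> = b\<^sup>2 * sin \<phi> / h \<phi>"
proof -
  have "(h \<phi> * sin \<phi> + h' \<phi> * cos \<phi>) * h \<phi> = (h \<phi>)\<^sup>2 * sin \<phi> + (h' \<phi> * h \<phi>) * cos \<phi>"
    by algebra
  also have "h' \<phi> * h \<phi> = - ((a\<^sup>2 - b\<^sup>2) * (sin \<phi> * cos \<phi>))"
    using h_pos[of \<phi>] by (simp add: h'_def)
  also have "(h \<phi>)\<^sup>2 * sin \<phi> + - ((a\<^sup>2 - b\<^sup>2) * (sin \<phi> * cos \<phi>)) * cos \<phi> = b\<^sup>2 * sin \<phi> * ((sin \<phi>)\<^sup>2 + (cos \<phi>)\<^sup>2)"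
    unfolding h_sq by algebra
  also have "\<dots> = b\<^sup>2 * sin \<phi>" by simp
  finally show ?thesis using h_pos[of \<phi>] by (simp add: nonzero_eq_divide_eq)
qed

text \<open>The function \<open>arctan (b / a * tan \<phi>)\<close>, written so that it is smooth across the right angle. It stems from
the subtraction formula for \<open>arctan (b / a * tan \<phi>) - \<phi>\<close>.\<close>

definition \<nu> :: "real \<Rightarrow> real" where
  "\<nu> \<phi> = \<phi> + arctan ((b - a) * (sin \<phi> * cos \<phi>) / (a * (cos \<phi>)\<^sup>2 + b * (sin \<phi>)\<^sup>2))"

lemma \<nu>_denominator_pos: "a * (cos \<phi>)\<^sup>2 + b * (sin \<phi>)\<^sup>2 > 0"
proof -
  have "a * (cos \<phi>)\<^sup>2 + b * (sin \<phi>)\<^sup>2 = b + (a - b) * (cos \<phi>)\<^sup>2"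
    unfolding sin_squared_eq by (simp add: algebra_simps)
  then show ?thesis using ab b by (simp add: add_pos_nonneg)
qed

lemma \<nu>_deriv: "(\<nu> has_real_derivative a * b / (h \<phi>)\<^sup>2) (at \<phi>)"
proof -
  let ?s = "sin \<phi>" and ?c = "cos \<phi>"
  define n where "n \<phi> = (b - a) * (sin \<phi> * cos \<phi>)" for \<phi>
  define d where "d \<phi> = a * (cos \<phi>)\<^sup>2 + b * (sin \<phi>)\<^sup>2" for \<phi>
  define n' where "n' = (b - a) * (?c\<^sup>2 - ?s\<^sup>2)"
  define d' where "d' = 2 * (b - a) * (?s * ?c)"
  have nd: "(n has_real_derivative n') (at \<phi>)" "(d has_real_derivative d') (at \<phi>)"
  proof -
    have "((\<lambda>\<phi>. (b - a) * (sin \<phi> * cos \<phi>)) has_real_derivative (b - a) * (?c * ?c + - ?s * ?s)) (at \<phi>)"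
      by (intro DERIV_cmult DERIV_mult DERIV_sin DERIV_cos)
    then show "(n has_real_derivative n') (at \<phi>)"
      unfolding n_def n'_def by (simp add: power2_eq_square)
    have "((\<lambda>\<phi>. a * (cos \<phi> * cos \<phi>) + b * (sin \<phi> * sin \<phi>)) has_real_derivative
        a * (- ?s * ?c + - ?s * ?c) + b * (?c * ?s + ?c * ?s)) (at \<phi>)"
      by (intro DERIV_add DERIV_cmult DERIV_mult DERIV_sin DERIV_cos)
    moreover have "a * (- s * c + - s * c) + b * (c * s + c * s) = 2 * (b - a) * (s * c)" for s c :: real
      by (simp add: algebra_simps)
    ultimately show "(d has_real_derivative d') (at \<phi>)"
      unfolding d_def d'_def power2_eq_square by (simp only:)
  qed
  have d0: "d \<phi> \<noteq> 0" using \<nu>_denominator_pos[of \<phi>] by (simp add: d_def)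
  have hh: "(d \<phi>)\<^sup>2 + (n \<phi>)\<^sup>2 = (h \<phi>)\<^sup>2"
  proof -
    have "(d \<phi>)\<^sup>2 + (n \<phi>)\<^sup>2 = (a\<^sup>2 * ?c\<^sup>2 + b\<^sup>2 * ?s\<^sup>2) * (?s\<^sup>2 + ?c\<^sup>2)"
      unfolding d_def n_def by algebra
    then show ?thesis by (simp add: h_sq)
  qed
  have nn: "(h \<phi>)\<^sup>2 + (n' * d \<phi> - n \<phi> * d') = a * b"
  proof -
    have "(h \<phi>)\<^sup>2 * (?s\<^sup>2 + ?c\<^sup>2) + (n' * d \<phi> - n \<phi> * d') = a * b * (?s\<^sup>2 + ?c\<^sup>2)\<^sup>2"
      unfolding h_sq d_def n_def n'_def d'_def by algebra
    then show ?thesis by simp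
  qed
  have "((\<lambda>\<phi>. n \<phi> / d \<phi>) has_real_derivative (n' * d \<phi> - n \<phi> * d') / (d \<phi> * d \<phi>)) (at \<phi>)"
    by (rule DERIV_divide[OF nd d0])
  from DERIV_chain2[OF DERIV_arctan this] have
    "((\<lambda>\<phi>. arctan (n \<phi> / d \<phi>)) has_real_derivative
      inverse (1 + (n \<phi> / d \<phi>)\<^sup>2) * ((n' * d \<phi> - n \<phi> * d') / (d \<phi> * d \<phi>))) (at \<phi>)" .
  also have "inverse (1 + (n \<phi> / d \<phi>)\<^sup>2) * ((n' * d \<phi> - n \<phi> * d') / (d \<phi> * d \<phi>))
      = (n' * d \<phi> - n \<phi> * d') / (h \<phi>)\<^sup>2"
  proof -
    have "1 + (n \<phi> / d \<phi>)\<^sup>2 = (h \<phi>)\<^sup>2 / (d \<phi>)\<^sup>2"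
      unfolding hh[symmetric] using d0 by (simp add: power_divide add_divide_distrib)
    then show ?thesis using d0 by (simp add: power2_eq_square)
  qed
  finally have "((\<lambda>\<phi>. \<phi> + arctan (n \<phi> / d \<phi>)) has_real_derivative 1 + (n' * d \<phi> - n \<phi> * d') / (h \<phi>)\<^sup>2) (at \<phi>)"
    by (intro DERIV_add DERIV_ident)
  moreover have "1 + (n' * d \<phi> - n \<phi> * d') / (h \<phi>)\<^sup>2 = a * b / (h \<phi>)\<^sup>2"
    unfolding nn[symmetric] add_divide_distrib using h_pos[of \<phi>] by simp
  ultimately show ?thesis by (simp add: \<nu>_def[abs_def] n_def d_def)
qed

lemma \<nu>_eq_arctan:
  assumes "0 \<le> \<phi>" "\<phi> < pi / 2"
  shows "\<nu> \<phi> = arctan (b / a * tan \<phi>)"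
proof -
  define D where "D t = \<nu> t - arctan (b / a * tan t)" for t
  have "(D has_real_derivative 0) (at t)" if "0 \<le> t" "t < pi / 2" for t
  proof -
    have c: "cos t > 0" using that pi_gt_zero by (intro cos_gt_zero_pi) linarith+
    have "((\<lambda>t. b / a * tan t) has_real_derivative b / a * inverse ((cos t)\<^sup>2)) (at t)"
      using c by (intro DERIV_cmult DERIV_tan) simp
    from DERIV_chain2[OF DERIV_arctan this] have
      "((\<lambda>t. arctan (b / a * tan t)) has_real_derivative
        inverse (1 + (b / a * tan t)\<^sup>2) * (b / a * inverse ((cos t)\<^sup>2))) (at t)" .
    moreover have "inverse (1 + (b / a * tan t)\<^sup>2) * (b / a * inverse ((cos t)\<^sup>2)) = a * b / (h t)\<^sup>2"
    proof -
      have "(1 + (b / a * tan t)\<^sup>2) * (a\<^sup>2 * (cos t)\<^sup>2) = (h t)\<^sup>2"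
        unfolding h_sq tan_def using c a by (simp add: power_mult_distrib power_divide distrib_right)
      then have "(h t)\<^sup>2 = (1 + (b / a * tan t)\<^sup>2) * (a\<^sup>2 * (cos t)\<^sup>2)" ..
      moreover have "1 + (b / a * tan t)\<^sup>2 > 0" by (simp add: add_pos_nonneg)
      ultimately show ?thesis using c a by (simp add: divide_inverse power2_eq_square)
    qed
    ultimately show ?thesis
      unfolding D_def using DERIV_diff[OF \<nu>_deriv[of t]] by fastforce
  qed
  note D = this
  have "D \<phi> = D 0"
  proof (cases "\<phi> = 0")
    case False
    show ?thesis
    proof (rule DERIV_isconst_end[where a = 0 and b = \<phi> and f = D])
      show "0 < \<phi>" using False assms by simp
      show "continuous_on {0..\<phi>} D"
        using D assms by (intro continuous_at_imp_continuous_on ballI DERIV_isCont[OF D]) auto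
      show "(D has_real_derivative 0) (at t)" if "0 < t" "t < \<phi>" for t
        using D[of t] that assms by simp
    qed
  qed simp
  then show ?thesis by (simp add: D_def \<nu>_def)
qed

end

lemma ellint_E_deriv:
  "((\<lambda>\<phi>. ellint_E \<phi> k) has_real_derivative sqrt (1 - k\<^sup>2 * (sin x)\<^sup>2)) (at x)"
proof -
  let ?f = "\<lambda>\<theta>. sqrt (1 - k\<^sup>2 * (sin \<theta>)\<^sup>2)"
  define m where "m = \<bar>x\<bar> + 1"
  have "((\<lambda>u. LBINT y=ereal 0..ereal u. ?f y) has_vector_derivative ?f x) (at x within {- m..m})"
    by (rule interval_integral_FTC2) (auto simp: m_def intro!: continuous_intros)
  moreover have "at x within {- m..m} = at x"
    by (rule at_within_interior) (auto simp: m_def)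
  ultimately show ?thesis
    by (simp add: ellint_E_def zero_ereal_def has_real_derivative_iff_has_vector_derivative)
qed

context circle_and_ellipse
begin

lemma h_eq_elliptic_integrand: "h \<phi> = a * sqrt (1 - (eccentricity a b)\<^sup>2 * (sin \<phi>)\<^sup>2)"
proof -
  have "(eccentricity a b)\<^sup>2 = (a\<^sup>2 - b\<^sup>2) / a\<^sup>2"
    using ab2 by (simp add: eccentricity_def power_divide)
  then have "a\<^sup>2 * (1 - (eccentricity a b)\<^sup>2 * (sin \<phi>)\<^sup>2) = a\<^sup>2 - (a\<^sup>2 - b\<^sup>2) * (sin \<phi>)\<^sup>2"
    using a by (simp add: right_diff_distrib)
  also have "\<dots> = a\<^sup>2 * (cos \<phi>)\<^sup>2 + b\<^sup>2 * (sin \<phi>)\<^sup>2"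
    unfolding cos_squared_eq by (simp add: algebra_simps)
  finally have "h \<phi> = sqrt (a\<^sup>2 * (1 - (eccentricity a b)\<^sup>2 * (sin \<phi>)\<^sup>2))"
    by (simp add: h_def)
  then show ?thesis using a by (simp add: real_sqrt_mult)
qed

text \<open>An antiderivative of \<open>p (p + p'')\<close> for the support function \<open>p = \<rho> + h\<close> of the curve at signed distance
\<open>\<rho>\<close> from the ellipse. The expansion of this product contains \<open>h\<^sup>2 + h h'' = a\<^sup>2 b\<^sup>2 / h\<^sup>2\<close>, which leads to \<open>\<nu>\<close>,
and \<open>\<rho> (2 h + h'')\<close>, which leads to the elliptic integral and to \<open>h'\<close>.\<close>

definition sweep :: "real \<Rightarrow> real \<Rightarrow> real" where
  "sweep \<rho> \<phi> = \<rho>\<^sup>2 * \<phi> + a * b * \<nu> \<phi> + 2 * \<rho> * a * ellint_E \<phi> (eccentricity a b) + \<rho> * h' \<phi>"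

lemma sweep_deriv: "(sweep \<rho> has_real_derivative (\<rho> + h \<phi>) * (\<rho> + h \<phi> + h'' \<phi>)) (at \<phi>)"
proof -
  have "(sweep \<rho> has_real_derivative
      \<rho>\<^sup>2 * 1 + a * b * (a * b / (h \<phi>)\<^sup>2) + 2 * \<rho> * a * sqrt (1 - (eccentricity a b)\<^sup>2 * (sin \<phi>)\<^sup>2) + \<rho> * h'' \<phi>) (at \<phi>)"
    unfolding sweep_def[abs_def]
    by (intro DERIV_add DERIV_cmult DERIV_ident \<nu>_deriv ellint_E_deriv h'_deriv)
  moreover have 1: "a * b * (a * b / (h \<phi>)\<^sup>2) = h \<phi> * (h \<phi> + h'' \<phi>)"
    unfolding h_plus_h'' using h_pos[of \<phi>] by (simp add: power2_eq_square power3_eq_cube)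
  moreover have 2: "2 * \<rho> * a * sqrt (1 - (eccentricity a b)\<^sup>2 * (sin \<phi>)\<^sup>2) = 2 * \<rho> * h \<phi>"
    by (simp add: h_eq_elliptic_integrand)
  moreover have "\<rho>\<^sup>2 * 1 + h \<phi> * (h \<phi> + h'' \<phi>) + 2 * \<rho> * h \<phi> + \<rho> * h'' \<phi> = (\<rho> + h \<phi>) * (\<rho> + h \<phi> + h'' \<phi>)"
    by algebra
  ultimately show ?thesis by (simp only:)
qed

lemma sweep_0: "sweep \<rho> 0 = 0"
  by (simp add: sweep_def \<nu>_def h'_def ellint_E_def zero_ereal_def[symmetric])

lemma sweep_right_angle:
  "2 * sweep \<rho> (pi / 2) = pi * \<rho>\<^sup>2 + pi * a * b + 4 * \<rho> * a * complete_ellint_E (eccentricity a b)"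
  by (simp add: sweep_def \<nu>_def h'_def complete_ellint_E_def algebra_simps)

text \<open>At the right angle itself the equation fails, since \<open>tan (\<pi> / 2) = 0\<close> by convention.\<close>

lemma F_eq_sweep:
  assumes "0 \<le> \<phi>" "\<phi> < pi / 2"
  shows "F r a b \<phi> = 2 * sweep (- r) \<phi>"
proof -
  let ?\<epsilon> = "eccentricity a b"
  have e2: "a\<^sup>2 * ?\<epsilon>\<^sup>2 = a\<^sup>2 - b\<^sup>2"
    using ab2 a by (simp add: eccentricity_def power_divide)
  have q: "sqrt (1 - ?\<epsilon>\<^sup>2 * (sin \<phi>)\<^sup>2) = h \<phi> / a"
    using a by (simp add: h_eq_elliptic_integrand)
  have "r * a * ?\<epsilon>\<^sup>2 * sin (2 * \<phi>) / sqrt (1 - ?\<epsilon>\<^sup>2 * (sin \<phi>)\<^sup>2) = r * (a\<^sup>2 * ?\<epsilon>\<^sup>2) * (2 * sin \<phi> * cos \<phi>) / h \<phi>"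
    unfolding q sin_double by (simp add: power2_eq_square)
  also have "\<dots> = 2 * (- r * h' \<phi>)"
    unfolding e2 by (simp add: h'_def)
  finally show ?thesis
    unfolding F_def Let_def by (simp add: sweep_def \<nu>_eq_arctan[OF assms])
qed

end

section \<open>Parallel body, enclosing centres and enclosed centres\<close>

context circle_and_ellipse
begin

definition K :: "(real \<times> real) set" where
  "K = {(x, y). x\<^sup>2 / a\<^sup>2 + y\<^sup>2 / b\<^sup>2 \<le> 1}"

definition C :: "(real \<times> real) set" where
  "C = {(x, y). x\<^sup>2 / a\<^sup>2 + y\<^sup>2 / b\<^sup>2 = 1}"

text \<open>The three regions of centres of disks of radius \<open>r\<close>: the disk meets \<open>K\<close>, contains \<open>C\<close>, or is contained in
\<open>K\<close>. By convexity of \<open>K\<close> the last condition concerns only the boundary of the disk.\<close>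

definition parallel_body :: "(real \<times> real) set" where
  "parallel_body = {v. \<exists>e \<in> K. dist v e \<le> r}"

definition enclosing :: "(real \<times> real) set" where
  "enclosing = {v. C \<subseteq> cball v r}"

definition enclosed :: "(real \<times> real) set" where
  "enclosed = {v. sphere v r \<subseteq> K}"

lemma C_subset_K: "C \<subseteq> K" by (auto simp: C_def K_def)

lemma K_image: "K = (\<lambda>(x, y). (a * x, b * y)) ` cball (0, 0) 1"
proof (intro set_eqI iffI)
  fix v assume "v \<in> K"
  then obtain x y where v: "v = (x, y)" "(x / a)\<^sup>2 + (y / b)\<^sup>2 \<le> 1"
    by (auto simp: K_def power_divide)
  have "dist (0, 0) (x / a, y / b) = sqrt ((x / a)\<^sup>2 + (y / b)\<^sup>2)"
    by (simp add: dist_prod_def dist_real_def power_divide)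
  with v(2) have "dist (0, 0) (x / a, y / b) \<le> 1" by simp
  then have "(x / a, y / b) \<in> cball (0, 0) 1" by simp
  moreover have "v = (\<lambda>(x, y). (a * x, b * y)) (x / a, y / b)" using a b v by simp
  ultimately show "v \<in> (\<lambda>(x, y). (a * x, b * y)) ` cball (0, 0) 1" by (rule rev_image_eqI)
next
  fix v assume "v \<in> (\<lambda>(x, y). (a * x, b * y)) ` cball (0, 0) 1"
  then obtain x y where v: "(x, y) \<in> cball (0, 0) 1" "v = (a * x, b * y)" by auto
  from v(1) have "sqrt (x\<^sup>2 + y\<^sup>2) \<le> 1" by (simp add: dist_prod_def dist_real_def)
  then have "x\<^sup>2 + y\<^sup>2 \<le> 1" by simp
  with v a b show "v \<in> K" by (simp add: K_def power_mult_distrib)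
qed

lemma convex_K: "convex K" and compact_K: "compact K"
proof -
  have lin: "linear (\<lambda>(x, y). (a * x, b * y))"
    by (rule linearI) (auto simp: algebra_simps)
  then show "convex K" unfolding K_image by (intro convex_linear_image) auto
  have "continuous_on UNIV (\<lambda>(x, y). (a * x, b * y))"
    by (simp add: case_prod_unfold continuous_intros)
  then show "compact K" unfolding K_image
    by (intro compact_continuous_image) (auto intro: continuous_on_subset)
qed

lemma K_support:
  assumes "(x, y) \<in> K"
  shows "x * cos \<phi> + y * sin \<phi> \<le> h \<phi>"
proof -
  have q: "(x / a)\<^sup>2 + (y / b)\<^sup>2 \<le> 1" using assms by (simp add: K_def power_divide)
  have "(x * cos \<phi> + y * sin \<phi>)\<^sup>2 = ((x / a) * (a * cos \<phi>) + (y / b) * (b * sin \<phi>))\<^sup>2"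
    using a b by simp
  also have "\<dots> \<le> ((x / a)\<^sup>2 + (y / b)\<^sup>2) * ((a * cos \<phi>)\<^sup>2 + (b * sin \<phi>)\<^sup>2)"
  proof -
    have "(p * s + q * t)\<^sup>2 \<le> (p\<^sup>2 + q\<^sup>2) * (s\<^sup>2 + t\<^sup>2)" for p q s t :: real
    proof -
      have "(p\<^sup>2 + q\<^sup>2) * (s\<^sup>2 + t\<^sup>2) - (p * s + q * t)\<^sup>2 = (p * t - q * s)\<^sup>2" by algebra
      then show ?thesis by (metis diff_ge_0_iff_ge zero_le_power2)
    qed
    then show ?thesis .
  qed
  also have "\<dots> \<le> 1 * ((a * cos \<phi>)\<^sup>2 + (b * sin \<phi>)\<^sup>2)"
    using q by (intro mult_right_mono) auto
  also have "\<dots> = (h \<phi>)\<^sup>2" by (simp add: h_sq power_mult_distrib)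
  finally show ?thesis by (rule power2_le_imp_le) (use h_pos[of \<phi>] in simp)
qed

text \<open>The point of the ellipse with outer normal direction \<open>\<phi>\<close>.\<close>

definition contact :: "real \<Rightarrow> real \<times> real" where
  "contact \<phi> = (a\<^sup>2 * cos \<phi> / h \<phi>, b\<^sup>2 * sin \<phi> / h \<phi>)"

lemma contact_in_C: "contact \<phi> \<in> C"
proof -
  have "(a\<^sup>2 * cos \<phi> / h \<phi>)\<^sup>2 / a\<^sup>2 = (a * cos \<phi>)\<^sup>2 / (h \<phi>)\<^sup>2"
    using a by (simp add: power2_eq_square)
  moreover have "(b\<^sup>2 * sin \<phi> / h \<phi>)\<^sup>2 / b\<^sup>2 = (b * sin \<phi>)\<^sup>2 / (h \<phi>)\<^sup>2"
    using b by (simp add: power2_eq_square)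
  moreover have "(a * cos \<phi>)\<^sup>2 + (b * sin \<phi>)\<^sup>2 = (h \<phi>)\<^sup>2"
    by (simp add: h_sq power_mult_distrib)
  ultimately show ?thesis
    using h_pos[of \<phi>] by (simp add: C_def contact_def flip: add_divide_distrib)
qed

lemma contact_height: "fst (contact \<phi>) * cos \<phi> + snd (contact \<phi>) * sin \<phi> = h \<phi>"
proof -
  have "(fst (contact \<phi>) * cos \<phi> + snd (contact \<phi>) * sin \<phi>) * h \<phi> = (h \<phi>)\<^sup>2"
    unfolding h_sq using h_pos[of \<phi>] by (simp add: contact_def distrib_right power2_eq_square)
  then show ?thesis using h_pos[of \<phi>] by (simp add: power2_eq_square)
qed

lemma uminus_C: "(- x, - y) \<in> C \<longleftrightarrow> (x, y) \<in> C" "(- x, y) \<in> C \<longleftrightarrow> (x, y) \<in> C" "(x, - y) \<in> C \<longleftrightarrow> (x, y) \<in> C"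
  by (simp_all add: C_def)

lemma uminus_K: "(- x, - y) \<in> K \<longleftrightarrow> (x, y) \<in> K" "(- x, y) \<in> K \<longleftrightarrow> (x, y) \<in> K" "(x, - y) \<in> K \<longleftrightarrow> (x, y) \<in> K"
  by (simp_all add: K_def)

definition offset :: "real \<Rightarrow> real \<Rightarrow> real \<times> real" where
  "offset \<rho> \<phi> = (fst (contact \<phi>) + \<rho> * cos \<phi>, snd (contact \<phi>) + \<rho> * sin \<phi>)"

text \<open>Along the ellipse the left hand side is the power of \<open>(x, y)\<close> with respect to the circle of radius \<open>\<bar>\<rho>\<bar>\<close>
that touches the ellipse at \<open>contact \<phi>\<close>. Along the circle it is a multiple of the equation of the ellipse.
The factor \<open>\<rho> h\<close> is the one for which the gradient of the left hand side vanishes at the point of contact, so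
that no linear terms remain on the right. The signs of the two coefficients decide global containment of either
curve in the other.\<close>

lemma contact_identity:
  "(x - fst (offset \<rho> \<phi>))\<^sup>2 + (y - snd (offset \<rho> \<phi>))\<^sup>2 - \<rho>\<^sup>2 - \<rho> * h \<phi> * (1 - x\<^sup>2 / a\<^sup>2 - y\<^sup>2 / b\<^sup>2)
   = (1 + \<rho> * h \<phi> / a\<^sup>2) * (x - fst (contact \<phi>))\<^sup>2 + (1 + \<rho> * h \<phi> / b\<^sup>2) * (y - snd (contact \<phi>))\<^sup>2"
proof -
  \<comment> \<open>In these variables the identity is a polynomial consequence of the four relations \<open>A\<close>, \<open>cs\<close> and \<open>hh\<close>.\<close>
  define X Y where "X = cos \<phi> / h \<phi>" and "Y = sin \<phi> / h \<phi>"
  define A B where "A = inverse (a\<^sup>2)" and "B = inverse (b\<^sup>2)"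
  define H where "H = h \<phi>"
  have H: "H \<noteq> 0" using h_pos[of \<phi>] by (simp add: H_def)
  have A: "A * a\<^sup>2 = 1" "B * b\<^sup>2 = 1" using a b by (simp_all add: A_def B_def)
  have c: "cos \<phi> = X * H" "sin \<phi> = Y * H" using H by (simp_all add: X_def Y_def H_def)
  have cs: "H\<^sup>2 * (X\<^sup>2 + Y\<^sup>2) = 1"
    using sin_cos_squared_add[of \<phi>] unfolding c by (simp add: algebra_simps power_mult_distrib)
  have hh: "a\<^sup>2 * X\<^sup>2 + b\<^sup>2 * Y\<^sup>2 = 1"
  proof -
    have "H\<^sup>2 * (a\<^sup>2 * X\<^sup>2 + b\<^sup>2 * Y\<^sup>2) = H\<^sup>2 * 1"
      using h_sq[of \<phi>] unfolding c H_def[symmetric] by (simp add: algebra_simps power_mult_distrib)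
    then show ?thesis using H by simp
  qed
  have f: "fst (contact \<phi>) = a\<^sup>2 * X" "snd (contact \<phi>) = b\<^sup>2 * Y"
    by (simp_all add: contact_def X_def Y_def)
  have "(x - (a\<^sup>2 * X + \<rho> * (X * H)))\<^sup>2 + (y - (b\<^sup>2 * Y + \<rho> * (Y * H)))\<^sup>2 - \<rho>\<^sup>2 - \<rho> * H * (1 - x\<^sup>2 * A - y\<^sup>2 * B)
   = (1 + \<rho> * H * A) * (x - a\<^sup>2 * X)\<^sup>2 + (1 + \<rho> * H * B) * (y - b\<^sup>2 * Y)\<^sup>2"
    using A cs hh by algebra
  then show ?thesis
    by (simp add: offset_def f c H_def[symmetric] A_def B_def divide_inverse)
qed

lemma dist_le_iff: "dist (x, y) (x', y') \<le> r \<longleftrightarrow> (x - x')\<^sup>2 + (y - y')\<^sup>2 \<le> r\<^sup>2"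
proof -
  have "dist (x, y) (x', y') = sqrt ((x - x')\<^sup>2 + (y - y')\<^sup>2)"
    by (simp add: dist_prod_def dist_real_def)
  moreover have "r = sqrt (r\<^sup>2)" using r by simp
  ultimately show ?thesis by (metis real_sqrt_le_iff)
qed

lemma dist_eq_iff: "dist (x, y) (x', y') = r \<longleftrightarrow> (x - x')\<^sup>2 + (y - y')\<^sup>2 = r\<^sup>2"
proof -
  have "dist (x, y) (x', y') = sqrt ((x - x')\<^sup>2 + (y - y')\<^sup>2)"
    by (simp add: dist_prod_def dist_real_def)
  moreover have "r = sqrt (r\<^sup>2)" using r by simp
  ultimately show ?thesis by (metis real_sqrt_eq_iff)
qed

lemma offset_enclosed:
  assumes "r * h \<phi> \<le> b\<^sup>2"
  shows "offset (- r) \<phi> \<in> enclosed"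
proof -
  have "(x, y) \<in> K" if "dist (offset (- r) \<phi>) (x, y) = r" for x y
  proof -
    obtain X Y where o: "offset (- r) \<phi> = (X, Y)" by fastforce
    with that have d: "(x - X)\<^sup>2 + (y - Y)\<^sup>2 = r\<^sup>2"
      using dist_eq_iff[of x y X Y] by (simp add: dist_commute)
    have "r * h \<phi> \<le> a\<^sup>2" using assms ab2 by linarith
    then have "r * h \<phi> / a\<^sup>2 \<le> 1" "r * h \<phi> / b\<^sup>2 \<le> 1"
      using assms a b by (simp_all add: pos_divide_le_eq)
    then have "0 \<le> 1 + - r * h \<phi> / a\<^sup>2" "0 \<le> 1 + - r * h \<phi> / b\<^sup>2"
      unfolding mult_minus_left minus_divide_left[symmetric] by linarith+
    then have "0 \<le> (1 + - r * h \<phi> / a\<^sup>2) * (x - fst (contact \<phi>))\<^sup>2 + (1 + - r * h \<phi> / b\<^sup>2) * (y - snd (contact \<phi>))\<^sup>2"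
      by (intro add_nonneg_nonneg[OF mult_nonneg_nonneg mult_nonneg_nonneg]) simp_all
    then have "0 \<le> r * h \<phi> * (1 - x\<^sup>2 / a\<^sup>2 - y\<^sup>2 / b\<^sup>2)"
      unfolding contact_identity[symmetric] o using d by simp
    moreover have "0 < r * h \<phi>" using r h_pos[of \<phi>] by simp
    ultimately have "0 \<le> 1 - x\<^sup>2 / a\<^sup>2 - y\<^sup>2 / b\<^sup>2"
      unfolding zero_le_mult_iff by linarith
    then show ?thesis by (simp add: K_def)
  qed
  then show ?thesis by (auto simp: enclosed_def)
qed

lemma offset_enclosing:
  assumes "a\<^sup>2 \<le> r * h \<phi>"
  shows "offset (- r) \<phi> \<in> enclosing"
proof -
  have "dist (offset (- r) \<phi>) (x, y) \<le> r" if "(x, y) \<in> C" for x y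
  proof -
    obtain X Y where o: "offset (- r) \<phi> = (X, Y)" by fastforce
    have "b\<^sup>2 \<le> r * h \<phi>" using assms ab2 by linarith
    then have "1 \<le> r * h \<phi> / a\<^sup>2" "1 \<le> r * h \<phi> / b\<^sup>2"
      using assms a b by (simp_all add: pos_le_divide_eq)
    then have "1 + - r * h \<phi> / a\<^sup>2 \<le> 0" "1 + - r * h \<phi> / b\<^sup>2 \<le> 0"
      unfolding mult_minus_left minus_divide_left[symmetric] by linarith+
    then have "(1 + - r * h \<phi> / a\<^sup>2) * (x - fst (contact \<phi>))\<^sup>2 + (1 + - r * h \<phi> / b\<^sup>2) * (y - snd (contact \<phi>))\<^sup>2 \<le> 0"
      by (intro add_nonpos_nonpos[OF mult_nonpos_nonneg mult_nonpos_nonneg]) simp_all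
    moreover have "1 - x\<^sup>2 / a\<^sup>2 - y\<^sup>2 / b\<^sup>2 = 0" using that by (simp add: C_def)
    ultimately have "(x - X)\<^sup>2 + (y - Y)\<^sup>2 \<le> r\<^sup>2"
      unfolding contact_identity[symmetric] o by simp
    then show ?thesis using dist_le_iff[of x y X Y] by (simp add: o dist_commute)
  qed
  then show ?thesis by (auto simp: enclosing_def)
qed

lemma unit_normal_dist: "dist (x, y) (x + s * cos \<phi>, y + s * sin \<phi>) = \<bar>s\<bar>"
proof -
  have "(s * cos \<phi>)\<^sup>2 + (s * sin \<phi>)\<^sup>2 = s\<^sup>2 * ((sin \<phi>)\<^sup>2 + (cos \<phi>)\<^sup>2)" by algebra
  then show ?thesis by (simp add: dist_prod_def dist_real_def)
qed

lemma offset_parallel_body: "offset r \<phi> \<in> parallel_body"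
proof -
  have "dist (contact \<phi>) (offset r \<phi>) = r"
    using unit_normal_dist[of "fst (contact \<phi>)" "snd (contact \<phi>)" r \<phi>] r by (simp add: offset_def)
  then show ?thesis using contact_in_C[of \<phi>] C_subset_K unfolding parallel_body_def
    by (force simp: dist_commute)
qed

lemma normal_component_le_dist: "(x - x') * cos \<phi> + (y - y') * sin \<phi> \<le> dist (x, y) (x', y')"
proof -
  have "((x - x') * cos \<phi> + (y - y') * sin \<phi>)\<^sup>2 \<le> (x - x')\<^sup>2 + (y - y')\<^sup>2"
  proof -
    have "((x - x') * cos \<phi> + (y - y') * sin \<phi>)\<^sup>2 + ((x - x') * sin \<phi> - (y - y') * cos \<phi>)\<^sup>2
        = ((x - x')\<^sup>2 + (y - y')\<^sup>2) * ((sin \<phi>)\<^sup>2 + (cos \<phi>)\<^sup>2)" by algebra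
    then have "((x - x') * cos \<phi> + (y - y') * sin \<phi>)\<^sup>2 + ((x - x') * sin \<phi> - (y - y') * cos \<phi>)\<^sup>2
        = (x - x')\<^sup>2 + (y - y')\<^sup>2" by simp
    then show ?thesis using zero_le_power2[of "(x - x') * sin \<phi> - (y - y') * cos \<phi>"] by linarith
  qed
  then show ?thesis by (simp add: dist_prod_def dist_real_def real_le_rsqrt)
qed

lemma parallel_body_support: "(x, y) \<in> parallel_body \<Longrightarrow> x * cos \<phi> + y * sin \<phi> \<le> r + h \<phi>"
proof -
  assume "(x, y) \<in> parallel_body"
  then obtain x' y' where e: "(x', y') \<in> K" "dist (x, y) (x', y') \<le> r" by (auto simp: parallel_body_def)
  from K_support[OF e(1), of \<phi>] normal_component_le_dist[of x x' \<phi> y y'] e(2)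
  show ?thesis by (simp add: algebra_simps)
qed

lemma enclosing_support: "(x, y) \<in> enclosing \<Longrightarrow> x * cos \<phi> + y * sin \<phi> \<le> r - h \<phi>"
proof -
  assume v: "(x, y) \<in> enclosing"
  obtain X Y where c: "contact \<phi> = (X, Y)" by fastforce
  have "(- X, - Y) \<in> C" using contact_in_C[of \<phi>] by (simp add: c uminus_C)
  with v have "dist (x, y) (- X, - Y) \<le> r" by (auto simp: enclosing_def)
  with normal_component_le_dist[of x "- X" \<phi> y "- Y"] contact_height[of \<phi>]
  show ?thesis by (simp add: c algebra_simps)
qed

lemma enclosed_support: "(x, y) \<in> enclosed \<Longrightarrow> x * cos \<phi> + y * sin \<phi> \<le> h \<phi> - r"
proof -
  assume "(x, y) \<in> enclosed"
  then have "(x + r * cos \<phi>, y + r * sin \<phi>) \<in> K"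
    using unit_normal_dist[of x y r \<phi>] r by (auto simp: enclosed_def)
  from K_support[OF this, of \<phi>] have
    "x * cos \<phi> + y * sin \<phi> + r * ((sin \<phi>)\<^sup>2 + (cos \<phi>)\<^sup>2) \<le> h \<phi>"
    by (simp only: power2_eq_square algebra_simps)
  then show ?thesis by simp
qed

lemma reflect_dist: "dist (- x, y) (- x', y') = dist (x, y :: real) (x' :: real, y')"
  "dist (x, - y) (x', - y') = dist (x, y :: real) (x' :: real, y')"
proof -
  have "\<bar>- u - - w\<bar> = \<bar>u - w\<bar>" for u w :: real by simp
  then show "dist (- x, y) (- x', y') = dist (x, y) (x', y')" "dist (x, - y) (x', - y') = dist (x, y) (x', y')"
    unfolding dist_prod_def dist_real_def fst_conv snd_conv by simp_all
qed

lemma parallel_body_reflect: "(x, y) \<in> parallel_body \<Longrightarrow> (- x, y) \<in> parallel_body" "(x, y) \<in> parallel_body \<Longrightarrow> (x, - y) \<in> parallel_body"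
proof -
  assume "(x, y) \<in> parallel_body"
  then obtain x' y' where e: "(x', y') \<in> K" "dist (x, y) (x', y') \<le> r" by (auto simp: parallel_body_def)
  then show "(- x, y) \<in> parallel_body" "(x, - y) \<in> parallel_body"
    using uminus_K[of x' y'] reflect_dist[of x y x' y'] unfolding parallel_body_def by force+
qed

lemma enclosing_reflect: "(x, y) \<in> enclosing \<Longrightarrow> (- x, y) \<in> enclosing"
  "(x, y) \<in> enclosing \<Longrightarrow> (x, - y) \<in> enclosing"
proof -
  assume v: "(x, y) \<in> enclosing"
  have "dist (- x, y) (x', y') \<le> r" "dist (x, - y) (x', y') \<le> r" if "(x', y') \<in> C" for x' y'
  proof -
    have "(- x', y') \<in> C" "(x', - y') \<in> C" using that by (simp_all add: uminus_C)
    with v have "dist (x, y) (- x', y') \<le> r" "dist (x, y) (x', - y') \<le> r" by (auto simp: enclosing_def)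
    then show "dist (- x, y) (x', y') \<le> r" "dist (x, - y) (x', y') \<le> r"
      using reflect_dist(1)[of x y "- x'" y'] reflect_dist(2)[of x y x' "- y'"] by simp_all
  qed
  then show "(- x, y) \<in> enclosing" "(x, - y) \<in> enclosing" by (auto simp: enclosing_def)
qed

lemma enclosed_reflect: "(x, y) \<in> enclosed \<Longrightarrow> (- x, y) \<in> enclosed"
  "(x, y) \<in> enclosed \<Longrightarrow> (x, - y) \<in> enclosed"
proof -
  assume v: "(x, y) \<in> enclosed"
  have 1: "(x', y') \<in> K" if "dist (- x, y) (x', y') = r" for x' y'
  proof -
    have "dist (x, y) (- x', y') = r" using that reflect_dist(1)[of x y "- x'" y'] by simp
    then have "(- x', y') \<in> K" using v by (auto simp: enclosed_def)
    then show ?thesis by (simp add: uminus_K)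
  qed
  have 2: "(x', y') \<in> K" if "dist (x, - y) (x', y') = r" for x' y'
  proof -
    have "dist (x, y) (x', - y') = r" using that reflect_dist(2)[of x y x' "- y'"] by simp
    then have "(x', - y') \<in> K" using v by (auto simp: enclosed_def)
    then show ?thesis by (simp add: uminus_K)
  qed
  from 1 2 show "(- x, y) \<in> enclosed" "(x, - y) \<in> enclosed" by (auto simp: enclosed_def)
qed

lemma parallel_body_eq_sum: "parallel_body = (\<Union>e\<in>K. \<Union>u\<in>cball 0 r. {e + u})"
proof (intro set_eqI iffI)
  fix v assume "v \<in> parallel_body"
  then obtain e where e: "e \<in> K" "dist v e \<le> r" by (auto simp: parallel_body_def)
  then have "v - e \<in> cball 0 r" "v = e + (v - e)" by (auto simp: dist_norm norm_minus_commute)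
  with e show "v \<in> (\<Union>e\<in>K. \<Union>u\<in>cball 0 r. {e + u})" by blast
next
  fix v assume "v \<in> (\<Union>e\<in>K. \<Union>u\<in>cball 0 r. {e + u})"
  then obtain e u where "e \<in> K" "norm u \<le> r" "v = e + u" by auto
  then show "v \<in> parallel_body" unfolding parallel_body_def by (auto simp: dist_norm intro!: bexI[of _ e])
qed

lemma parallel_body_compact_convex: "compact parallel_body" "convex parallel_body"
proof -
  have "parallel_body = {x + y |x y. x \<in> K \<and> y \<in> cball 0 r}"
    unfolding parallel_body_eq_sum by blast
  then show "compact parallel_body" by (simp only: compact_sums[OF compact_K compact_cball])
  show "convex parallel_body" unfolding parallel_body_eq_sum by (intro convex_sums convex_K convex_cball)
qed

lemma vertex_in_C: "(a, 0) \<in> C" "(- a, 0) \<in> C" "(0, b) \<in> C" "(0, - b) \<in> C"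
  using a b by (simp_all add: C_def)

lemma enclosing_compact_convex: "compact enclosing" "convex enclosing"
proof -
  have eq: "enclosing = (\<Inter>e\<in>C. cball e r)" by (auto simp: enclosing_def dist_commute)
  show "convex enclosing" unfolding eq by (intro convex_INT) auto
  have "closed enclosing" unfolding eq by (intro closed_INT) auto
  moreover have "enclosing \<subseteq> cball (a, 0) r" using eq vertex_in_C by blast
  ultimately show "compact enclosing"
    by (meson bounded_cball bounded_subset compact_eq_bounded_closed)
qed

lemma enclosed_compact_convex: "compact enclosed" "convex enclosed"
proof -
  have eq: "enclosed = (\<Inter>u\<in>sphere 0 r. (+) (- u) ` K)"
  proof (intro set_eqI iffI)
    fix v assume v: "v \<in> enclosed"
    show "v \<in> (\<Inter>u\<in>sphere 0 r. (+) (- u) ` K)"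
    proof
      fix u :: "real \<times> real" assume "u \<in> sphere 0 r"
      then have "v + u \<in> sphere v r" by (simp add: dist_norm)
      with v have "v + u \<in> K" by (auto simp: enclosed_def)
      then show "v \<in> (+) (- u) ` K" by (rule rev_image_eqI) simp
    qed
  next
    fix v assume v: "v \<in> (\<Inter>u\<in>sphere 0 r. (+) (- u) ` K)"
    have "w \<in> K" if "dist v w = r" for w
    proof -
      have "w - v \<in> sphere 0 r" using that by (simp add: dist_norm norm_minus_commute)
      with v have "v \<in> (+) (- (w - v)) ` K" by blast
      then show ?thesis by force
    qed
    then show "v \<in> enclosed" by (auto simp: enclosed_def)
  qed
  show "convex enclosed" unfolding eq by (intro convex_INT convex_translation convex_K)
  have "closed enclosed" unfolding eq
    by (intro closed_INT ballI compact_imp_closed compact_translation compact_K)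
  moreover have "(r, 0) \<in> sphere (0 :: real \<times> real) r" using r by (simp add: norm_prod_def)
  then have "enclosed \<subseteq> (+) (- (r, 0)) ` K" using eq by blast
  ultimately show "compact enclosed"
    by (meson bounded_subset compact_eq_bounded_closed compact_translation compact_K)
qed

lemma offset_coords:
  "fst (offset \<rho> \<phi>) = (\<rho> + h \<phi>) * cos \<phi> - h' \<phi> * sin \<phi>"
  "snd (offset \<rho> \<phi>) = (\<rho> + h \<phi>) * sin \<phi> + h' \<phi> * cos \<phi>"
  using contact_point_fst[of \<phi>] contact_point_snd[of \<phi>]
  by (simp_all add: offset_def contact_def algebra_simps)

lemma h'_ends: "h' 0 = 0" "h' (pi / 2) = 0" by (simp_all add: h'_def)

lemma support_derivs:
  "((\<lambda>\<phi>. \<rho> + h \<phi>) has_real_derivative h' \<phi>) (at \<phi>)"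
  "((\<lambda>\<phi>. - (\<rho> + h \<phi>)) has_real_derivative - h' \<phi>) (at \<phi>)"
  "((\<lambda>\<phi>. - h' \<phi>) has_real_derivative - h'' \<phi>) (at \<phi>)"
proof -
  show 1: "((\<lambda>\<phi>. \<rho> + h \<phi>) has_real_derivative h' \<phi>) (at \<phi>)"
    using DERIV_add[OF DERIV_const h_deriv, of \<rho>] by simp
  show "((\<lambda>\<phi>. - (\<rho> + h \<phi>)) has_real_derivative - h' \<phi>) (at \<phi>)"
    by (rule DERIV_minus[OF 1])
  show "((\<lambda>\<phi>. - h' \<phi>) has_real_derivative - h'' \<phi>) (at \<phi>)"
    by (rule DERIV_minus[OF h'_deriv])
qed

lemma parallel_body_area:
  "measure lborel parallel_body = (pi * r\<^sup>2 + pi * a * b + 4 * r * a * complete_ellint_E (eccentricity a b))"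
proof -
  have "measure lborel parallel_body = (2 * (sweep r (pi / 2) - sweep r 0))"
  proof (rule area_from_support_function[where p = "\<lambda>\<phi>. r + h \<phi>" and p' = h' and p'' = h''
        and \<sigma> = 0 and \<tau> = "pi / 2" and G = "sweep r"])
    show "0 \<le> r + h \<phi> + h'' \<phi>" for \<phi>
      using h_plus_h''[of \<phi>] h_pos[of \<phi>] r a b by (simp add: add.assoc)
    show "((r + h \<phi>) * cos \<phi> - h' \<phi> * sin \<phi>, (r + h \<phi>) * sin \<phi> + h' \<phi> * cos \<phi>) \<in> parallel_body" for \<phi>
      using offset_parallel_body[of \<phi>] unfolding offset_coords[symmetric] by simp
  qed (auto simp: h'_ends intro: parallel_body_compact_convex parallel_body_reflect parallel_body_support
      support_derivs h'_deriv continuous_h'' sweep_deriv)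
  then show ?thesis using sweep_right_angle[of r] by (simp add: sweep_0)
qed

text \<open>The conditions under which the two coefficients in \<open>contact_identity\<close> have a common sign also give the
radius of curvature \<open>\<plusminus> (h + h'' - r)\<close> of the parallel curve the right sign.\<close>

lemma curvature_bounds:
  shows "a\<^sup>2 \<le> r * h \<phi> \<Longrightarrow> h \<phi> + h'' \<phi> \<le> r" and "r * h \<phi> \<le> b\<^sup>2 \<Longrightarrow> r \<le> h \<phi> + h'' \<phi>"
proof -
  have h3: "(h \<phi>) ^ 3 > 0" using h_pos[of \<phi>] by simp
  have b2: "b\<^sup>2 \<le> (h \<phi>)\<^sup>2" "(h \<phi>)\<^sup>2 \<le> a\<^sup>2"
    using h_ge[of \<phi>] h_le[of \<phi>] h_pos[of \<phi>] b by (simp_all add: power_mono)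
  have eq: "(r * h \<phi>) * (h \<phi>)\<^sup>2 = r * (h \<phi>) ^ 3" by (simp add: power2_eq_square power3_eq_cube)
  show "h \<phi> + h'' \<phi> \<le> r" if "a\<^sup>2 \<le> r * h \<phi>"
  proof -
    have "a\<^sup>2 * b\<^sup>2 \<le> (r * h \<phi>) * (h \<phi>)\<^sup>2"
      using that b2 r h_pos[of \<phi>] by (intro mult_mono) auto
    then show ?thesis unfolding h_plus_h'' eq using h3 by (simp only: pos_divide_le_eq)
  qed
  show "r \<le> h \<phi> + h'' \<phi>" if "r * h \<phi> \<le> b\<^sup>2"
  proof -
    have "(r * h \<phi>) * (h \<phi>)\<^sup>2 \<le> b\<^sup>2 * a\<^sup>2"
      using that b2 r h_pos[of \<phi>] by (intro mult_mono) auto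
    then show ?thesis unfolding h_plus_h'' eq using h3 by (simp only: pos_le_divide_eq mult.commute)
  qed
qed

text \<open>The centres of the disks that contain the ellipse are bounded by the inner parallel curve, reflected at the
origin: a disk that contains the ellipse and touches it at the point with normal direction \<open>\<phi> + \<pi>\<close> has its centre
at distance \<open>r\<close> from this point in the direction \<open>\<phi>\<close>. Hence the support function is \<open>r - h\<close>.\<close>

lemma enclosing_area_sweep:
  assumes "0 < \<beta>" "\<beta> \<le> pi / 2"
    and large: "\<And>\<phi>. \<phi> \<in> {0..\<beta>} \<Longrightarrow> a\<^sup>2 \<le> r * h \<phi>"
    and stop: "r * h \<beta> = a\<^sup>2 \<or> \<beta> = pi / 2"
  shows "measure lborel enclosing = (2 * sweep (- r) \<beta>)"
proof -
  have "measure lborel enclosing = (2 * (sweep (- r) \<beta> - sweep (- r) 0))"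
  proof (rule area_from_support_function[where p = "\<lambda>\<phi>. - (- r + h \<phi>)" and p' = "\<lambda>\<phi>. - h' \<phi>"
        and p'' = "\<lambda>\<phi>. - h'' \<phi>" and \<sigma> = 0 and \<tau> = \<beta> and G = "sweep (- r)"])
    show "0 \<le> - (- r + h \<phi>) + - h'' \<phi>" if "\<phi> \<in> {0..\<beta>}" for \<phi>
      using curvature_bounds(1)[OF large[OF that]] by simp
    show "x * cos \<phi> + y * sin \<phi> \<le> - (- r + h \<phi>)" if "(x, y) \<in> enclosing" for \<phi> x y
      using enclosing_support[OF that] by simp
    show "(- (- r + h \<phi>) * cos \<phi> - - h' \<phi> * sin \<phi>, - (- r + h \<phi>) * sin \<phi> + - h' \<phi> * cos \<phi>) \<in> enclosing"
      if "\<phi> \<in> {0..\<beta>}" for \<phi>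
    proof -
      obtain X Y where o: "offset (- r) \<phi> = (X, Y)" by fastforce
      have "(X, Y) \<in> enclosing" using offset_enclosing[OF large[OF that]] by (simp add: o)
      then have "(- X, - Y) \<in> enclosing" using enclosing_reflect by blast
      moreover have "- (- r + h \<phi>) * cos \<phi> - - h' \<phi> * sin \<phi> = - X"
        "- (- r + h \<phi>) * sin \<phi> + - h' \<phi> * cos \<phi> = - Y"
        using offset_coords[of "- r" \<phi>] by (simp_all add: o algebra_simps)
      ultimately show ?thesis by simp
    qed
    show "- (- r + h \<beta>) * cos \<beta> - - h' \<beta> * sin \<beta> = 0"
    proof -
      have "- (- r + h \<beta>) * cos \<beta> - - h' \<beta> * sin \<beta> = (r - a\<^sup>2 / h \<beta>) * cos \<beta>"
        using contact_point_fst[of \<beta>] by (simp add: algebra_simps)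
      also have "\<dots> = 0"
      proof (cases "\<beta> = pi / 2")
        case False
        with stop have "r = a\<^sup>2 / h \<beta>" using h_pos[of \<beta>] by (simp add: nonzero_eq_divide_eq)
        then show ?thesis by simp
      next
        case True
        then have "cos \<beta> = 0" by (simp only: cos_pi_half)
        then show ?thesis by simp
      qed
      finally show ?thesis .
    qed
    show "(sweep (- r) has_real_derivative - (- r + h \<phi>) * (- (- r + h \<phi>) + - h'' \<phi>)) (at \<phi>)" for \<phi>
      using sweep_deriv[of "- r" \<phi>] by (simp add: algebra_simps)
    show "- (- r + h 0) * sin 0 + - h' 0 * cos 0 = 0" by (simp add: h'_ends)
    show "continuous_on UNIV (\<lambda>\<phi>. - h'' \<phi>)" by (intro continuous_intros continuous_h'')
  qed (rule enclosing_compact_convex enclosing_reflect support_derivs(2,3) assms(1,2) order.refl; assumption?)+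
  then show ?thesis by (simp add: sweep_0)
qed

lemma enclosed_area_sweep:
  assumes "0 \<le> \<alpha>" "\<alpha> < pi / 2"
    and small: "\<And>\<phi>. \<phi> \<in> {\<alpha>..pi / 2} \<Longrightarrow> r * h \<phi> \<le> b\<^sup>2"
    and start: "r * h \<alpha> = b\<^sup>2 \<or> \<alpha> = 0"
  shows "measure lborel enclosed = (2 * (sweep (- r) (pi / 2) - sweep (- r) \<alpha>))"
proof (rule area_from_support_function[where p = "\<lambda>\<phi>. - r + h \<phi>" and p' = h' and p'' = h''
      and \<sigma> = \<alpha> and \<tau> = "pi / 2" and G = "sweep (- r)"])
  show "0 \<le> - r + h \<phi> + h'' \<phi>" if "\<phi> \<in> {\<alpha>..pi / 2}" for \<phi>
    using curvature_bounds(2)[OF small[OF that]] by simp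
  show "x * cos \<phi> + y * sin \<phi> \<le> - r + h \<phi>" if "(x, y) \<in> enclosed" for \<phi> x y
    using enclosed_support[OF that] by simp
  show "((- r + h \<phi>) * cos \<phi> - h' \<phi> * sin \<phi>, (- r + h \<phi>) * sin \<phi> + h' \<phi> * cos \<phi>) \<in> enclosed"
    if "\<phi> \<in> {\<alpha>..pi / 2}" for \<phi>
    using offset_enclosed[OF small[OF that]] unfolding offset_coords[symmetric] by simp
  show "(- r + h \<alpha>) * sin \<alpha> + h' \<alpha> * cos \<alpha> = 0"
  proof -
    have "(- r + h \<alpha>) * sin \<alpha> + h' \<alpha> * cos \<alpha> = (b\<^sup>2 / h \<alpha> - r) * sin \<alpha>"
      using contact_point_snd[of \<alpha>] by (simp add: algebra_simps)
    also have "\<dots> = 0"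
    proof (cases "\<alpha> = 0")
      case False
      with start have "r = b\<^sup>2 / h \<alpha>" using h_pos[of \<alpha>] by (simp add: nonzero_eq_divide_eq)
      then show ?thesis by simp
    qed simp
    finally show ?thesis .
  qed
  show "(- r + h (pi / 2)) * cos (pi / 2) - h' (pi / 2) * sin (pi / 2) = 0" by (simp add: h'_ends)
qed (rule enclosed_compact_convex enclosed_reflect support_derivs(1) h'_deriv continuous_h'' sweep_deriv
    assms(1,2) order.refl; assumption?)+

lemma h_arctan: "(h (arctan t))\<^sup>2 * (1 + t\<^sup>2) = a\<^sup>2 + b\<^sup>2 * t\<^sup>2"
proof -
  have "1 + t\<^sup>2 > 0" by (simp add: add_pos_nonneg)
  then show ?thesis
    unfolding h_sq cos_arctan sin_arctan
    by (simp add: power_divide distrib_right)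
qed

lemma h_0: "h 0 = a" and h_right_angle: "h (pi / 2) = b"
  using a b by (simp_all add: h_def)

text \<open>If \<open>r\<close> is at least the largest radius of curvature \<open>a\<^sup>2 / b\<close>, the whole quarter of the parallel curve bounds the
region. Otherwise the curve leaves the first quadrant at the angle \<open>\<beta>\<close> with \<open>r h(\<beta>) = a\<^sup>2\<close>.\<close>

theorem enclosing_area:
  assumes "a < r"
  shows "measure lborel enclosing = (if a\<^sup>2 / b \<le> r
      then pi * r\<^sup>2 + pi * a * b - 4 * r * a * complete_ellint_E (eccentricity a b)
      else F r a b (beta r a b))"
proof (cases "a\<^sup>2 / b \<le> r")
  case True
  then have "a\<^sup>2 \<le> r * b" using b by (simp add: pos_divide_le_eq)
  moreover have "r * b \<le> r * h \<phi>" for \<phi> using h_ge[of \<phi>] r by simp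
  ultimately have "a\<^sup>2 \<le> r * h \<phi>" for \<phi> by (rule order.trans)
  then have "measure lborel enclosing = (2 * sweep (- r) (pi / 2))"
    by (intro enclosing_area_sweep) auto
  then show ?thesis using True sweep_right_angle[of "- r"] by simp
next
  case False
  then have rb: "r * b < a\<^sup>2" using b by (simp add: pos_divide_le_eq)
  then have "(r * b)\<^sup>2 < (a\<^sup>2)\<^sup>2" using r b by (intro power_strict_mono) auto
  then have d: "a ^ 4 - r\<^sup>2 * b\<^sup>2 > 0" by (simp add: power_mult_distrib flip: power_mult)
  have e: "r\<^sup>2 - a\<^sup>2 > 0" using assms a by (simp add: power_strict_mono)
  define t where "t = a * sqrt (r\<^sup>2 - a\<^sup>2) / sqrt (a ^ 4 - r\<^sup>2 * b\<^sup>2)"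
  have "t > 0" using a d e by (simp add: t_def)
  have t2: "t\<^sup>2 * (a ^ 4 - r\<^sup>2 * b\<^sup>2) = a\<^sup>2 * (r\<^sup>2 - a\<^sup>2)"
    using d e by (simp add: t_def power_divide power_mult_distrib)
  have \<beta>: "beta r a b = arctan t" "0 < arctan t" "arctan t < pi / 2"
    using \<open>t > 0\<close> arctan_ubound[of t] by (simp_all add: beta_def t_def)
  have "(r * h (arctan t))\<^sup>2 * (1 + t\<^sup>2) = (a\<^sup>2)\<^sup>2 * (1 + t\<^sup>2)"
  proof -
    have "(r * h (arctan t))\<^sup>2 * (1 + t\<^sup>2) = r\<^sup>2 * (a\<^sup>2 + b\<^sup>2 * t\<^sup>2)"
      unfolding h_arctan[symmetric] by (simp add: power_mult_distrib)
    also have "\<dots> = (a\<^sup>2)\<^sup>2 * (1 + t\<^sup>2)" using t2 by algebra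
    finally show ?thesis .
  qed
  moreover have "1 + t\<^sup>2 \<noteq> 0" using zero_le_power2[of t] by linarith
  ultimately have "(r * h (arctan t))\<^sup>2 = (a\<^sup>2)\<^sup>2" by simp
  then have h: "r * h (arctan t) = a\<^sup>2"
    by (rule power2_eq_imp_eq) (use r h_pos[of "arctan t"] in simp_all)
  have "measure lborel enclosing = (2 * sweep (- r) (arctan t))"
  proof (rule enclosing_area_sweep)
    show "a\<^sup>2 \<le> r * h \<phi>" if "\<phi> \<in> {0..arctan t}" for \<phi>
      unfolding h[symmetric] using h_antimono[of \<phi> "arctan t"] that \<beta> r by simp
  qed (use \<beta> h in auto)
  then show ?thesis using False \<beta> F_eq_sweep[of "arctan t"] by simp
qed

text \<open>If \<open>r\<close> is at most the smallest radius of curvature \<open>b\<^sup>2 / a\<close>, the whole quarter of the parallel curve bounds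
the region. Otherwise the curve enters the first quadrant only at the angle \<open>\<alpha>\<close> with \<open>r h(\<alpha>) = b\<^sup>2\<close>.\<close>

theorem enclosed_area:
  assumes "b > r"
  shows "measure lborel enclosed = (if b\<^sup>2 / a < r then F_tilde r a b (alpha r a b)
      else pi * r\<^sup>2 + pi * a * b - 4 * r * a * complete_ellint_E (eccentricity a b))"
proof (cases "b\<^sup>2 / a < r")
  case False
  then have "r * a \<le> b\<^sup>2" using a by (simp add: pos_divide_less_eq)
  moreover have "r * h \<phi> \<le> r * a" for \<phi> using h_le[of \<phi>] r by simp
  ultimately have "r * h \<phi> \<le> b\<^sup>2" for \<phi> using order.trans by blast
  then have "measure lborel enclosed = (2 * (sweep (- r) (pi / 2) - sweep (- r) 0))"
    by (intro enclosed_area_sweep) auto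
  then show ?thesis using False sweep_right_angle[of "- r"] by (simp add: sweep_0)
next
  case True
  then have rb: "b\<^sup>2 < r * a" using a by (simp add: pos_divide_less_eq)
  then have "(b\<^sup>2)\<^sup>2 < (r * a)\<^sup>2" by (intro power_strict_mono) auto
  then have d: "r\<^sup>2 * a\<^sup>2 - b ^ 4 > 0" by (simp add: power_mult_distrib flip: power_mult)
  have e: "b\<^sup>2 - r\<^sup>2 > 0" using assms r by (simp add: power_strict_mono)
  define t where "t = sqrt (r\<^sup>2 * a\<^sup>2 - b ^ 4) / (b * sqrt (b\<^sup>2 - r\<^sup>2))"
  have "t > 0" using b d e by (simp add: t_def)
  have t2: "t\<^sup>2 * (b\<^sup>2 * (b\<^sup>2 - r\<^sup>2)) = r\<^sup>2 * a\<^sup>2 - b ^ 4"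
    using b d e by (simp add: t_def power_divide power_mult_distrib)
  have \<alpha>: "alpha r a b = arctan t" "0 < arctan t" "arctan t < pi / 2"
    using \<open>t > 0\<close> arctan_ubound[of t] by (simp_all add: alpha_def t_def)
  have "(r * h (arctan t))\<^sup>2 * (1 + t\<^sup>2) = (b\<^sup>2)\<^sup>2 * (1 + t\<^sup>2)"
  proof -
    have "(r * h (arctan t))\<^sup>2 * (1 + t\<^sup>2) = r\<^sup>2 * (a\<^sup>2 + b\<^sup>2 * t\<^sup>2)"
      unfolding h_arctan[symmetric] by (simp add: power_mult_distrib)
    also have "\<dots> = (b\<^sup>2)\<^sup>2 * (1 + t\<^sup>2)" using t2 by algebra
    finally show ?thesis .
  qed
  moreover have "1 + t\<^sup>2 \<noteq> 0" using zero_le_power2[of t] by linarith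
  ultimately have "(r * h (arctan t))\<^sup>2 = (b\<^sup>2)\<^sup>2" by simp
  then have h: "r * h (arctan t) = b\<^sup>2"
    by (rule power2_eq_imp_eq) (use r h_pos[of "arctan t"] in simp_all)
  have "measure lborel enclosed = (2 * (sweep (- r) (pi / 2) - sweep (- r) (arctan t)))"
  proof (rule enclosed_area_sweep)
    show "r * h \<phi> \<le> b\<^sup>2" if "\<phi> \<in> {arctan t..pi / 2}" for \<phi>
      unfolding h[symmetric] using h_antimono[of "arctan t" \<phi>] that \<alpha> r by simp
  qed (use \<alpha> h in auto)
  then show ?thesis
    using True \<alpha> F_eq_sweep[of "arctan t"] sweep_right_angle[of "- r"] by (simp add: F_tilde_def)
qed

end

section \<open>Transversal intersections of circle and ellipse\<close>

lemma inj_on_cis: "inj_on cis {0..<2 * pi}"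
proof (rule inj_onI)
  fix s t assume st: "s \<in> {0..<2 * pi}" "t \<in> {0..<2 * pi}" "cis s = cis t"
  then have "cos s = cos t" "sin s = sin t" by (simp_all add: complex_eq_iff)
  then obtain k :: int where k: "s = t + 2 * pi * of_int k" using sin_cos_eq_iff[of s t] by auto
  with st have "2 * pi * of_int k < 2 * pi * 1" "2 * pi * (- 1) < 2 * pi * of_int k"
    unfolding atLeastLessThan_iff by linarith+
  then have "of_int k < (1 :: real)" "(- 1 :: real) < of_int k"
    by (simp_all only: mult_less_cancel_left_pos pi_gt_zero mult_pos_pos zero_less_numeral)
  then have "k = 0" by linarith
  with k show "s = t" by simp
qed

lemma shift_into_period:
  obtains s where "s \<in> {0..<2 * pi}" "cos s = cos t" "sin s = sin t"
  using sincos_total_2pi[of "cos t" "sin t"] by (metis atLeastLessThan_iff sin_cos_squared_add2 add.commute)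

context circle_and_ellipse
begin

definition E :: "real \<Rightarrow> real \<times> real" where
  "E t = (a * cos t, b * sin t)"

text \<open>The power of the point with parameter \<open>t\<close> with respect to the circle of radius \<open>r\<close> about \<open>v\<close>. It is
negative inside the disk, so upward zeros are the parameters at which the ellipse leaves the disk.\<close>

definition gap :: "real \<times> real \<Rightarrow> real \<Rightarrow> real" where
  "gap v t = (a * cos t - fst v)\<^sup>2 + (b * sin t - snd v)\<^sup>2 - r\<^sup>2"

definition gap' :: "real \<times> real \<Rightarrow> real \<Rightarrow> real" where
  "gap' v t = 2 * (b * cos t * (b * sin t - snd v) - a * sin t * (a * cos t - fst v))"

lemma gap_deriv: "(gap v has_real_derivative gap' v t) (at t)"
proof -
  have "((\<lambda>t. (a * cos t - fst v) * (a * cos t - fst v) + (b * sin t - snd v) * (b * sin t - snd v) - r\<^sup>2)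
      has_real_derivative
      ((a * - sin t - 0) * (a * cos t - fst v) + (a * - sin t - 0) * (a * cos t - fst v))
      + ((b * cos t - 0) * (b * sin t - snd v) + (b * cos t - 0) * (b * sin t - snd v)) - 0) (at t)"
    by (intro DERIV_diff DERIV_add DERIV_mult DERIV_cmult DERIV_sin DERIV_cos DERIV_const)
  moreover have "gap v = (\<lambda>t. (a * cos t - fst v) * (a * cos t - fst v) + (b * sin t - snd v) * (b * sin t - snd v) - r\<^sup>2)"
    by (rule ext) (simp only: gap_def power2_eq_square)
  moreover have "((a * - sin t - 0) * (a * cos t - fst v) + (a * - sin t - 0) * (a * cos t - fst v))
      + ((b * cos t - 0) * (b * sin t - snd v) + (b * cos t - 0) * (b * sin t - snd v)) - 0 = gap' v t"
    unfolding gap'_def by algebra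
  ultimately show ?thesis by (simp only:)
qed

lemma gap_cong: "cos s = cos t \<Longrightarrow> sin s = sin t \<Longrightarrow> gap v s = gap v t"
  "cos s = cos t \<Longrightarrow> sin s = sin t \<Longrightarrow> gap' v s = gap' v t"
  by (simp_all add: gap_def gap'_def)

lemma gap_periodic: "gap v (t + 2 * pi) = gap v t" "gap' v (t + 2 * pi) = gap' v t"
  by (rule gap_cong; simp)+

lemma gap_dist: "gap v t = (dist (E t) v)\<^sup>2 - r\<^sup>2"
  by (cases v) (simp add: gap_def E_def dist_prod_def dist_real_def)

lemma gap_le_0_iff: "gap v t \<le> 0 \<longleftrightarrow> v \<in> cball (E t) r"
proof -
  have "gap v t \<le> 0 \<longleftrightarrow> (dist (E t) v)\<^sup>2 \<le> r\<^sup>2" by (simp add: gap_dist)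
  also have "\<dots> \<longleftrightarrow> dist (E t) v \<le> r" using r by (simp add: abs_le_square_iff[symmetric])
  finally show ?thesis by simp
qed

lemma gap_eq_0_iff: "gap v t = 0 \<longleftrightarrow> dist (E t) v = r"
proof -
  have "gap v t = 0 \<longleftrightarrow> (dist (E t) v)\<^sup>2 = r\<^sup>2" by (simp add: gap_dist)
  also have "\<dots> \<longleftrightarrow> dist (E t) v = r" using r by (simp add: power2_eq_iff_nonneg)
  finally show ?thesis .
qed

lemma C_eq_range_E: "C = range E" and C_eq_image_E: "C = E ` {0..<2 * pi}"
proof -
  have "E t \<in> C" for t
    using a b by (simp add: E_def C_def power_mult_distrib)
  then have "range E \<subseteq> C" by blast
  moreover have "C \<subseteq> E ` {0..<2 * pi}"
  proof
    fix v assume "v \<in> C"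
    then obtain x y where v: "v = (x, y)" "(x / a)\<^sup>2 + (y / b)\<^sup>2 = 1" by (auto simp: C_def power_divide)
    from sincos_total_2pi[OF v(2)] obtain t where "0 \<le> t" "t < 2 * pi" "x / a = cos t" "y / b = sin t" .
    moreover from this have "v = E t" using a b v(1) by (simp add: E_def nonzero_divide_eq_eq mult.commute)
    ultimately show "v \<in> E ` {0..<2 * pi}" by auto
  qed
  ultimately show "C = range E" "C = E ` {0..<2 * pi}" by blast+
qed

text \<open>The speed of the standard parametrization is the support function in a direction turned by a right angle.\<close>

definition speed :: "real \<Rightarrow> real" where
  "speed t = h (t + pi / 2)"

lemma speed_sq: "(speed t)\<^sup>2 = a\<^sup>2 * (sin t)\<^sup>2 + b\<^sup>2 * (cos t)\<^sup>2"
  by (simp add: speed_def h_sq cos_add sin_add)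

lemma speed_pos: "speed t > 0" by (simp add: speed_def h_pos)

text \<open>The curve at signed distance \<open>s\<close> from the ellipse; \<open>offset\<close> is the same curve with the normal direction as its
parameter.\<close>

definition parallel_curve :: "real \<Rightarrow> real \<Rightarrow> real \<times> real" where
  "parallel_curve s t = (a * cos t + s * (b * cos t / speed t), b * sin t + s * (a * sin t / speed t))"

definition tangency_set :: "(real \<times> real) set" where
  "tangency_set = parallel_curve r ` {0..2 * pi} \<union> parallel_curve (- r) ` {0..2 * pi}"

lemma speed_deriv: "(speed has_real_derivative h' (t + pi / 2)) (at t)"
  unfolding speed_def[abs_def]
  using DERIV_chain2[where f = h and g = "\<lambda>t. t + pi / 2", OF h_deriv DERIV_add[OF DERIV_ident DERIV_const]]
  by simp

lemma parallel_curve_differentiable: "parallel_curve s differentiable (at t)"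
proof -
  have 1: "speed differentiable (at t)" using speed_deriv real_differentiable_def by blast
  have 2: "cos differentiable (at t)" "sin differentiable (at t)"
    using DERIV_cos DERIV_sin real_differentiable_def by blast+
  show ?thesis unfolding parallel_curve_def[abs_def]
    using speed_pos[of t]
    by (intro differentiable_Pair differentiable_add differentiable_mult differentiable_divide
        differentiable_const 1 2) simp_all
qed

lemma tangency_set_compact: "compact tangency_set"
  unfolding tangency_set_def
  by (intro compact_Un compact_continuous_image compact_Icc continuous_at_imp_continuous_on ballI
      differentiable_imp_continuous_within parallel_curve_differentiable)

text \<open>The set is the smooth image of an interval.\<close>

lemma tangency_set_null: "tangency_set \<in> null_sets lborel"
proof -
  have "negligible (parallel_curve s ` {0..2 * pi})" for s
    by (rule negligible_differentiable_image_lowdim)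
       (auto intro!: differentiable_at_imp_differentiable_on parallel_curve_differentiable)
  then have "negligible tangency_set"
    unfolding tangency_set_def by (intro negligible_Un)
  then have "tangency_set \<in> null_sets lebesgue" by (simp add: negligible_iff_null_sets)
  moreover have "tangency_set \<in> sets borel"
    using tangency_set_compact by (simp add: borel_compact)
  ultimately show ?thesis by (simp add: null_sets_def)
qed

text \<open>If the derivative vanishes as well, then the vector from the point of the ellipse to \<open>v\<close> is normal to the
ellipse and has length \<open>r\<close>.\<close>

lemma simple_zeros:
  assumes v: "v \<notin> tangency_set" and z: "gap v t = 0"
  shows "gap' v t \<noteq> 0"
proof
  assume z': "gap' v t = 0"
  obtain s where s: "s \<in> {0..<2 * pi}" "cos s = cos t" "sin s = sin t" by (rule shift_into_period)
  define w where "w = speed s"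
  define x y where "x = fst v - a * cos s" and "y = snd v - b * sin s"
  have w: "w > 0" "w\<^sup>2 = a\<^sup>2 * (sin s)\<^sup>2 + b\<^sup>2 * (cos s)\<^sup>2" by (simp_all add: w_def speed_pos speed_sq)
  have xy: "x\<^sup>2 + y\<^sup>2 = r\<^sup>2" using z s by (simp add: gap_def x_def y_def power2_commute)
  have orth: "x * (a * sin s) = y * (b * cos s)"
    using z' s by (simp add: gap'_def x_def y_def algebra_simps)
  define k where "k = (x * (b * cos s) + y * (a * sin s)) / w"
  have kw: "k * w = x * (b * cos s) + y * (a * sin s)" using w by (simp add: k_def)
  have "(k * w)\<^sup>2 = r\<^sup>2 * w\<^sup>2"
    unfolding kw w(2) using xy orth by algebra
  then have "k\<^sup>2 = r\<^sup>2" using w(1) by (simp add: power_mult_distrib)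
  then have k: "k = r \<or> k = - r" by (simp add: power2_eq_iff)
  have "x * w\<^sup>2 = (k * w) * (b * cos s)" "y * w\<^sup>2 = (k * w) * (a * sin s)"
    unfolding kw w(2) using orth by algebra+
  then have "x * w = k * (b * cos s)" "y * w = k * (a * sin s)"
    using w(1) by (simp_all add: power2_eq_square)
  then have "x = k * (b * cos s / w)" "y = k * (a * sin s / w)"
    using w(1) by (simp_all add: nonzero_eq_divide_eq)
  then have "v = parallel_curve k s"
    by (simp add: parallel_curve_def w_def x_def y_def prod_eq_iff algebra_simps)
  with k s(1) v show False by (auto simp: tangency_set_def)
qed

text \<open>On the unit circle \<open>z = exp (\<i> t)\<close> the trigonometric polynomial \<open>gap v\<close> is this polynomial divided by
\<open>z\<^sup>2\<close>; this bounds the number of its zeros by four.\<close>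

definition gap_poly :: "real \<times> real \<Rightarrow> complex poly" where
  "gap_poly v = [: complex_of_real ((a\<^sup>2 - b\<^sup>2) / 4), Complex (- a * fst v) (- b * snd v),
     complex_of_real ((a\<^sup>2 + b\<^sup>2) / 2 + (fst v)\<^sup>2 + (snd v)\<^sup>2 - r\<^sup>2),
     Complex (- a * fst v) (b * snd v), complex_of_real ((a\<^sup>2 - b\<^sup>2) / 4) :]"

lemma gap_poly_cis: "poly (gap_poly v) (cis t) = (cis t)\<^sup>2 * complex_of_real (gap v t)"
proof -
  define x y where "x = complex_of_real (fst v)" and "y = complex_of_real (snd v)"
  define A B R where "A = complex_of_real a" and "B = complex_of_real b" and "R = complex_of_real r"
  define c s where "c = complex_of_real (cos t)" and "s = complex_of_real (sin t)"
  have cs: "c\<^sup>2 + s\<^sup>2 = 1"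
    unfolding c_def s_def using sin_cos_squared_add[of t]
    by (metis add.commute of_real_1 of_real_add of_real_power)
  have z: "cis t = c + \<i> * s" by (simp add: c_def s_def complex_eq_iff)
  have i: "\<i>\<^sup>2 = - 1" by simp
  have c1: "Complex (- a * fst v) (- b * snd v) = - A * x - \<i> * (B * y)"
    "Complex (- a * fst v) (b * snd v) = - A * x + \<i> * (B * y)"
    by (simp_all add: A_def B_def x_def y_def complex_eq_iff)
  have g: "complex_of_real (gap v t) = (A * c - x)\<^sup>2 + (B * s - y)\<^sup>2 - R\<^sup>2"
    by (simp add: gap_def A_def B_def R_def x_def y_def c_def s_def)
  have p: "complex_of_real ((a\<^sup>2 - b\<^sup>2) / 4) = (A\<^sup>2 - B\<^sup>2) / 4"
    "complex_of_real ((a\<^sup>2 + b\<^sup>2) / 2 + (fst v)\<^sup>2 + (snd v)\<^sup>2 - r\<^sup>2) = (A\<^sup>2 + B\<^sup>2) / 2 + x\<^sup>2 + y\<^sup>2 - R\<^sup>2"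
    by (simp_all add: A_def B_def R_def x_def y_def)
  \<comment> \<open>In these variables the polynomial identity is free of fractions.\<close>
  define D S where "D = (A\<^sup>2 - B\<^sup>2) / 4" and "S = (A\<^sup>2 + B\<^sup>2) / 2"
  have DS: "A\<^sup>2 = S + 2 * D" "B\<^sup>2 = S - 2 * D" by (simp_all add: D_def S_def field_simps)
  have *: "D + (c + \<i> * s) * ((- A * x - \<i> * (B * y)) + (c + \<i> * s) * ((S + x\<^sup>2 + y\<^sup>2 - R\<^sup>2)
      + (c + \<i> * s) * ((- A * x + \<i> * (B * y)) + (c + \<i> * s) * D)))
    = (c + \<i> * s)\<^sup>2 * ((A * c - x)\<^sup>2 + (B * s - y)\<^sup>2 - R\<^sup>2)"
    using DS cs i by algebra
  show ?thesis
    unfolding g z gap_poly_def c1 p D_def[symmetric] S_def[symmetric] using * by simp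
qed

lemma
  assumes v: "v \<notin> tangency_set"
  shows finite_zeros: "finite {t \<in> {0..2 * pi}. gap v t = 0}"
    and card_zeros_le_4: "card {t \<in> {0..<2 * pi}. gap v t = 0} \<le> 4"
proof -
  define Z where "Z = {t \<in> {0..<2 * pi}. gap v t = 0}"
  have nz: "gap_poly v \<noteq> 0"
  proof
    assume "gap_poly v = 0"
    then have "gap v t = 0" for t using gap_poly_cis[of v t] by simp
    then have "gap v = (\<lambda>t. 0)" by auto
    with gap_deriv[of v 0] have "((\<lambda>t. 0) has_real_derivative gap' v 0) (at 0)" by simp
    then have "gap' v 0 = 0" using DERIV_const DERIV_unique by blast
    with simple_zeros[OF v, of 0] \<open>gap v = (\<lambda>t. 0)\<close> show False by simp
  qed
  have sub: "cis ` Z \<subseteq> {z. poly (gap_poly v) z = 0}"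
    using gap_poly_cis[of v] by (auto simp: Z_def)
  have inj: "inj_on cis Z" by (rule inj_on_subset[OF inj_on_cis]) (auto simp: Z_def)
  have fin: "finite {z. poly (gap_poly v) z = 0}" using nz by (rule poly_roots_finite)
  then have "finite Z" using sub inj by (meson finite_imageD finite_subset)
  have "{t \<in> {0..2 * pi}. gap v t = 0} \<subseteq> insert (2 * pi) Z" by (auto simp: Z_def)
  with \<open>finite Z\<close> show "finite {t \<in> {0..2 * pi}. gap v t = 0}" by (meson finite_insert finite_subset)
  have "card Z = card (cis ` Z)" using inj by (simp add: card_image)
  also have "\<dots> \<le> card {z. poly (gap_poly v) z = 0}" by (rule card_mono[OF fin sub])
  also have "\<dots> \<le> degree (gap_poly v)" by (rule card_poly_roots_bound[OF nz])
  also have "\<dots> \<le> 4"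
    unfolding gap_poly_def
    by (intro order.trans[OF degree_pCons_le] ; simp)+
  finally show "card {t \<in> {0..<2 * pi}. gap v t = 0} \<le> 4" by (simp add: Z_def)
qed

definition up_count :: "real \<times> real \<Rightarrow> nat" where
  "up_count v = card (up_zeros (gap v) (gap' v))"

lemma card_zeros: "v \<notin> tangency_set \<Longrightarrow> card {t \<in> {0..<2 * pi}. gap v t = 0} = 2 * up_count v"
  unfolding up_count_def
  by (rule card_zeros_eq_twice_up_zeros[OF gap_deriv gap_periodic simple_zeros finite_zeros])

lemma up_count_le_2: "v \<notin> tangency_set \<Longrightarrow> up_count v \<le> 2"
  using card_zeros card_zeros_le_4 by fastforce

lemma finite_up_zeros: "v \<notin> tangency_set \<Longrightarrow> finite (up_zeros (gap v) (gap' v))"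
  by (rule finite_subset[OF _ finite_zeros]) (auto simp: up_zeros_def)

lemma card_up_steps_le: "v \<notin> tangency_set \<Longrightarrow> card (up_steps (gap v) n) \<le> up_count v"
  unfolding up_count_def by (rule up_steps_le[OF gap_deriv simple_zeros finite_up_zeros])

lemma card_up_steps_tendsto:
  assumes "v \<notin> tangency_set"
  shows "(\<lambda>n. real (card (up_steps (gap v) n))) \<longlonglongrightarrow> real (up_count v)"
proof (rule tendsto_eventually)
  have "eventually (\<lambda>n. up_count v \<le> card (up_steps (gap v) n)) sequentially"
    unfolding up_count_def by (rule up_steps_ge[OF gap_deriv finite_zeros[OF assms]])
  then show "eventually (\<lambda>n. real (card (up_steps (gap v) n)) = real (up_count v)) sequentially"
    using card_up_steps_le[OF assms] by (auto elim!: eventually_mono intro: le_antisym)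
qed

text \<open>The centres for which the \<open>k\<close>-th step of the inscribed polygon leaves the disk.\<close>

definition lune :: "nat \<Rightarrow> nat \<Rightarrow> (real \<times> real) set" where
  "lune n k = cball (E (grid n k)) r - cball (E (grid n (Suc k))) r"

lemma card_up_steps_eq_sum: "real (card (up_steps (gap v) n)) = (\<Sum>k<n. indicator (lune n k) v)"
proof -
  have "up_steps (gap v) n = {k \<in> {..<n}. v \<in> lune n k}"
    using gap_le_0_iff by (auto simp: up_steps_def lune_def not_le[symmetric])
  then show ?thesis
    by (simp add: indicator_def sum.If_cases Int_def)
qed

text \<open>The sum-to-product formulas make the length of a chord exact; this reduces the length of the inscribed polygons
to Riemann sums of the speed.\<close>

lemma dist_E: "dist (E s) (E t) = 2 * \<bar>sin ((t - s) / 2)\<bar> * speed ((s + t) / 2)"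
proof -
  define d m where "d = (t - s) / 2" and "m = (s + t) / 2"
  have st: "s = m - d" "t = m + d" by (simp_all add: d_def m_def field_simps)
  have "(a * cos s - a * cos t)\<^sup>2 + (b * sin s - b * sin t)\<^sup>2 = (2 * sin d * speed m)\<^sup>2"
    unfolding power_mult_distrib speed_sq st cos_add cos_diff sin_add sin_diff by algebra
  then have "dist (E s) (E t) = \<bar>2 * sin d * speed m\<bar>"
    by (simp add: E_def dist_prod_def dist_real_def)
  then show ?thesis using speed_pos[of m] by (simp add: abs_mult d_def m_def)
qed

definition arc_length :: "real \<Rightarrow> real" where
  "arc_length t = a * ellint_E (t + pi / 2) (eccentricity a b)"

lemma arc_length_deriv: "(arc_length has_real_derivative speed t) (at t)"
proof -
  have "((\<lambda>t. ellint_E (t + pi / 2) (eccentricity a b)) has_real_derivative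
      sqrt (1 - (eccentricity a b)\<^sup>2 * (sin (t + pi / 2))\<^sup>2) * (1 + 0)) (at t)"
    by (rule DERIV_chain2[OF ellint_E_deriv DERIV_add[OF DERIV_ident DERIV_const]])
  from DERIV_cmult[OF this, of a] show ?thesis
    unfolding arc_length_def[abs_def] speed_def h_eq_elliptic_integrand by simp
qed

text \<open>The integrand of the elliptic integral has period \<open>\<pi>\<close> and is symmetric about \<open>\<pi> / 2\<close>.\<close>

lemma perimeter: "arc_length (2 * pi) - arc_length 0 = 4 * a * complete_ellint_E (eccentricity a b)"
proof -
  let ?e = "eccentricity a b"
  let ?J = "\<lambda>\<phi>. ellint_E \<phi> ?e"
  have J0: "?J 0 = 0" by (simp add: ellint_E_def zero_ereal_def[symmetric])
  have "((\<lambda>\<phi>. ?J (\<phi> + pi) - ?J \<phi>) has_real_derivative 0) (at x)" for x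
  proof -
    have "((\<lambda>\<phi>. ?J (\<phi> + pi) - ?J \<phi>) has_real_derivative
      sqrt (1 - ?e\<^sup>2 * (sin (x + pi))\<^sup>2) * (1 + 0) - sqrt (1 - ?e\<^sup>2 * (sin x)\<^sup>2)) (at x)"
      by (intro DERIV_diff ellint_E_deriv DERIV_chain2[OF ellint_E_deriv DERIV_add[OF DERIV_ident DERIV_const]])
    then show ?thesis by simp
  qed
  then have "?J (x + pi) - ?J x = ?J (0 + pi) - ?J 0" for x
    using DERIV_isconst_all[of "\<lambda>\<phi>. ?J (\<phi> + pi) - ?J \<phi>" x 0] by blast
  then have shift: "?J (x + pi) = ?J x + ?J pi" for x
    unfolding J0 add_0_left diff_0_right by (metis diff_add_cancel add.commute)
  have "((\<lambda>\<phi>. ?J (pi - \<phi>) + ?J \<phi>) has_real_derivative 0) (at x)" for x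
  proof -
    have "((\<lambda>\<phi>. ?J (pi - \<phi>) + ?J \<phi>) has_real_derivative
      sqrt (1 - ?e\<^sup>2 * (sin (pi - x))\<^sup>2) * (0 - 1) + sqrt (1 - ?e\<^sup>2 * (sin x)\<^sup>2)) (at x)"
      by (intro DERIV_add ellint_E_deriv DERIV_chain2[OF ellint_E_deriv DERIV_diff[OF DERIV_const DERIV_ident]])
    then show ?thesis by simp
  qed
  then have "?J (pi - pi / 2) + ?J (pi / 2) = ?J (pi - 0) + ?J 0"
    using DERIV_isconst_all[of "\<lambda>\<phi>. ?J (pi - \<phi>) + ?J \<phi>" "pi / 2" 0] by blast
  then have half: "?J pi = 2 * ?J (pi / 2)" by (simp add: J0)
  have "2 * pi + pi / 2 = (pi / 2 + pi) + pi" by simp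
  then have "?J (2 * pi + pi / 2) = ?J (pi / 2) + 4 * ?J (pi / 2)"
    by (simp only: shift half)
  then show ?thesis by (simp add: arc_length_def complete_ellint_E_def algebra_simps)
qed

end

section \<open>The areas of the regions with two and four intersections\<close>

context circle_and_ellipse
begin

lemma norm_E: "dist 0 (E t) = h t"
  by (simp add: E_def h_def dist_prod_def dist_real_def zero_prod_def power_mult_distrib)

lemma speed_le: "speed t \<le> a"
  by (simp add: speed_def h_le)

lemma speed_Lipschitz: "\<bar>speed s - speed t\<bar> \<le> (a\<^sup>2 - b\<^sup>2) / b * \<bar>s - t\<bar>"
proof -
  have *: "\<bar>speed s - speed t\<bar> \<le> (a\<^sup>2 - b\<^sup>2) / b * \<bar>s - t\<bar>" if lt: "t < s" for s t
  proof -
    obtain z where z: "speed s - speed t = (s - t) * h' (z + pi / 2)"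
      using MVT2[where f = speed and f' = "\<lambda>t. h' (t + pi / 2)", OF lt speed_deriv] by blast
    have "\<bar>h' \<phi>\<bar> \<le> (a\<^sup>2 - b\<^sup>2) / b" for \<phi>
    proof -
      have "\<bar>sin \<phi> * cos \<phi>\<bar> \<le> 1"
        unfolding abs_mult by (intro mult_le_one) auto
      then have "(a\<^sup>2 - b\<^sup>2) * \<bar>sin \<phi> * cos \<phi>\<bar> \<le> a\<^sup>2 - b\<^sup>2"
        using ab2 by (intro mult_left_le) auto
      moreover have "\<bar>h' \<phi>\<bar> = (a\<^sup>2 - b\<^sup>2) * \<bar>sin \<phi> * cos \<phi>\<bar> / h \<phi>"
        using h_pos[of \<phi>] ab2 by (simp add: h'_def abs_mult)
      ultimately show ?thesis
        using h_ge[of \<phi>] b ab2 by (auto intro!: frac_le)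
    qed
    then show ?thesis
      unfolding z abs_mult mult.commute[of "\<bar>s - t\<bar>"] by (intro mult_right_mono) simp_all
  qed
  show ?thesis
  proof (cases s t rule: linorder_cases)
    case less
    then show ?thesis using *[OF less] by (simp add: abs_minus_commute)
  next
    case greater
    then show ?thesis using * by simp
  qed simp
qed

text \<open>With the exact length of the chords, the perimeter of the inscribed polygon is a midpoint sum for the integral
of the speed, times a factor \<open>sin x / x\<close> that tends to one. The Lipschitz bound controls the midpoint sums.\<close>

lemma chord_sum_tendsto:
  "(\<lambda>n. \<Sum>k<n. dist (E (grid n k)) (E (grid n (Suc k)))) \<longlonglongrightarrow> arc_length (2 * pi) - arc_length 0"
proof -
  define M where "M = (a\<^sup>2 - b\<^sup>2) / b"
  have M: "M \<ge> 0" using ab2 b by (simp add: M_def)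
  define m where "m n k = (grid n k + grid n (Suc k)) / 2" for n k
  define S where "S n = (\<Sum>k<n. 2 * pi / n * speed (m n k))" for n
  have close: "\<bar>S n - (arc_length (2 * pi) - arc_length 0)\<bar> \<le> 4 * pi\<^sup>2 * M / n" if "n > 0" for n
  proof -
    have cell: "\<bar>2 * pi / n * speed (m n k) - (arc_length (grid n (Suc k)) - arc_length (grid n k))\<bar> \<le> (2 * pi / n)\<^sup>2 * M"
      if "k < n" for k
    proof -
      have lt: "grid n k < grid n (Suc k)" using that by (rule grid_bounds(2))
      obtain z where z: "grid n k < z" "z < grid n (Suc k)"
        "arc_length (grid n (Suc k)) - arc_length (grid n k) = (grid n (Suc k) - grid n k) * speed z"
        using MVT2[OF lt arc_length_deriv] by blast
      have w: "grid n (Suc k) - grid n k = 2 * pi / n" by (simp add: grid_mesh)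
      have "\<bar>m n k - z\<bar> \<le> 2 * pi / n"
      proof -
        have "\<bar>(x + y) / 2 - u\<bar> \<le> y - x" if "x < u" "u < y" for x y u :: real
          using that unfolding abs_le_iff by (intro conjI) (simp_all add: field_simps)
        from this[OF z(1,2)] show ?thesis unfolding m_def w .
      qed
      have "2 * pi / n * speed (m n k) - (arc_length (grid n (Suc k)) - arc_length (grid n k))
          = 2 * pi / n * (speed (m n k) - speed z)"
        unfolding z(3) w by (simp add: right_diff_distrib)
      also have "\<bar>\<dots>\<bar> = 2 * pi / n * \<bar>speed (m n k) - speed z\<bar>" by (simp add: abs_mult)
      also have "\<dots> \<le> 2 * pi / n * (M * (2 * pi / n))"
      proof (rule mult_left_mono)
        have "\<bar>speed (m n k) - speed z\<bar> \<le> M * \<bar>m n k - z\<bar>" unfolding M_def by (rule speed_Lipschitz)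
        also have "\<dots> \<le> M * (2 * pi / n)" using \<open>\<bar>m n k - z\<bar> \<le> 2 * pi / n\<close> M by (rule mult_left_mono)
        finally show "\<bar>speed (m n k) - speed z\<bar> \<le> M * (2 * pi / n)" .
      qed simp
      also have "\<dots> = (2 * pi / n)\<^sup>2 * M" by (simp only: power2_eq_square ac_simps)
      finally show ?thesis .
    qed
    have "(\<Sum>k<n. arc_length (grid n (Suc k)) - arc_length (grid n k)) = arc_length (2 * pi) - arc_length 0"
      using sum_lessThan_telescope[of "\<lambda>k. arc_length (grid n k)" n] grid_ends(1)[of n] grid_ends(2)[OF \<open>n > 0\<close>] by simp
    then have diff: "S n - (arc_length (2 * pi) - arc_length 0) = (\<Sum>k<n. 2 * pi / n * speed (m n k) - (arc_length (grid n (Suc k)) - arc_length (grid n k)))"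
      by (simp add: S_def sum_subtractf)
    have "\<bar>S n - (arc_length (2 * pi) - arc_length 0)\<bar> \<le> (\<Sum>k<n. \<bar>2 * pi / n * speed (m n k) - (arc_length (grid n (Suc k)) - arc_length (grid n k))\<bar>)"
      unfolding diff by (rule sum_abs)
    also have "\<dots> \<le> (\<Sum>k<n. (2 * pi / n)\<^sup>2 * M)" by (intro sum_mono cell) simp
    also have "\<dots> = real n * ((2 * pi / n)\<^sup>2 * M)" by (simp only: sum_constant card_lessThan)
    also have "\<dots> = 4 * pi\<^sup>2 * M / n"
    proof -
      have "x * ((2 * p / x)\<^sup>2 * M) = 4 * p\<^sup>2 * M / x" if "x \<noteq> 0" for x p :: real
        using that by (simp add: power2_eq_square)
      from this[of "real n" pi] \<open>n > 0\<close> show ?thesis by simp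
    qed
    finally show ?thesis .
  qed
  have "(\<lambda>n. S n - (arc_length (2 * pi) - arc_length 0)) \<longlonglongrightarrow> 0"
  proof (rule tendsto_rabs_zero_cancel, rule tendsto_sandwich[where f = "\<lambda>_. 0"
        and h = "\<lambda>n. 4 * pi\<^sup>2 * M / real n"])
    show "\<forall>\<^sub>F n in sequentially. \<bar>S n - (arc_length (2 * pi) - arc_length 0)\<bar> \<le> 4 * pi\<^sup>2 * M / n"
      using eventually_gt_at_top[of 0] by (rule eventually_mono) (rule close)
    show "(\<lambda>n. 4 * pi\<^sup>2 * M / real n) \<longlonglongrightarrow> 0" by (rule lim_const_over_n)
  qed auto
  then have S: "S \<longlonglongrightarrow> arc_length (2 * pi) - arc_length 0" by (simp add: LIM_zero_iff)
  have "(\<lambda>h. (sin (0 + h) - sin 0) / h) \<midarrow>0\<rightarrow> cos (0::real)"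
    using DERIV_sin[of "0 :: real"] unfolding DERIV_def .
  then have sinc: "((\<lambda>h. sin h / h) \<longlongrightarrow> 1) (at (0::real))" by simp
  have "filterlim (\<lambda>n. pi / real n) (at 0) sequentially"
    by (rule filterlim_atI[OF lim_const_over_n])
       (auto intro!: eventually_mono[OF eventually_gt_at_top[of 0]])
  from filterlim_compose[OF sinc this]
  \<comment> \<open>The quotient of chord and arc for the regular polygon.\<close>
  have c: "(\<lambda>n. sin (pi / n) / (pi / n)) \<longlonglongrightarrow> 1" .
  have "(\<Sum>k<n. dist (E (grid n k)) (E (grid n (Suc k)))) = sin (pi / n) / (pi / n) * S n" if "n > 0" for n
  proof -
    have "dist (E (grid n k)) (E (grid n (Suc k))) = sin (pi / n) / (pi / n) * (2 * pi / n * speed (m n k))" for k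
    proof -
      have "(grid n (Suc k) - grid n k) / 2 = pi / n" by (simp add: grid_mesh)
      moreover have "0 \<le> sin (pi / n)"
        using that by (intro sin_ge_zero) (simp_all add: pos_divide_le_eq)
      moreover have "sin (pi / n) / (pi / n) * (2 * pi / n * x) = 2 * sin (pi / n) * x" for x
        using that by simp
      ultimately show ?thesis unfolding dist_E m_def by (simp only: abs_of_nonneg)
    qed
    then show ?thesis by (simp only: S_def sum_distrib_left)
  qed
  then have "\<forall>\<^sub>F n in sequentially. sin (pi / n) / (pi / n) * S n = (\<Sum>k<n. dist (E (grid n k)) (E (grid n (Suc k))))"
    by (intro eventually_mono[OF eventually_gt_at_top[of 0]]) simp
  moreover have "(\<lambda>n. sin (pi / n) / (pi / n) * S n) \<longlonglongrightarrow> 1 * (arc_length (2 * pi) - arc_length 0)"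
    by (rule tendsto_mult[OF c S])
  ultimately show ?thesis using tendsto_cong by fastforce
qed

lemma chord_le: "n > 0 \<Longrightarrow> dist (E (grid n k)) (E (grid n (Suc k))) \<le> 2 * pi * a / n"
proof -
  assume n: "n > 0"
  have d: "(grid n (Suc k) - grid n k) / 2 = pi / n" by (simp add: grid_mesh)
  have "\<bar>sin (pi / n)\<bar> \<le> pi / n" using abs_sin_le_one abs_sin_x_le_abs_x[of "pi / n"] by simp
  then have "2 * \<bar>sin (pi / n)\<bar> * speed ((grid n k + grid n (Suc k)) / 2) \<le> 2 * (pi / n) * a"
    using speed_le speed_pos n by (intro mult_mono) (auto intro: less_imp_le)
  then show ?thesis unfolding dist_E d by (simp add: mult.commute mult.left_commute)
qed

lemma lune_sum_tendsto:
  "(\<lambda>n. \<Sum>k<n. measure lborel (lune n k)) \<longlonglongrightarrow> 2 * r * (arc_length (2 * pi) - arc_length 0)"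
proof (rule tendsto_sandwich)
  let ?d = "\<lambda>n k. dist (E (grid n k)) (E (grid n (Suc k)))"
  have "(\<lambda>n. 2 * pi * a / real n) \<longlonglongrightarrow> 0" by (rule lim_const_over_n)
  then have "\<forall>\<^sub>F n in sequentially. 2 * pi * a / real n < r" using r by (rule order_tendstoD(2))
  then have ev: "\<forall>\<^sub>F n in sequentially. n > 0 \<and> 2 * pi * a / real n < r"
    using eventually_gt_at_top[of 0] by (rule eventually_conj[rotated])
  show "\<forall>\<^sub>F n in sequentially. (\<Sum>k<n. measure lborel (lune n k)) \<le> 2 * r * (\<Sum>k<n. ?d n k)"
    using ev
  proof eventually_elim
    case (elim n)
    then have "?d n k \<le> r" for k using chord_le[of n k] by simp
    then show ?case unfolding sum_distrib_left lune_def using measure_lune(1)[OF r] by (intro sum_mono) auto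
  qed
  show "\<forall>\<^sub>F n in sequentially. 2 * r * (\<Sum>k<n. ?d n k) - 8 * pi\<^sup>2 * a\<^sup>2 / n \<le> (\<Sum>k<n. measure lborel (lune n k))"
    using ev
  proof eventually_elim
    case (elim n)
    have "2 * r * ?d n k - 2 * (2 * pi * a / n)\<^sup>2 \<le> measure lborel (lune n k)" for k
    proof -
      have "?d n k \<le> r" using chord_le[of n k] elim by simp
      then have "2 * r * ?d n k - 2 * (?d n k)\<^sup>2 \<le> measure lborel (lune n k)"
        unfolding lune_def by (rule measure_lune(2)[OF r])
      moreover have "(?d n k)\<^sup>2 \<le> (2 * pi * a / n)\<^sup>2"
        using chord_le[of n k] elim by (intro power_mono) auto
      ultimately show ?thesis by linarith
    qed
    then have "(\<Sum>k<n. 2 * r * ?d n k - 2 * (2 * pi * a / n)\<^sup>2) \<le> (\<Sum>k<n. measure lborel (lune n k))"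
      by (intro sum_mono)
    moreover have "(\<Sum>k<n. 2 * r * ?d n k - 2 * (2 * pi * a / n)\<^sup>2) = 2 * r * (\<Sum>k<n. ?d n k) - 8 * pi\<^sup>2 * a\<^sup>2 / n"
      using elim by (simp add: sum_subtractf sum_distrib_left power_divide power_mult_distrib power2_eq_square)
    ultimately show ?case by simp
  qed
  show "(\<lambda>n. 2 * r * (\<Sum>k<n. ?d n k)) \<longlonglongrightarrow> 2 * r * (arc_length (2 * pi) - arc_length 0)"
    by (intro tendsto_intros chord_sum_tendsto)
  have "(\<lambda>n. 2 * r * (\<Sum>k<n. ?d n k) - 8 * pi\<^sup>2 * a\<^sup>2 / n) \<longlonglongrightarrow> 2 * r * (arc_length (2 * pi) - arc_length 0) - 0"
    by (intro tendsto_diff tendsto_intros chord_sum_tendsto lim_const_over_n)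
  then show "(\<lambda>n. 2 * r * (\<Sum>k<n. ?d n k) - 8 * pi\<^sup>2 * a\<^sup>2 / n) \<longlonglongrightarrow> 2 * r * (arc_length (2 * pi) - arc_length 0)"
    by simp
qed

text \<open>The value zero on the tangency set makes this function measurable; the count itself is not controlled there.\<close>

definition generic_up_count :: "real \<times> real \<Rightarrow> real" where
  "generic_up_count v = (if v \<in> tangency_set then 0 else real (up_count v))"

lemma lune_borel: "lune n k \<in> sets lborel" by (simp add: lune_def)

lemma lune_finite: "emeasure lborel (lune n k) < \<infinity>"
  by (rule emeasure_bounded_finite) (auto simp: lune_def intro: bounded_subset[OF bounded_cball])

lemma tangency_set_borel: "tangency_set \<in> sets borel"
  using tangency_set_compact by (rule borel_compact)

lemma AE_generic: "AE v in lborel. v \<notin> tangency_set"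
  using tangency_set_null by (rule AE_not_in)

lemma generic_up_count_measurable: "generic_up_count \<in> borel_measurable borel"
proof (rule borel_measurable_LIMSEQ_real)
  show "(\<lambda>v. indicator (- tangency_set) v * (\<Sum>k<n. indicator (lune n k) v) :: real) \<in> borel_measurable borel" for n
    using tangency_set_borel lune_borel by (intro borel_measurable_times borel_measurable_sum borel_measurable_indicator) auto
  show "(\<lambda>n. indicator (- tangency_set) v * (\<Sum>k<n. indicator (lune n k) v)) \<longlonglongrightarrow> generic_up_count v" for v
    using card_up_steps_tendsto[of v] by (cases "v \<in> tangency_set") (auto simp: generic_up_count_def card_up_steps_eq_sum)
qed

text \<open>Poincare's formula for the circle and the ellipse: the mean number of departures is determined by the two
perimeters.\<close>

lemma generic_up_count_integral:
  "integral\<^sup>L lborel generic_up_count = 8 * r * a * complete_ellint_E (eccentricity a b)"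
proof -
  let ?s = "\<lambda>n v. \<Sum>k<n. indicator (lune n k) v :: real"
  have int: "integral\<^sup>L lborel (?s n) = (\<Sum>k<n. measure lborel (lune n k))" for n
    using lune_borel lune_finite
    by (subst Bochner_Integration.integral_sum) (auto intro: integrable_real_indicator)
  have dom: "integrable lborel (\<lambda>v. 2 * indicator (cball 0 (a + r)) v :: real)"
    by (intro integrable_mult_right integrable_real_indicator emeasure_bounded_finite) auto
  have conv: "AE v in lborel. (\<lambda>n. ?s n v) \<longlonglongrightarrow> generic_up_count v"
    using AE_generic by eventually_elim
      (use card_up_steps_tendsto in \<open>auto simp: generic_up_count_def card_up_steps_eq_sum\<close>)
  have bound: "AE v in lborel. norm (?s n v) \<le> 2 * indicator (cball 0 (a + r)) v" for n
    using AE_generic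
  proof eventually_elim
    fix v assume v: "v \<notin> tangency_set"
    have "?s n v \<le> 2"
      using card_up_steps_le[OF v, of n] up_count_le_2[OF v] by (simp flip: card_up_steps_eq_sum)
    moreover have "?s n v = 0" if "v \<notin> cball 0 (a + r)"
    proof -
      have "v \<notin> lune n k" for k
      proof
        assume "v \<in> lune n k"
        then have "dist (E (grid n k)) v \<le> r" by (simp add: lune_def)
        then have "dist 0 v \<le> a + r"
          using dist_triangle[of 0 v "E (grid n k)"] norm_E[of "grid n k"] h_le[of "grid n k"] by linarith
        with that show False by simp
      qed
      then show ?thesis by simp
    qed
    moreover have "?s n v \<ge> 0" by (intro sum_nonneg) auto
    ultimately show "norm (?s n v) \<le> 2 * indicator (cball 0 (a + r)) v"
      by (auto split: split_indicator)
  qed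
  have "(\<lambda>n. integral\<^sup>L lborel (?s n)) \<longlonglongrightarrow> integral\<^sup>L lborel generic_up_count"
    by (rule integral_dominated_convergence[OF _ _ dom conv bound])
       (use generic_up_count_measurable lune_borel in \<open>auto intro!: borel_measurable_sum\<close>)
  moreover have "(\<lambda>n. integral\<^sup>L lborel (?s n)) \<longlonglongrightarrow> 2 * r * (arc_length (2 * pi) - arc_length 0)"
    unfolding int by (rule lune_sum_tendsto)
  ultimately have "integral\<^sup>L lborel generic_up_count = 2 * r * (arc_length (2 * pi) - arc_length 0)"
    by (rule LIMSEQ_unique)
  then show ?thesis by (simp add: perimeter)
qed

definition crossing :: "nat \<Rightarrow> (real \<times> real) set" where
  "crossing j = {v. v \<notin> tangency_set \<and> up_count v = j}"

lemma crossing_borel: "crossing j \<in> sets borel"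
proof -
  have "crossing j = - tangency_set \<inter> generic_up_count -` {real j}"
    by (auto simp: crossing_def generic_up_count_def)
  moreover have "generic_up_count -` {real j} \<in> sets borel"
    using measurable_sets[OF generic_up_count_measurable, of "{real j}"] by simp
  ultimately show ?thesis using tangency_set_borel by auto
qed

lemma enclosing_iff: "v \<in> enclosing \<longleftrightarrow> (\<forall>t. gap v t \<le> 0)"
  unfolding enclosing_def C_eq_range_E gap_le_0_iff by (simp add: image_subset_iff dist_commute)

text \<open>The supporting line of \<open>K\<close> at a point given by its parameter instead of its normal direction.\<close>

lemma normal_at_E:
  obtains \<phi> where "fst (E t) * cos \<phi> + snd (E t) * sin \<phi> = h \<phi>"
proof -
  define w where "w = speed t"
  have w: "w > 0" "w\<^sup>2 = a\<^sup>2 * (sin t)\<^sup>2 + b\<^sup>2 * (cos t)\<^sup>2" by (simp_all add: w_def speed_pos speed_sq)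
  have e: "(b * cos t)\<^sup>2 + (a * sin t)\<^sup>2 = w\<^sup>2" unfolding w(2) power_mult_distrib by simp
  have "(b * cos t / w)\<^sup>2 + (a * sin t / w)\<^sup>2 = 1"
    unfolding power_divide add_divide_distrib[symmetric] e using w(1) by simp
  from sincos_total_2pi[OF this] obtain \<phi> where \<phi>: "b * cos t / w = cos \<phi>" "a * sin t / w = sin \<phi>" by metis
  have c: "cos \<phi> * w = b * cos t" "sin \<phi> * w = a * sin t"
    using w(1) unfolding \<phi>[symmetric] by simp_all
  have "(h \<phi> * w)\<^sup>2 = a\<^sup>2 * (cos \<phi> * w)\<^sup>2 + b\<^sup>2 * (sin \<phi> * w)\<^sup>2"
    unfolding power_mult_distrib h_sq by (simp only: algebra_simps)
  also have "\<dots> = (a * b)\<^sup>2 * ((sin t)\<^sup>2 + (cos t)\<^sup>2)" unfolding c by algebra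
  finally have "(h \<phi> * w)\<^sup>2 = (a * b)\<^sup>2" by simp
  then have hw: "h \<phi> * w = a * b"
    using h_pos[of \<phi>] w a b by (simp add: power2_eq_iff_nonneg)
  have "(fst (E t) * cos \<phi> + snd (E t) * sin \<phi>) * w = fst (E t) * (cos \<phi> * w) + snd (E t) * (sin \<phi> * w)"
    by (simp only: algebra_simps)
  also have "\<dots> = a * b * ((sin t)\<^sup>2 + (cos t)\<^sup>2)" unfolding c E_def fst_conv snd_conv by algebra
  also have "\<dots> = h \<phi> * w" using hw by simp
  finally have "fst (E t) * cos \<phi> + snd (E t) * sin \<phi> = h \<phi>" using w(1) by simp
  then show ?thesis by (rule that)
qed

text \<open>A disk in \<open>K\<close> stays on the inner side of every supporting line, so its centre has distance at least \<open>r\<close> from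
every point of the ellipse.\<close>

lemma enclosed_gap: "v \<in> enclosed \<Longrightarrow> 0 \<le> gap v t"
proof -
  assume v: "v \<in> enclosed"
  obtain x y where xy: "v = (x, y)" by fastforce
  obtain X Y where XY: "E t = (X, Y)" by fastforce
  obtain \<phi> where \<phi>: "X * cos \<phi> + Y * sin \<phi> = h \<phi>" using normal_at_E[of t] by (auto simp: XY)
  have "x * cos \<phi> + y * sin \<phi> \<le> h \<phi> - r" using enclosed_support v xy by simp
  with \<phi> have "r \<le> (X - x) * cos \<phi> + (Y - y) * sin \<phi>" by (simp add: algebra_simps)
  also have "\<dots> \<le> dist (E t) v" unfolding xy XY by (rule normal_component_le_dist)
  finally have "r\<^sup>2 \<le> (dist (E t) v)\<^sup>2" using r by (intro power_mono) auto
  then show ?thesis by (simp add: gap_dist)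
qed

lemma frontier_K: "frontier K \<subseteq> C"
proof -
  have "open {v :: real \<times> real. (fst v)\<^sup>2 / a\<^sup>2 + (snd v)\<^sup>2 / b\<^sup>2 < 1}"
    by (intro open_Collect_less continuous_intros) (use a b in auto)
  then have "{v. (fst v)\<^sup>2 / a\<^sup>2 + (snd v)\<^sup>2 / b\<^sup>2 < 1} \<subseteq> interior K"
    by (intro interior_maximal) (auto simp: K_def)
  moreover have "frontier K = K - interior K"
    using compact_K by (simp add: frontier_def compact_imp_closed)
  ultimately show ?thesis by (force simp: K_def C_def)
qed

text \<open>The disk is connected, so it lies in \<open>K\<close> as soon as it meets \<open>K\<close> but not the frontier of \<open>K\<close>.\<close>

lemma disjoint_from_C_imp_enclosed:
  assumes "v \<in> parallel_body" and pos: "\<And>t. gap v t > 0"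
  shows "v \<in> enclosed"
proof -
  obtain e where "e \<in> K" "dist v e \<le> r" using assms(1) by (auto simp: parallel_body_def)
  then have "cball v r \<inter> K \<noteq> {}" by auto
  have "cball v r - K = {}"
  proof (rule ccontr)
    assume "cball v r - K \<noteq> {}"
    with connected_Int_frontier[of "cball v r" K] \<open>cball v r \<inter> K \<noteq> {}\<close>
    have "cball v r \<inter> frontier K \<noteq> {}" by (simp add: convex_connected)
    then obtain p where p: "p \<in> cball v r" "p \<in> frontier K" by blast
    with frontier_K obtain t where "p = E t" by (auto simp: C_eq_range_E)
    with p have "E t \<in> cball v r" by simp
    then have "gap v t \<le> 0" by (simp add: gap_le_0_iff dist_commute)
    with pos[of t] show False by simp
  qed
  then show ?thesis by (auto simp: enclosed_def)
qed

lemma E_in_K: "E t \<in> K" using C_subset_K C_eq_range_E by auto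

text \<open>A zero of \<open>gap v\<close> is transversal, hence there are points of the ellipse on both sides of the circle, and
neither curve can enclose the other. Without zeros, \<open>gap v\<close> has one sign: if it is negative, the ellipse lies in
the disk, and if it is positive, the disk lies in \<open>K\<close> as soon as it meets \<open>K\<close>.\<close>

lemma position_trichotomy:
  assumes v: "v \<notin> tangency_set"
  shows "(indicator parallel_body v :: real) = indicator (crossing 1) v + indicator (crossing 2) v
    + indicator enclosing v + indicator enclosed v"
proof (cases "up_count v = 0")
  case False
  then have "up_zeros (gap v) (gap' v) \<noteq> {}" by (auto simp: up_count_def)
  then obtain t where t: "gap v t = 0" "gap' v t > 0" by (auto simp: up_zeros_def)
  have "v \<in> parallel_body"
    using t(1) E_in_K[of t] unfolding gap_eq_0_iff parallel_body_def by (auto simp: dist_commute)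
  moreover have "v \<notin> enclosing"
  proof
    assume "v \<in> enclosing"
    from DERIV_pos_inc_right[OF gap_deriv t(2)] obtain d where
      d: "d > 0" "\<And>h. h > 0 \<Longrightarrow> h < d \<Longrightarrow> gap v t < gap v (t + h)" by blast
    then have "gap v (t + d / 2) > 0" using t(1) by (metis half_gt_zero field_sum_of_halves less_add_same_cancel1)
    with \<open>v \<in> enclosing\<close> show False by (simp add: enclosing_iff not_le[symmetric])
  qed
  moreover have "v \<notin> enclosed"
  proof
    assume "v \<in> enclosed"
    from DERIV_pos_inc_left[OF gap_deriv t(2)] obtain d where
      d: "d > 0" "\<And>h. h > 0 \<Longrightarrow> h < d \<Longrightarrow> gap v (t - h) < gap v t" by blast
    then have "gap v (t - d / 2) < 0" using t(1) by (metis half_gt_zero field_sum_of_halves less_add_same_cancel1)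
    with enclosed_gap[OF \<open>v \<in> enclosed\<close>, of "t - d / 2"] show False by simp
  qed
  moreover have "v \<in> crossing 1 \<longleftrightarrow> v \<notin> crossing 2" "v \<in> crossing 1 \<or> v \<in> crossing 2"
    using up_count_le_2[OF v] False v by (auto simp: crossing_def)
  ultimately show ?thesis by (auto simp: indicator_def)
next
  case True
  have "finite {t \<in> {0..<2 * pi}. gap v t = 0}"
    by (rule finite_subset[OF _ finite_zeros[OF v]]) auto
  with card_zeros[OF v] True have empty: "{t \<in> {0..<2 * pi}. gap v t = 0} = {}" by simp
  have nz: "gap v t \<noteq> 0" for t
  proof
    assume "gap v t = 0"
    obtain s where "s \<in> {0..<2 * pi}" "cos s = cos t" "sin s = sin t" by (rule shift_into_period)
    with \<open>gap v t = 0\<close> gap_cong(1)[of s t v] empty show False by auto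
  qed
  have cont: "continuous_on A (gap v)" for A
    by (rule DERIV_continuous_on[of _ _ "gap' v"]) (meson gap_deriv DERIV_subset subset_UNIV)
  have sign: "(\<forall>t. gap v t > 0) \<or> (\<forall>t. gap v t < 0)"
  proof (rule ccontr)
    assume "\<not> ?thesis"
    then obtain s t where st: "gap v s < 0" "gap v t > 0" using nz by (meson linorder_neqE_linordered_idom)
    have "connected (range (gap v))" by (intro connected_continuous_image cont connected_UNIV)
    from connectedD_interval[OF this, of "gap v s" "gap v t" 0] st have "0 \<in> range (gap v)" by auto
    with nz show False by force
  qed
  have not12: "v \<notin> crossing 1" "v \<notin> crossing 2" using True by (auto simp: crossing_def)
  from sign show ?thesis
  proof
    assume pos: "\<forall>t. gap v t > 0"
    then have "v \<notin> enclosing" by (auto simp: enclosing_iff not_le)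
    moreover have "v \<in> parallel_body \<longleftrightarrow> v \<in> enclosed"
    proof
      assume "v \<in> enclosed"
      moreover have "v + (r, 0) \<in> sphere v r" using r by (simp add: dist_norm norm_prod_def)
      ultimately have "v + (r, 0) \<in> K" by (auto simp: enclosed_def)
      moreover have "dist v (v + (r, 0)) \<le> r" using \<open>v + (r, 0) \<in> sphere v r\<close> by simp
      ultimately show "v \<in> parallel_body" unfolding parallel_body_def by blast
    qed (use pos disjoint_from_C_imp_enclosed in blast)
    ultimately show ?thesis using not12 by (simp add: indicator_def)
  next
    assume neg: "\<forall>t. gap v t < 0"
    then have "v \<in> enclosing" by (auto simp: enclosing_iff less_imp_le)
    moreover have "v \<in> parallel_body"
      using neg gap_le_0_iff[of v 0] E_in_K[of 0] by (force simp: parallel_body_def dist_commute less_imp_le)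
    moreover have "v \<notin> enclosed" using neg enclosed_gap[of v 0] by (auto simp: not_le[symmetric])
    ultimately show ?thesis using not12 by (simp add: indicator_def)
  qed
qed

lemma crossing_subset_parallel_body: "j > 0 \<Longrightarrow> crossing j \<subseteq> parallel_body"
proof
  fix v assume j: "j > 0" and v: "v \<in> crossing j"
  then have "up_zeros (gap v) (gap' v) \<noteq> {}" by (auto simp: crossing_def up_count_def)
  then obtain t where "gap v t = 0" by (auto simp: up_zeros_def)
  then show "v \<in> parallel_body" using E_in_K[of t] unfolding gap_eq_0_iff parallel_body_def by (auto simp: dist_commute)
qed

lemma crossing_finite: "j > 0 \<Longrightarrow> emeasure lborel (crossing j) < \<infinity>"
  by (rule emeasure_bounded_finite, rule bounded_subset[OF compact_imp_bounded[OF parallel_body_compact_convex(1)]])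
     (rule crossing_subset_parallel_body)

lemma compact_measure_facts: "compact S \<Longrightarrow> S \<in> sets lborel" "compact S \<Longrightarrow> emeasure lborel S < \<infinity>"
  for S :: "(real \<times> real) set"
  using borel_compact emeasure_bounded_finite[OF compact_imp_bounded] by auto

lemma indicator_integrable:
  "integrable lborel (indicator enclosing :: _ \<Rightarrow> real)" "integrable lborel (indicator enclosed :: _ \<Rightarrow> real)"
  "integrable lborel (indicator parallel_body :: _ \<Rightarrow> real)" "j > 0 \<Longrightarrow> integrable lborel (indicator (crossing j) :: _ \<Rightarrow> real)"
  using compact_measure_facts enclosing_compact_convex(1) enclosed_compact_convex(1) parallel_body_compact_convex(1)
    crossing_borel crossing_finite
  by (auto intro!: integrable_real_indicator)

lemma measure_parallel_body_split: "measure lborel parallel_body = measure lborel (crossing 1) + measure lborel (crossing 2)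
    + (measure lborel enclosing + measure lborel enclosed)"
proof -
  have "integral\<^sup>L lborel (indicator parallel_body :: _ \<Rightarrow> real) = integral\<^sup>L lborel (\<lambda>v. indicator (crossing 1) v
      + indicator (crossing 2) v + indicator enclosing v + indicator enclosed v)"
  proof (rule integral_cong_AE)
    show "AE v in lborel. indicator parallel_body v = (indicator (crossing 1) v
      + indicator (crossing 2) v + indicator enclosing v + indicator enclosed v :: real)"
      using AE_generic by eventually_elim (rule position_trichotomy)
  qed (use indicator_integrable in \<open>auto intro!: borel_measurable_add dest: borel_measurable_integrable\<close>)
  then show ?thesis using indicator_integrable by simp
qed

lemma up_count_integral_split: "integral\<^sup>L lborel generic_up_count = measure lborel (crossing 1) + 2 * measure lborel (crossing 2)"
proof -
  have "generic_up_count = (\<lambda>v. indicator (crossing 1) v + 2 * indicator (crossing 2) v)"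
  proof
    fix v
    show "generic_up_count v = indicator (crossing 1) v + 2 * indicator (crossing 2) v"
    proof (cases "v \<in> tangency_set")
      case False
      with up_count_le_2[OF False] have "up_count v = 0 \<or> up_count v = 1 \<or> up_count v = 2" by auto
      with False show ?thesis by (auto simp: generic_up_count_def crossing_def indicator_def)
    qed (simp add: generic_up_count_def crossing_def)
  qed
  then show ?thesis using indicator_integrable by simp
qed

text \<open>The solution of the two linear equations for the two areas, one from Poincare's formula and one from the
decomposition of the parallel body.\<close>

theorem crossing_measures:
  defines "A \<equiv> measure lborel enclosing + measure lborel enclosed"
  shows "measure lborel (crossing 1) = 2 * pi * r\<^sup>2 + 2 * pi * a * b - 2 * A"
    and "measure lborel (crossing 2) = 4 * r * a * complete_ellint_E (eccentricity a b) - pi * r\<^sup>2 - pi * a * b + A"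
  using measure_parallel_body_split up_count_integral_split generic_up_count_integral parallel_body_area
  unfolding A_def by simp_all

lemma enclosing_null: "a \<ge> r \<Longrightarrow> measure lborel enclosing = 0"
proof -
  assume ar: "a \<ge> r"
  have "enclosing \<subseteq> {(0, 0)}"
  proof clarify
    fix x y assume v: "(x, y) \<in> enclosing"
    have "x \<le> r - a" "- x \<le> r - a"
      using enclosing_support[OF v, of 0] enclosing_support[OF enclosing_reflect(1)[OF v], of 0] by (simp_all add: h_0)
    with ar have "x = 0" "a = r" by linarith+
    have "dist (x, y) (a, 0) \<le> r" using v vertex_in_C(1) by (auto simp: enclosing_def)
    then have "y = 0" using dist_le_iff[of x y a 0] \<open>x = 0\<close> \<open>a = r\<close> by simp
    with \<open>x = 0\<close> show "x = 0 \<and> y = 0" by simp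
  qed
  then have "emeasure lborel enclosing = 0"
    by (metis emeasure_lborel_countable countable_empty countable_insert countable_subset)
  then show ?thesis by (simp add: measure_def)
qed

lemma enclosed_null: "b \<le> r \<Longrightarrow> measure lborel enclosed = 0"
proof -
  assume br: "b \<le> r"
  have "enclosed \<subseteq> {(0, 0)}"
  proof clarify
    fix x y assume v: "(x, y) \<in> enclosed"
    have "y \<le> b - r" "- y \<le> b - r"
      using enclosed_support[OF v, of "pi / 2"] enclosed_support[OF enclosed_reflect(2)[OF v], of "pi / 2"]
      by (simp_all add: h_right_angle)
    with br have "y = 0" "b = r" by linarith+
    have "dist (x, y) (x, y + r) = r" using r by (simp add: dist_prod_def dist_real_def)
    then have "(x, y + r) \<in> K" using v by (auto simp: enclosed_def)
    then have "x\<^sup>2 / a\<^sup>2 + (y + r)\<^sup>2 / b\<^sup>2 \<le> 1" by (simp add: K_def)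
    then have "x\<^sup>2 / a\<^sup>2 \<le> 0" using \<open>y = 0\<close> \<open>b = r\<close> r by simp
    then have "x = 0" using a by (simp add: divide_le_0_iff)
    with \<open>y = 0\<close> show "x = 0 \<and> y = 0" by simp
  qed
  then have "emeasure lborel enclosed = 0"
    by (metis emeasure_lborel_countable countable_empty countable_insert countable_subset)
  then show ?thesis by (simp add: measure_def)
qed

end

section \<open>From relative centres to positions\<close>

text \<open>The point \<open>c\<close> in the coordinates of the moving frame.\<close>

definition rel_center :: "real \<times> real \<Rightarrow> real \<times> real \<times> real \<Rightarrow> real \<times> real" where
  "rel_center c = (\<lambda>(x, y, \<psi>). plane_rotation (cos \<psi>) (- sin \<psi>) (c - (x, y)))"

lemma continuous_rel_center: "continuous_on UNIV (rel_center c)"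
  unfolding rel_center_def plane_rotation_def case_prod_unfold
  by (intro continuous_intros)

lemma rel_center_slice: "rel_center c (x, y, \<psi>) = plane_rotation (cos \<psi>) (- sin \<psi>) c + plane_rotation (- cos \<psi>) (sin \<psi>) (x, y)"
  by (cases c) (simp add: rel_center_def plane_rotation_def algebra_simps)

lemma emeasure_rel_center_slice:
  assumes "B \<in> sets borel"
  shows "emeasure lborel {v. rel_center c (fst v, snd v, \<psi>) \<in> B} = emeasure lborel B"
proof -
  have "{v. rel_center c (fst v, snd v, \<psi>) \<in> B} =
    (\<lambda>v. plane_rotation (cos \<psi>) (- sin \<psi>) c + plane_rotation (- cos \<psi>) (sin \<psi>) v) -` B"
    by (auto simp: rel_center_slice)
  then show ?thesis using emeasure_rigid_motion[OF assms, of "- cos \<psi>" "sin \<psi>"] by simp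
qed

lemma emeasure_lborel_slices_angle:
  fixes S :: "(real \<times> real \<times> real) set"
  assumes S: "S \<in> sets borel"
  shows "emeasure lborel S = (\<integral>\<^sup>+ \<psi>. emeasure lborel {v. (fst v, snd v, \<psi>) \<in> S} \<partial>lborel)"
proof -
  have S2[measurable]: "S \<in> sets (borel \<Otimes>\<^sub>M (borel \<Otimes>\<^sub>M borel))"
    using S unfolding borel_prod .
  have "emeasure lborel S = (\<integral>\<^sup>+ q. indicator S q \<partial>lborel)" using S by simp
  also have "\<dots> = (\<integral>\<^sup>+ q. indicator S q \<partial>(lborel \<Otimes>\<^sub>M lborel))" by (simp only: lborel_prod)
  also have "\<dots> = (\<integral>\<^sup>+ x. \<integral>\<^sup>+ p. indicator S (x, p) \<partial>lborel \<partial>lborel)"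
    using S by (subst lborel.nn_integral_fst[symmetric]) (auto simp: lborel_prod)
  also have "\<dots> = (\<integral>\<^sup>+ x. \<integral>\<^sup>+ \<psi>. \<integral>\<^sup>+ y. indicator S (x, y, \<psi>) \<partial>lborel \<partial>lborel \<partial>lborel)"
  proof (rule nn_integral_cong)
    fix x :: real
    have "(\<lambda>p. indicator S (x, p) :: ennreal) \<in> borel_measurable (lborel \<Otimes>\<^sub>M lborel)"
      by measurable
    from lborel_pair.nn_integral_snd[OF this]
    show "(\<integral>\<^sup>+ p. indicator S (x, p) \<partial>lborel) = (\<integral>\<^sup>+ \<psi>. \<integral>\<^sup>+ y. indicator S (x, y, \<psi>) \<partial>lborel \<partial>lborel)"
      by (simp add: lborel_prod)
  qed
  also have "\<dots> = (\<integral>\<^sup>+ \<psi>. \<integral>\<^sup>+ x. \<integral>\<^sup>+ y. indicator S (x, y, \<psi>) \<partial>lborel \<partial>lborel \<partial>lborel)"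
    by (rule lborel_pair.Fubini') measurable
  also have "\<dots> = (\<integral>\<^sup>+ \<psi>. emeasure lborel {v. (fst v, snd v, \<psi>) \<in> S} \<partial>lborel)"
  proof (rule nn_integral_cong)
    fix \<psi> :: real
    have m: "{v. (fst v, snd v, \<psi>) \<in> S} \<in> sets borel"
      using measurable_sets[of "\<lambda>v. (fst v, snd v, \<psi>)" borel borel S] S
      by (simp add: borel_measurable_continuous_onI continuous_intros vimage_def)
    have "(\<integral>\<^sup>+ y. indicator S (x, y, \<psi>) \<partial>lborel) = emeasure lborel (Pair x -` {v. (fst v, snd v, \<psi>) \<in> S})" for x
    proof -
      have "Pair x -` {v. (fst v, snd v, \<psi>) \<in> S} \<in> sets borel"
        using measurable_sets[of "Pair x" borel borel "{v. (fst v, snd v, \<psi>) \<in> S}"] m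
        by (simp add: borel_measurable_continuous_onI continuous_intros)
      moreover have "(\<lambda>y. indicator S (x, y, \<psi>) :: ennreal) = indicator (Pair x -` {v. (fst v, snd v, \<psi>) \<in> S})"
        by (rule ext) (simp add: indicator_def)
      ultimately show ?thesis by simp
    qed
    then show "(\<integral>\<^sup>+ x. \<integral>\<^sup>+ y. indicator S (x, y, \<psi>) \<partial>lborel \<partial>lborel) = emeasure lborel {v. (fst v, snd v, \<psi>) \<in> S}"
      by (simp add: emeasure_lborel_slices_fst[OF m])
  qed
  finally show ?thesis .
qed

definition positions_with :: "real \<times> real \<Rightarrow> (real \<times> real) set \<Rightarrow> (real \<times> real \<times> real) set" where
  "positions_with c B = {q \<in> positions. rel_center c q \<in> B}"

lemma positions_with_borel:
  assumes "B \<in> sets borel"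
  shows "positions_with c B \<in> sets borel"
proof -
  have "rel_center c -` B \<in> sets borel"
    using measurable_sets[OF borel_measurable_continuous_onI[OF continuous_rel_center] assms, of c] by simp
  moreover have "positions \<in> sets borel"
    unfolding positions_def borel_prod[symmetric] by (intro pair_measureI) auto
  ultimately show ?thesis by (auto simp: positions_with_def Int_def[symmetric] Collect_conj_eq vimage_def)
qed

text \<open>For a fixed direction the relative centre depends on the origin of the frame by a rigid motion, so all
slices have the same area.\<close>

lemma emeasure_positions_with:
  assumes B: "B \<in> sets borel"
  shows "emeasure lborel (positions_with c B) = 2 * pi * emeasure lborel B"
proof -
  have "emeasure lborel (positions_with c B) = (\<integral>\<^sup>+ \<psi>. emeasure lborel B * indicator {0..<2 * pi} \<psi> \<partial>lborel)"
    unfolding emeasure_lborel_slices_angle[OF positions_with_borel[OF B]]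
  proof (rule nn_integral_cong)
    fix \<psi> :: real
    show "emeasure lborel {v. (fst v, snd v, \<psi>) \<in> positions_with c B} = emeasure lborel B * indicator {0..<2 * pi} \<psi>"
      using emeasure_rel_center_slice[OF B, of c \<psi>]
      by (cases "\<psi> \<in> {0..<2 * pi}") (auto simp: positions_with_def positions_def)
  qed
  also have "\<dots> = emeasure lborel B * ennreal (2 * pi)"
    by (subst nn_integral_cmult_indicator) auto
  finally show ?thesis by (simp add: mult.commute)
qed

text \<open>The sets of positions in question are described by their relative centres only up to the null set of
tangential positions.\<close>

lemma positions_with_measure:
  assumes B: "B \<in> sets borel" "emeasure lborel B < \<infinity>"
    and eq: "S - positions_with c T \<subseteq> positions_with c B" "positions_with c B - positions_with c T \<subseteq> S"
    and T: "T \<in> null_sets lborel"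
  shows "S \<in> lmeasurable" and "kinematic_measure S = 2 * pi * measure lborel B"
proof -
  let ?P = "positions_with c B"
  have PT: "positions_with c T \<in> null_sets lebesgue"
  proof -
    have "emeasure lborel (positions_with c T) = 0" "positions_with c T \<in> sets lborel"
      using null_setsD1[OF T] null_setsD2[OF T] emeasure_positions_with[of T c] positions_with_borel[of T c]
      by simp_all
    then show ?thesis by (intro null_sets_completionI) auto
  qed
  have "emeasure lborel ?P < \<infinity>" and mP: "measure lborel ?P = 2 * pi * measure lborel B"
    using B emeasure_positions_with[OF B(1), of c]
    by (auto simp: ennreal_mult_less_top measure_def enn2real_mult)
  then have P: "?P \<in> lmeasurable"
    using positions_with_borel[OF B(1), of c] by (simp add: fmeasurable_def)
  have null: "(?P - S) \<union> (S - ?P) \<in> null_sets lebesgue"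
    by (rule null_sets_completion_subset[OF _ PT]) (use eq in blast)
  show S: "S \<in> lmeasurable"
    by (rule lmeasurable_negligible_symdiff[OF P]) (use null in \<open>simp add: negligible_iff_null_sets\<close>)
  have "measure lebesgue S = measure lebesgue ?P"
    by (rule measure_negligible_symdiff[OF P]) (use null in \<open>simp add: negligible_iff_null_sets\<close>)
  then show "kinematic_measure S = 2 * pi * measure lborel B"
    using mP positions_with_borel[OF B(1), of c] by (simp add: kinematic_measure_def)
qed

lemma place_eq: "place (x, y, \<psi>) v = (x, y) + plane_rotation (cos \<psi>) (sin \<psi>) v"
  by (cases v) (simp add: plane_rotation_def algebra_simps)

lemma place_rel_center: "place q (rel_center c q) = c"
proof -
  obtain x y \<psi> where q: "q = (x, y, \<psi>)" by (cases q)
  obtain p s where c: "c = (p, s)" by fastforce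
  define u w where "u = cos \<psi>" and "w = sin \<psi>"
  have uw: "u\<^sup>2 + w\<^sup>2 = 1" by (simp add: u_def w_def)
  have "u * (u * (p - x) + w * (s - y)) - w * (- w * (p - x) + u * (s - y)) = p - x"
    "w * (u * (p - x) + w * (s - y)) + u * (- w * (p - x) + u * (s - y)) = s - y"
    using uw by algebra+
  then show ?thesis
    unfolding q c place_eq rel_center_def by (simp add: plane_rotation_def u_def w_def)
qed

lemma dist_place: "dist (place q v) (place q v') = dist v v'"
proof -
  obtain x y \<psi> where q: "q = (x, y, \<psi>)" by (cases q)
  obtain p s p' s' where v: "v = (p, s)" "v' = (p', s')" by fastforce
  define u w where "u = cos \<psi>" and "w = sin \<psi>"
  have uw: "u\<^sup>2 + w\<^sup>2 = 1" by (simp add: u_def w_def)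
  have "(x + p * u - s * w - (x + p' * u - s' * w))\<^sup>2 + (y + p * w + s * u - (y + p' * w + s' * u))\<^sup>2
    = (p - p')\<^sup>2 + (s - s')\<^sup>2"
    using uw by algebra
  then show ?thesis by (simp add: q v dist_prod_def dist_real_def u_def w_def)
qed

lemma dist_place_center: "dist (place q v) c = dist v (rel_center c q)"
  using dist_place[of q v "rel_center c q"] by (simp add: place_rel_center)

lemma surj_place: "surj (place q)"
  by (rule surjI[of "place q" "\<lambda>c. rel_center c q"]) (rule place_rel_center)

lemma inj_place: "inj (place q)"
  by (rule injI) (metis dist_place dist_eq_0_iff)

text \<open>The infimum runs over the orders of non-vanishing derivatives; order zero is excluded by the zero, and order one
is attained.\<close>

lemma vanishing_order_simple_zero:
  assumes "(f has_real_derivative d) (at t)" "f t = 0" "d \<noteq> 0"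
  shows "vanishing_order f t = 1"
proof -
  have "deriv f t = d" using assms(1) by (rule DERIV_imp_deriv)
  then have one: "1 \<in> {n. (deriv ^^ n) f t \<noteq> 0}" using assms by simp
  have "vanishing_order f t \<le> enat 1"
    unfolding vanishing_order_def using one by (rule INF_lower)
  moreover have "enat 1 \<le> vanishing_order f t"
    unfolding vanishing_order_def
  proof (rule INF_greatest)
    fix n assume "n \<in> {n. (deriv ^^ n) f t \<noteq> 0}"
    then have "n \<noteq> 0" using assms(2) by (cases n) auto
    then show "enat 1 \<le> enat n" by simp
  qed
  ultimately show ?thesis by (simp add: one_enat_def)
qed

context circle_and_ellipse
begin

lemma ellipse_curve_eq: "ellipse_curve a b q = place q ` C"
  by (simp add: ellipse_curve_def C_def)

lemma ellipse_region_eq: "ellipse_region a b q = place q ` K"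
  by (simp add: ellipse_region_def K_def)

lemma ellipse_param_eq: "ellipse_param a b q t = place q (E t)"
  by (simp add: ellipse_param_def E_def)

lemma circle_poly_param: "circle_poly c r (ellipse_param a b q t) = gap (rel_center c q) t"
proof -
  have "circle_poly c r p = (dist p c)\<^sup>2 - r\<^sup>2" for p
    by (simp add: circle_poly_def dist_prod_def dist_real_def)
  then show ?thesis by (simp add: ellipse_param_eq dist_place_center gap_dist)
qed

lemma inj_E: "inj_on E {0..<2 * pi}"
proof (rule inj_onI)
  fix s t assume "s \<in> {0..<2 * pi}" "t \<in> {0..<2 * pi}" "E s = E t"
  then have "cis s = cis t" using a b by (simp add: E_def complex_eq_iff)
  from inj_onD[OF inj_on_cis this] show "s = t"
    using \<open>s \<in> {0..<2 * pi}\<close> \<open>t \<in> {0..<2 * pi}\<close> by blast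
qed

text \<open>All multiplicities are one, so the intersection number is the number of zeros of \<open>gap\<close>.\<close>

lemma intersection_number_generic:
  assumes v: "rel_center c q \<notin> tangency_set"
  shows "intersection_number c r a b q = enat (2 * up_count (rel_center c q))"
proof -
  define Z where "Z = {t \<in> {0..<2 * pi}. gap (rel_center c q) t = 0}"
  have inj: "inj_on (ellipse_param a b q) {0..<2 * pi}"
  proof -
    have "ellipse_param a b q = place q \<circ> E" by (rule ext) (simp add: ellipse_param_eq)
    then show ?thesis by (simp only: comp_inj_on[OF inj_E inj_on_subset[OF inj_place subset_UNIV]])
  qed
  have I: "sphere c r \<inter> ellipse_curve a b q = ellipse_param a b q ` Z"
  proof -
    have "ellipse_param a b q t \<in> sphere c r \<longleftrightarrow> gap (rel_center c q) t = 0" for t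
      by (simp add: gap_eq_0_iff ellipse_param_eq dist_place_center dist_commute[of c])
    moreover have "ellipse_curve a b q = ellipse_param a b q ` {0..<2 * pi}"
      by (simp add: ellipse_curve_eq C_eq_image_E ellipse_param_eq[abs_def] image_image)
    ultimately show ?thesis by (auto simp: Z_def)
  qed
  have "finite Z" by (rule finite_subset[OF _ finite_zeros[OF v]]) (auto simp: Z_def)
  have mult: "intersection_multiplicity c r a b q (ellipse_param a b q t) = 1" if "t \<in> Z" for t
  proof -
    have t: "t \<in> {0..<2 * pi}" "gap (rel_center c q) t = 0" using that by (auto simp: Z_def)
    have "(THE s. s \<in> {0..<2 * pi} \<and> ellipse_param a b q s = ellipse_param a b q t) = t"
      using t(1) inj by (intro the_equality) (auto dest: inj_onD)
    then show ?thesis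
      unfolding intersection_multiplicity_def circle_poly_param
      using vanishing_order_simple_zero[OF gap_deriv t(2) simple_zeros[OF v t(2)]] by simp
  qed
  have "intersection_number c r a b q = (\<Sum>p\<in>ellipse_param a b q ` Z. intersection_multiplicity c r a b q p)"
    using \<open>finite Z\<close> by (simp add: intersection_number_def I Let_def)
  also have "\<dots> = (\<Sum>t\<in>Z. intersection_multiplicity c r a b q (ellipse_param a b q t))"
    by (rule sum.reindex_cong[of "ellipse_param a b q" Z])
       (auto intro: inj_on_subset[OF inj] simp: Z_def)
  also have "\<dots> = (\<Sum>t\<in>Z. 1)" by (intro sum.cong mult) simp_all
  also have "\<dots> = of_nat (card Z)" by simp
  also have "\<dots> = enat (2 * up_count (rel_center c q))"
    using card_zeros[OF v] by (simp add: Z_def of_nat_eq_enat)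
  finally show ?thesis .
qed

lemma pos_points_measure:
  assumes "j > 0"
  shows "pos_points (2 * j) c r a b \<in> lmeasurable"
    and "kinematic_measure (pos_points (2 * j) c r a b) = 2 * pi * measure lborel (crossing j)"
proof -
  have count: "q \<in> pos_points (2 * j) c r a b \<longleftrightarrow> q \<in> positions_with c (crossing j)"
    if "q \<notin> positions_with c tangency_set" for q
  proof (cases "q \<in> positions")
    case True
    with that have "rel_center c q \<notin> tangency_set" by (simp add: positions_with_def)
    with True intersection_number_generic[of c q] show ?thesis
      by (simp add: pos_points_def positions_with_def crossing_def)
  qed (simp add: pos_points_def positions_with_def)
  then have 1: "pos_points (2 * j) c r a b - positions_with c tangency_set \<subseteq> positions_with c (crossing j)"
    and 2: "positions_with c (crossing j) - positions_with c tangency_set \<subseteq> pos_points (2 * j) c r a b"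
    by blast+
  show "pos_points (2 * j) c r a b \<in> lmeasurable"
    "kinematic_measure (pos_points (2 * j) c r a b) = 2 * pi * measure lborel (crossing j)"
    using positions_with_measure[OF crossing_borel crossing_finite[OF assms] 1 2 tangency_set_null] by auto
qed

lemma ellipse_in_disk_iff: "ellipse_curve a b q \<subseteq> cball c r \<longleftrightarrow> rel_center c q \<in> enclosing"
proof -
  have "ellipse_curve a b q \<subseteq> cball c r \<longleftrightarrow> (\<forall>e\<in>C. dist (place q e) c \<le> r)"
    unfolding ellipse_curve_eq by (auto simp: dist_commute)
  also have "\<dots> \<longleftrightarrow> rel_center c q \<in> enclosing"
    unfolding dist_place_center enclosing_def by (auto simp: dist_commute)
  finally show ?thesis .
qed

lemma circle_in_ellipse_iff: "sphere c r \<subseteq> ellipse_region a b q \<longleftrightarrow> rel_center c q \<in> enclosed"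
proof
  assume s: "sphere c r \<subseteq> ellipse_region a b q"
  show "rel_center c q \<in> enclosed"
    unfolding enclosed_def
  proof clarify
    fix x y assume "(x, y) \<in> sphere (rel_center c q) r"
    then have "place q (x, y) \<in> sphere c r"
      using dist_place_center[of q "(x, y)" c] by (simp add: dist_commute)
    with s have "place q (x, y) \<in> place q ` K" by (auto simp: ellipse_region_eq)
    then show "(x, y) \<in> K" using inj_place by (metis inj_image_mem_iff)
  qed
next
  assume e: "rel_center c q \<in> enclosed"
  show "sphere c r \<subseteq> ellipse_region a b q"
  proof
    fix p assume p: "p \<in> sphere c r"
    obtain v where v: "p = place q v" using surj_place by (metis surjD)
    then have "v \<in> sphere (rel_center c q) r"
      using p dist_place_center[of q v c] by (simp add: dist_commute)
    with e v show "p \<in> ellipse_region a b q" by (auto simp: enclosed_def ellipse_region_eq)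
  qed
qed

lemma positions_measure_compact:
  assumes "compact B"
  shows "positions_with c B \<in> lmeasurable" "kinematic_measure (positions_with c B) = 2 * pi * measure lborel B"
  using positions_with_measure[of B "positions_with c B" c "{}"] compact_measure_facts[OF assms] by auto

lemma centers_measure:
  assumes "compact B"
  shows "{(x, y). rel_center c (x, y, \<psi>) \<in> B} \<in> lmeasurable"
    and "measure lebesgue {(x, y). rel_center c (x, y, \<psi>) \<in> B} = measure lborel B"
proof -
  have eq: "{(x, y). rel_center c (x, y, \<psi>) \<in> B} = (\<lambda>v. rel_center c (fst v, snd v, \<psi>)) -` B" by auto
  have B: "B \<in> sets borel" using assms by (rule borel_compact)
  have "continuous_on UNIV (\<lambda>v. rel_center c (fst v, snd v, \<psi>))"
    by (rule continuous_on_compose2[OF continuous_rel_center]) (auto intro!: continuous_intros)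
  from measurable_sets[OF borel_measurable_continuous_onI[OF this] B]
  have m: "{(x, y). rel_center c (x, y, \<psi>) \<in> B} \<in> sets borel" unfolding eq by simp
  have e: "emeasure lborel {(x, y). rel_center c (x, y, \<psi>) \<in> B} = emeasure lborel B"
    using emeasure_rel_center_slice[OF B, of c \<psi>] by (simp add: case_prod_unfold)
  with m compact_measure_facts(2)[OF assms] show "{(x, y). rel_center c (x, y, \<psi>) \<in> B} \<in> lmeasurable"
    by (simp add: fmeasurable_def)
  from e m show "measure lebesgue {(x, y). rel_center c (x, y, \<psi>) \<in> B} = measure lborel B"
    by (simp add: measure_def)
qed

lemma pos10_eq: "pos10 c r a b = positions_with c enclosing"
  by (simp add: pos10_def positions_with_def ellipse_in_disk_iff)

lemma pos01_eq: "pos01 c r a b = positions_with c enclosed"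
  by (simp add: pos01_def positions_with_def circle_in_ellipse_iff)

lemma centers_eq: "centers10 c r a b \<psi> = {(x, y). rel_center c (x, y, \<psi>) \<in> enclosing}"
  "centers01 c r a b \<psi> = {(x, y). rel_center c (x, y, \<psi>) \<in> enclosed}"
  by (simp_all add: centers10_def centers01_def ellipse_in_disk_iff circle_in_ellipse_iff)

text \<open>At most one of the two areas differs from zero, because the enclosing disks need \<open>r > a\<close> and the enclosed ones
need \<open>r < b\<close>, up to a single centre in the limiting cases.\<close>

lemma m_i_eq: "m_i c r a b = 2 * pi * (measure lborel enclosing + measure lborel enclosed)"
proof -
  consider "a < r" | "b > r" | "b \<le> r" "r \<le> a" using ab by linarith
  then show ?thesis
  proof cases
    case 1
    with ab have enclosed_zero: "measure lborel enclosed = 0" by (intro enclosed_null) simp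
    show ?thesis
      using 1 positions_measure_compact(2)[OF enclosing_compact_convex(1)]
      by (simp add: m_i_def pos10_eq enclosed_zero)
  next
    case 2
    with ab have "\<not> a < r" by linarith
    then have enclosing_zero: "measure lborel enclosing = 0" by (intro enclosing_null) simp
    show ?thesis
      using 2 \<open>\<not> a < r\<close> positions_measure_compact(2)[OF enclosed_compact_convex(1)]
      by (simp add: m_i_def pos01_eq enclosing_zero)
  next
    case 3
    then show ?thesis by (simp add: m_i_def enclosing_null enclosed_null)
  qed
qed

end

theorem theorem4p1:
  fixes a b r :: real and c :: "real \<times> real"
  assumes "a \<ge> b" and "b > 0" and "r > 0"
  shows
    "pos_points 2 c r a b \<in> lmeasurable
     \<and> kinematic_measure (pos_points 2 c r a b)
         = 4 * pi^2 * r^2 + 4 * pi^2 * a * b - 2 * m_i c r a b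
     \<and> pos_points 4 c r a b \<in> lmeasurable
     \<and> kinematic_measure (pos_points 4 c r a b)
         = 8 * pi * r * a * complete_ellint_E (eccentricity a b)
           - 2 * pi^2 * r^2 - 2 * pi^2 * a * b + m_i c r a b
     \<and> (a < r \<longrightarrow> pos10 c r a b \<in> lmeasurable
         \<and> (\<forall>\<psi>\<in>{0..<2*pi}. centers10 c r a b \<psi> \<in> lmeasurable
             \<and> kinematic_measure (pos10 c r a b) = 2 * pi * measure lebesgue (centers10 c r a b \<psi>)
             \<and> measure lebesgue (centers10 c r a b \<psi>)
                 = (if a^2 / b \<le> r
                    then pi * r^2 + pi * a * b - 4 * r * a * complete_ellint_E (eccentricity a b)
                    else F r a b (beta r a b))))
     \<and> (b > r \<longrightarrow> pos01 c r a b \<in> lmeasurable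
         \<and> (\<forall>\<psi>\<in>{0..<2*pi}. centers01 c r a b \<psi> \<in> lmeasurable
             \<and> kinematic_measure (pos01 c r a b) = 2 * pi * measure lebesgue (centers01 c r a b \<psi>)
             \<and> measure lebesgue (centers01 c r a b \<psi>)
                 = (if b^2 / a < r
                    then F_tilde r a b (alpha r a b)
                    else pi * r^2 + pi * a * b - 4 * r * a * complete_ellint_E (eccentricity a b))))"
proof -
  interpret circle_and_ellipse a b r using assms by unfold_locales
  have p2: "pos_points 2 c r a b \<in> lmeasurable"
    "kinematic_measure (pos_points 2 c r a b) = 2 * pi * measure lborel (crossing 1)"
    using pos_points_measure[of 1 c] by simp_all
  have p4: "pos_points 4 c r a b \<in> lmeasurable"
    "kinematic_measure (pos_points 4 c r a b) = 2 * pi * measure lborel (crossing 2)"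
    using pos_points_measure[of 2 c] by simp_all
  have m2: "kinematic_measure (pos_points 2 c r a b) = 4 * pi^2 * r^2 + 4 * pi^2 * a * b - 2 * m_i c r a b"
    unfolding p2(2) crossing_measures m_i_eq by (simp add: algebra_simps power2_eq_square)
  have m4: "kinematic_measure (pos_points 4 c r a b) = 8 * pi * r * a * complete_ellint_E (eccentricity a b)
           - 2 * pi^2 * r^2 - 2 * pi^2 * a * b + m_i c r a b"
    unfolding p4(2) crossing_measures m_i_eq by (simp add: algebra_simps power2_eq_square)
  note cc = enclosing_compact_convex(1) and cd = enclosed_compact_convex(1)
  show ?thesis
    using p2(1) m2 p4(1) m4 enclosing_area enclosed_area
      positions_measure_compact[OF cc, of c] positions_measure_compact[OF cd, of c]
      centers_measure[OF cc, of c] centers_measure[OF cd, of c]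
    by (simp add: pos10_eq pos01_eq centers_eq)
qed

end
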